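(* Let $T>0$, $\gamma_0<0<\gamma_2$, $\delta_0,\delta_2\in\mathbb{R}$, $\xi\in C^{1+\beta}([0,T])$ decreasing with $\beta>1/2$, $\xi(0)=0$, $K=\xi(T)\le0$; let $u_0\in C^2(\mathbb{R}^+)\cap L^\infty(\mathbb{R}^+)$ with $u_0'\in L^1(\mathbb{R}^+)$, $u_0''\in L^\infty(\mathbb{R}^+)$, and $u_T\in C^2((-\infty,K))$ with $u_T'\in L^1((-\infty,K))$, $u_T''\in L^\infty((-\infty,K))$. For an unknown function $m$ on $[0,T]$ set $g_0^+=(m-\delta_2)/\gamma_2$, $g_0^-=(m-\delta_0)/\gamma_0$, and let $N_1,N_2,K_1,K_2$ (depending on $m$ through $g_0^\pm$) and $G_1,G_2$ be as in the context. Then the equation, for all $t\in(0,T)$, $$\xi'(t)\Big(\frac{m(t)-\delta_2}{\gamma_2}-\frac{m(t)-\delta_0}{\gamma_0}\Big)=\frac{|\gamma_0|N_1(\tau_1)}{\pi}+\frac{|\gamma_0|}{\pi^2}\int_0^{\tau_1}\!\big(K_1(s,\tau_1)+G_1(\tau_1,s)\big)N_1(s)ds-\frac{\gamma_2N_2(\tau_2)}{\pi}-\frac{\gamma_2}{\pi^2}\int_0^{\tau_2}\!\big(K_2(s,\tau_2)+G_2(\tau_2,s)\big)N_2(s)ds,$$ where $\tau_1=|\gamma_0|(T-t)$, $\tau_2=\gamma_2t$, is equivalent to a generalized Abel equation of the first kind $$\int_0^t\frac{k_1(t,s)}{\sqrt{t-s}}m'(s)\,ds+\int_t^T\frac{k_2(t,s)}{\sqrt{s-t}}m'(s)\,ds=h(t),$$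 where $k_1$ is Hölder continuous of order $1/2$ on $\overline{C}_T$, $C_T=\{(t,s):0<s<t<T\}$, $k_2$ is Hölder continuous of order $1/2$ on $[0,T]\times[0,T]\setminus C_T$, and $h\in C^{1/2}([0,T])$ depends only on $u_0'$, $u_T'$ and $m(0)$ (besides the fixed data $\xi,\gamma_i,\delta_i$).
   Context: $\overline\xi(\tau)=\xi(\tau/\gamma_2)$, $\underline\xi(\tau)=K-\xi(T-\tau/|\gamma_0|)$. For $0<s<\tau$: $K_2(s,\tau)=\frac{\sqrt\pi}{2}\frac{\overline\xi(\tau)-\overline\xi(s)}{\tau-s}\frac{e^{-(\overline\xi(\tau)-\overline\xi(s))^2/(4(\tau-s))}}{(\tau-s)^{1/2}}$ ($\tau<\gamma_2T$) and $K_1$ is the same expression with $\underline\xi$ in place of $\overline\xi$ ($\tau<|\gamma_0|T$). $N_2(\tau)=\sqrt\pi\big[\tau^{-1/2}\int_0^\infty e^{-(\overline\xi(\tau)-x)^2/(4\tau)}u_0'(x)dx-\int_0^\tau\frac{e^{-(\overline\xi(\tau)-\overline\xi(s))^2/(4(\tau-s))}}{(\tau-s)^{1/2}}\frac{(g_0^+)'(s/\gamma_2)}{\gamma_2}ds\big]$, $N_1(\tau)=\sqrt\pi\big[-\tau^{-1/2}\int_0^\infty e^{-(\underline\xi(\tau)-x)^2/(4\tau)}u_T'(K-x)dx+\int_0^\tau\frac{e^{-(\underline\xi(\tau)-\underline\xi(s))^2/(4(\tau-s))}}{(\tau-s)^{1/2}}\frac{(g_0^-)'(T-s/|\gamma_0|)}{|\gamma_0|}ds\big]$.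 For $i=1,2$, with $L_i$ the length of the time interval ($L_1=|\gamma_0|T$, $L_2=\gamma_2T$), let $H_1^{(i)}(t,s)=\frac1\pi K_i(s,t)\mathbf 1_{(0,t)}(s)$, $H_n^{(i)}(t,s)=\int_0^{L_i}H_{n-1}^{(i)}(t,z)H_1^{(i)}(z,s)dz$, and $G_i$ is the Hölder continuous function such that $\frac1\pi(K_i(s,t)+G_i(t,s))$ is the resolvent kernel of the Volterra equation $\pi f(\tau)=N(\tau)+\int_0^\tau K_i(s,\tau)f(s)ds$, so that its solution is $f(t)=N(t)/\pi+\pi^{-2}\int_0^t(K_i(s,t)+G_i(t,s))N(s)ds$. The equation in the claim is the Rankine–Hugoniot condition $\xi'(t)=\frac{u^-_x(\xi(t),t)\cdot(-|\gamma_0|)\cdot(-1)-\gamma_2u^+_x(\xi(t),t)}{g_0^+(t)-g_0^-(t)}$ written via these Dirichlet-to-Neumann formulas. *)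

theory Defs
  imports "HOL-Analysis.Analysis"
begin

definition holder_on :: "real \<Rightarrow> 'a::metric_space set \<Rightarrow> ('a \<Rightarrow> real) \<Rightarrow> bool" where
  "holder_on a S f \<longleftrightarrow> (\<exists>C. \<forall>x\<in>S. \<forall>y\<in>S. dist (f x) (f y) \<le> C * dist x y powr a)"

definition C1b_on :: "real \<Rightarrow> real \<Rightarrow> real \<Rightarrow> (real \<Rightarrow> real) \<Rightarrow> bool" where
  "C1b_on b a0 b0 f \<longleftrightarrow> (\<exists>f'. (\<forall>x\<in>{a0..b0}. (f has_real_derivative f' x) (at x within {a0..b0}))
       \<and> holder_on b {a0..b0} f')"

definition C1_on :: "real \<Rightarrow> real \<Rightarrow> (real \<Rightarrow> real) \<Rightarrow> bool" where
  "C1_on a0 b0 f \<longleftrightarrow> (\<exists>f'. (\<forall>x\<in>{a0..b0}. (f has_real_derivative f' x) (at x within {a0..b0}))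
       \<and> continuous_on {a0..b0} f')"

definition C2_open :: "real set \<Rightarrow> (real \<Rightarrow> real) \<Rightarrow> bool" where
  "C2_open S f \<longleftrightarrow> (\<forall>x\<in>S. f differentiable at x \<and> deriv f differentiable at x)
       \<and> continuous_on S (deriv (deriv f))"

definition Kker :: "(real \<Rightarrow> real) \<Rightarrow> real \<Rightarrow> real \<Rightarrow> real \<Rightarrow> real" where
  "Kker xb L s \<tau> = (if 0 < s \<and> s < \<tau> \<and> \<tau> < L then
      sqrt pi / 2 * ((xb \<tau> - xb s) / (\<tau> - s)) *
      (exp (- (xb \<tau> - xb s)\<^sup>2 / (4 * (\<tau> - s))) / sqrt (\<tau> - s)) else 0)"

text \<open>Iterated kernels: Hit xb L n = H_{n+1}.\<close>
definition H1ker :: "(real \<Rightarrow> real) \<Rightarrow> real \<Rightarrow> real \<Rightarrow> real \<Rightarrow> real" where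
  "H1ker xb L t s = (1 / pi) * Kker xb L s t * indicator {0<..<t} s"

primrec Hit :: "(real \<Rightarrow> real) \<Rightarrow> real \<Rightarrow> nat \<Rightarrow> real \<Rightarrow> real \<Rightarrow> real" where
  "Hit xb L 0 t s = H1ker xb L t s"
| "Hit xb L (Suc n) t s = integral {0..L} (\<lambda>z. Hit xb L n t z * H1ker xb L z s)"

text \<open>G_i, defined so that (K_i(s,t) + G_i(t,s))/pi = sum_{n>=1} H_n(t,s) is the resolvent kernel.\<close>
definition Gker :: "(real \<Rightarrow> real) \<Rightarrow> real \<Rightarrow> real \<Rightarrow> real \<Rightarrow> real" where
  "Gker xb L t s = pi * (\<Sum>n. Hit xb L (Suc n) t s)"

definition xi_up :: "(real \<Rightarrow> real) \<Rightarrow> real \<Rightarrow> real \<Rightarrow> real" where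
  "xi_up \<xi> \<gamma>2 \<tau> = \<xi> (\<tau> / \<gamma>2)"

definition xi_lo :: "(real \<Rightarrow> real) \<Rightarrow> real \<Rightarrow> real \<Rightarrow> real \<Rightarrow> real" where
  "xi_lo \<xi> T \<gamma>0 \<tau> = \<xi> T - \<xi> (T - \<tau> / \<bar>\<gamma>0\<bar>)"

definition N2fun :: "(real \<Rightarrow> real) \<Rightarrow> real \<Rightarrow> (real \<Rightarrow> real) \<Rightarrow> (real \<Rightarrow> real) \<Rightarrow> real \<Rightarrow> real" where
  "N2fun \<xi> \<gamma>2 u0' gp \<tau> = sqrt pi *
     ( (1 / sqrt \<tau>) * integral {0<..} (\<lambda>x. exp (- (xi_up \<xi> \<gamma>2 \<tau> - x)\<^sup>2 / (4 * \<tau>)) * u0' x)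
     - integral {0..\<tau>} (\<lambda>s. exp (- (xi_up \<xi> \<gamma>2 \<tau> - xi_up \<xi> \<gamma>2 s)\<^sup>2 / (4 * (\<tau> - s)))
           / sqrt (\<tau> - s) * (deriv gp (s / \<gamma>2) / \<gamma>2)))"

definition N1fun :: "(real \<Rightarrow> real) \<Rightarrow> real \<Rightarrow> real \<Rightarrow> (real \<Rightarrow> real) \<Rightarrow> (real \<Rightarrow> real) \<Rightarrow> real \<Rightarrow> real" where
  "N1fun \<xi> T \<gamma>0 uT' gm \<tau> = sqrt pi *
     ( - (1 / sqrt \<tau>) * integral {0<..} (\<lambda>x. exp (- (xi_lo \<xi> T \<gamma>0 \<tau> - x)\<^sup>2 / (4 * \<tau>)) * uT' (\<xi> T - x))
     + integral {0..\<tau>} (\<lambda>s. exp (- (xi_lo \<xi> T \<gamma>0 \<tau> - xi_lo \<xi> T \<gamma>0 s)\<^sup>2 / (4 * (\<tau> - s)))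
           / sqrt (\<tau> - s) * (deriv gm (T - s / \<bar>\<gamma>0\<bar>) / \<bar>\<gamma>0\<bar>)))"

text \<open>The Rankine--Hugoniot equation written via the Dirichlet-to-Neumann formulas, at time t.\<close>
definition RH_eq :: "real \<Rightarrow> real \<Rightarrow> real \<Rightarrow> real \<Rightarrow> real \<Rightarrow> (real \<Rightarrow> real) \<Rightarrow>
    (real \<Rightarrow> real) \<Rightarrow> (real \<Rightarrow> real) \<Rightarrow> (real \<Rightarrow> real) \<Rightarrow> real \<Rightarrow> bool" where
  "RH_eq T \<gamma>0 \<gamma>2 \<delta>0 \<delta>2 \<xi> u0' uT' m t \<longleftrightarrow>
    (let gp = (\<lambda>t. (m t - \<delta>2) / \<gamma>2); gm = (\<lambda>t. (m t - \<delta>0) / \<gamma>0);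
         L1 = \<bar>\<gamma>0\<bar> * T; L2 = \<gamma>2 * T;
         x1 = xi_lo \<xi> T \<gamma>0; x2 = xi_up \<xi> \<gamma>2;
         N1 = N1fun \<xi> T \<gamma>0 uT' gm; N2 = N2fun \<xi> \<gamma>2 u0' gp;
         \<tau>1 = \<bar>\<gamma>0\<bar> * (T - t); \<tau>2 = \<gamma>2 * t
     in deriv \<xi> t * ((m t - \<delta>2) / \<gamma>2 - (m t - \<delta>0) / \<gamma>0) =
        \<bar>\<gamma>0\<bar> * N1 \<tau>1 / pi
        + \<bar>\<gamma>0\<bar> / pi\<^sup>2 * integral {0..\<tau>1} (\<lambda>s. (Kker x1 L1 s \<tau>1 + Gker x1 L1 \<tau>1 s) * N1 s)
        - \<gamma>2 * N2 \<tau>2 / pi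
        - \<gamma>2 / pi\<^sup>2 * integral {0..\<tau>2} (\<lambda>s. (Kker x2 L2 s \<tau>2 + Gker x2 L2 \<tau>2 s) * N2 s))"

definition Abel_eq :: "real \<Rightarrow> (real \<Rightarrow> real \<Rightarrow> real) \<Rightarrow> (real \<Rightarrow> real \<Rightarrow> real) \<Rightarrow>
    (real \<Rightarrow> real) \<Rightarrow> (real \<Rightarrow> real) \<Rightarrow> real \<Rightarrow> bool" where
  "Abel_eq T k1 k2 h m t \<longleftrightarrow>
    integral {0..t} (\<lambda>s. k1 t s / sqrt (t - s) * deriv m s)
    + integral {t..T} (\<lambda>s. k2 t s / sqrt (s - t) * deriv m s) = h t"

end

theory Submission
  imports Defs "HOL-Probability.Distributions"
begin

text \<open>
  The equivalence holds pointwise in \<open>t\<close>: both equations are the same identity, written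
  differently.  A kernel is regarded as \<open>a t s / sqrt (t - s)\<close> with an amplitude \<open>a\<close>
  that is Hoelder continuous of order 1/2 on the triangle \<open>0 \<le> s < t < L\<close>.  The substitution
  \<open>z = s + (t - s) y\<close> turns the convolution of two such kernels into an integral against
  the fixed weight \<open>1 / sqrt (y (1 - y))\<close>, hence into a Hoelder continuous function.  All further
  iterates of the kernel are bounded and Hoelder continuous in \<open>t\<close>, with geometrically
  decreasing constants after weighting by \<open>exp (l (t - s))\<close>; this controls \<open>G\<close> without
  any regularity of \<open>G\<close> in \<open>s\<close>, because convolving with a weakly singular kernel on the right
  restores it.  Fubini then moves the resolvent from the datum \<open>N\<close> onto the heat kernel in front of
  \<open>m'\<close>.  The term \<open>\<xi>' m\<close> is absorbed into the kernel by writing \<open>m t\<close> as \<open>m 0\<close> plus the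
  integral of \<open>m'\<close>, and the terminal-value problem is the initial-value problem for the reflected boundary.
\<close>

section \<open>Functions that are Hoelder continuous of order 1/2\<close>

text \<open>Two kernels with a singularity of order 1/2 convolve to a kernel without singularity, so
  a single convolution already leads into bounded kernels; everything after it is a contraction
  argument. The obstacle is the edge s = 0. \<open>Kker\<close> and its iterates vanish there by
  definition, so \<open>Gker\<close> may jump at that edge, while the contribution of the initial
  datum is precisely a convolution evaluated at s = 0. Therefore the triangle contains this edge,
  amplitudes carry no cut-off, and Hoelder continuity in both variables is claimed only for
  convolutions whose right factor is such an amplitude. On the diagonal and at the end times the
  formulas degenerate to default values such as division by zero. Hoelder bounds are therefore
  proved away from these edges and extended by uniform continuity; integrals do not notice the
  change. The exponent 1/2 comes from the factors \<open>sqrt (t - s)\<close> that remain in the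
  amplitudes and from the ratio \<open>X \<tau> / sqrt \<tau>\<close> in the initial contribution;
  the exponent \<beta> of \<xi>' is lowered to it once, at the start.\<close>

lemma sqrt_diff_le:
  assumes "x \<ge> 0" "y \<ge> 0"
  shows "\<bar>sqrt x - sqrt y\<bar> \<le> sqrt \<bar>x - y\<bar>"
proof -
  have *: "sqrt a - sqrt b \<le> sqrt (a - b)" if "b \<le> a" "b \<ge> 0" for a b :: real
  proof -
    have "sqrt (b + (a - b)) \<le> sqrt b + sqrt (a - b)"
      by (rule sqrt_add_le_add_sqrt) (use that in auto)
    then show ?thesis by simp
  qed
  show ?thesis
    using *[of x y] *[of y x] assms by (cases "x \<le> y") (auto simp: abs_if)
qed

text \<open>\<open>holder_on\<close> allows a constant of either sign; its absolute value serves as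
  well and can be used in monotonicity steps.\<close>

lemma holder_half_iff:
  "holder_on (1/2) S f \<longleftrightarrow> (\<exists>C\<ge>0. \<forall>x\<in>S. \<forall>y\<in>S. \<bar>f x - f y\<bar> \<le> C * sqrt (dist x y))"
proof
  assume "holder_on (1/2) S f"
  then obtain C where C: "\<And>x y. x \<in> S \<Longrightarrow> y \<in> S \<Longrightarrow> dist (f x) (f y) \<le> C * dist x y powr (1/2)"
    unfolding holder_on_def by blast
  have "\<bar>f x - f y\<bar> \<le> \<bar>C\<bar> * sqrt (dist x y)" if "x \<in> S" "y \<in> S" for x y
    using C[OF that] mult_right_mono[OF abs_ge_self[of C], of "sqrt (dist x y)"]
    by (auto simp: dist_real_def powr_half_sqrt)
  then show "\<exists>C\<ge>0. \<forall>x\<in>S. \<forall>y\<in>S. \<bar>f x - f y\<bar> \<le> C * sqrt (dist x y)"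
    by (intro exI[of _ "\<bar>C\<bar>"]) auto
qed (auto simp: holder_on_def dist_real_def powr_half_sqrt)

lemma holder_halfD:
  "holder_on (1/2) S f \<Longrightarrow> \<exists>C\<ge>0. \<forall>x\<in>S. \<forall>y\<in>S. \<bar>f x - f y\<bar> \<le> C * sqrt (dist x y)"
  unfolding holder_half_iff .

lemma holder_halfI:
  assumes "\<And>x y. x \<in> S \<Longrightarrow> y \<in> S \<Longrightarrow> \<bar>f x - f y\<bar> \<le> C * sqrt (dist x y)"
  shows "holder_on (1/2) S f"
proof -
  have "\<bar>f x - f y\<bar> \<le> \<bar>C\<bar> * sqrt (dist x y)" if "x \<in> S" "y \<in> S" for x y
    using assms[OF that] mult_right_mono[OF abs_ge_self[of C], of "sqrt (dist x y)"] by auto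
  then show ?thesis unfolding holder_half_iff by (intro exI[of _ "\<bar>C\<bar>"]) auto
qed

lemma holder_half_subset: "holder_on (1/2) S f \<Longrightarrow> U \<subseteq> S \<Longrightarrow> holder_on (1/2) U f"
  unfolding holder_on_def by blast

lemma holder_half_cong:
  "holder_on (1/2) S f \<Longrightarrow> (\<And>x. x \<in> S \<Longrightarrow> f x = g x) \<Longrightarrow> holder_on (1/2) S g"
  unfolding holder_on_def by simp

lemma holder_half_add:
  assumes "holder_on (1/2) S f" "holder_on (1/2) S g"
  shows "holder_on (1/2) S (\<lambda>x. f x + g x)"
proof -
  obtain C where C: "\<And>x y. x \<in> S \<Longrightarrow> y \<in> S \<Longrightarrow> \<bar>f x - f y\<bar> \<le> C * sqrt (dist x y)"
    using holder_halfD[OF assms(1)] by blast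
  obtain D where D: "\<And>x y. x \<in> S \<Longrightarrow> y \<in> S \<Longrightarrow> \<bar>g x - g y\<bar> \<le> D * sqrt (dist x y)"
    using holder_halfD[OF assms(2)] by blast
  show ?thesis
  proof (rule holder_halfI[where C="C + D"])
    fix x y assume "x \<in> S" "y \<in> S"
    from C[OF this] D[OF this]
    show "\<bar>f x + g x - (f y + g y)\<bar> \<le> (C + D) * sqrt (dist x y)"
      unfolding distrib_right by linarith
  qed
qed

lemma holder_half_Lipschitz_comp:
  assumes f: "holder_on (1/2) U f" and M: "\<And>x y. x \<in> S \<Longrightarrow> y \<in> S \<Longrightarrow> dist (\<phi> x) (\<phi> y) \<le> M * dist x y"
    and "\<phi> ` S \<subseteq> U"
  shows "holder_on (1/2) S (\<lambda>x. f (\<phi> x))"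
proof -
  obtain C where C: "C \<ge> 0" "\<And>x y. x \<in> U \<Longrightarrow> y \<in> U \<Longrightarrow> \<bar>f x - f y\<bar> \<le> C * sqrt (dist x y)"
    using holder_halfD[OF f] by blast
  show ?thesis
  proof (rule holder_halfI[where C="C * sqrt M"])
    fix x y assume *: "x \<in> S" "y \<in> S"
    have "\<bar>f (\<phi> x) - f (\<phi> y)\<bar> \<le> C * sqrt (dist (\<phi> x) (\<phi> y))"
      using assms(3) * by (intro C(2)) auto
    also have "\<dots> \<le> C * sqrt (M * dist x y)"
      using M[OF *] C by (intro mult_left_mono) auto
    finally show "\<bar>f (\<phi> x) - f (\<phi> y)\<bar> \<le> C * sqrt M * sqrt (dist x y)"
      by (simp add: real_sqrt_mult)
  qed
qed

lemma Lipschitz_holder_half_comp: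
  assumes f: "holder_on (1/2) S f"
    and M: "\<And>x y. x \<in> f ` S \<Longrightarrow> y \<in> f ` S \<Longrightarrow> \<bar>\<phi> x - \<phi> y\<bar> \<le> M * \<bar>x - y\<bar>" "M \<ge> 0"
  shows "holder_on (1/2) S (\<lambda>x. \<phi> (f x))"
proof -
  obtain C where C: "C \<ge> 0" "\<And>x y. x \<in> S \<Longrightarrow> y \<in> S \<Longrightarrow> \<bar>f x - f y\<bar> \<le> C * sqrt (dist x y)"
    using holder_halfD[OF f] by blast
  show ?thesis
  proof (rule holder_halfI[where C="M * C"])
    fix x y assume *: "x \<in> S" "y \<in> S"
    have "\<bar>\<phi> (f x) - \<phi> (f y)\<bar> \<le> M * \<bar>f x - f y\<bar>" using * by (intro M(1)) auto
    also have "\<dots> \<le> M * (C * sqrt (dist x y))"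
      using C(2)[OF *] M(2) by (rule mult_left_mono)
    finally show "\<bar>\<phi> (f x) - \<phi> (f y)\<bar> \<le> M * C * sqrt (dist x y)" by simp
  qed
qed

lemma holder_half_cmult: "holder_on (1/2) S f \<Longrightarrow> holder_on (1/2) S (\<lambda>x. c * f x)"
  by (rule Lipschitz_holder_half_comp[where M="\<bar>c\<bar>" and \<phi>="\<lambda>x. c * x"])
    (simp_all add: abs_mult flip: right_diff_distrib)

lemma holder_half_bounded:
  assumes "holder_on (1/2) S f" "bounded S"
  shows "\<exists>B\<ge>0. \<forall>x\<in>S. \<bar>f x\<bar> \<le> B"
proof (cases "S = {}")
  case False
  then obtain x0 where x0: "x0 \<in> S" by blast
  obtain e where e: "\<And>y. y \<in> S \<Longrightarrow> dist x0 y \<le> e"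
    using assms(2) unfolding bounded_any_center[of S x0] by blast
  obtain C where C: "C \<ge> 0" "\<And>x y. x \<in> S \<Longrightarrow> y \<in> S \<Longrightarrow> \<bar>f x - f y\<bar> \<le> C * sqrt (dist x y)"
    using holder_halfD[OF assms(1)] by blast
  show ?thesis
  proof (intro exI[of _ "\<bar>f x0\<bar> + C * sqrt e"] conjI ballI)
    have "0 \<le> e" using e[OF x0] by simp
    then show "0 \<le> \<bar>f x0\<bar> + C * sqrt e" using C by simp
    fix x assume x: "x \<in> S"
    have "\<bar>f x0 - f x\<bar> \<le> C * sqrt (dist x0 x)" using x0 x by (rule C(2))
    also have "\<dots> \<le> C * sqrt e" using C e[OF x] by (intro mult_left_mono) auto
    finally show "\<bar>f x\<bar> \<le> \<bar>f x0\<bar> + C * sqrt e" by linarith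
  qed
qed auto

lemma holder_half_mult:
  assumes "holder_on (1/2) S f" "holder_on (1/2) S g" "bounded S"
  shows "holder_on (1/2) S (\<lambda>x. f x * g x)"
proof -
  obtain C where C: "\<And>x y. x \<in> S \<Longrightarrow> y \<in> S \<Longrightarrow> \<bar>f x - f y\<bar> \<le> C * sqrt (dist x y)"
    using holder_halfD[OF assms(1)] by blast
  obtain D where D: "\<And>x y. x \<in> S \<Longrightarrow> y \<in> S \<Longrightarrow> \<bar>g x - g y\<bar> \<le> D * sqrt (dist x y)"
    using holder_halfD[OF assms(2)] by blast
  obtain B where B: "B \<ge> 0" "\<And>x. x \<in> S \<Longrightarrow> \<bar>f x\<bar> \<le> B" using holder_half_bounded[OF assms(1,3)] by blast
  obtain A where A: "A \<ge> 0" "\<And>x. x \<in> S \<Longrightarrow> \<bar>g x\<bar> \<le> A" using holder_half_bounded[OF assms(2,3)] by blast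
  show ?thesis
  proof (rule holder_halfI[where C="B * D + A * C"])
    fix x y assume *: "x \<in> S" "y \<in> S"
    have "f x * g x - f y * g y = f x * (g x - g y) + g y * (f x - f y)"
      by (simp add: algebra_simps)
    also have "\<bar>\<dots>\<bar> \<le> \<bar>f x\<bar> * \<bar>g x - g y\<bar> + \<bar>g y\<bar> * \<bar>f x - f y\<bar>"
      by (metis abs_mult abs_triangle_ineq)
    also have "\<dots> \<le> B * (D * sqrt (dist x y)) + A * (C * sqrt (dist x y))"
      by (intro add_mono mult_mono) (use A B C D * in auto)
    finally show "\<bar>f x * g x - f y * g y\<bar> \<le> (B * D + A * C) * sqrt (dist x y)"
      by (simp add: algebra_simps)
  qed
qed

text \<open>The square root is itself Hoelder of order 1/2 down to 0. This is how the factors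
  \<open>sqrt (t - s)\<close> and \<open>sqrt \<tau>\<close> enter, and they limit the
  order.\<close>

lemma holder_half_sqrt_comp:
  assumes M: "\<And>x y. x \<in> S \<Longrightarrow> y \<in> S \<Longrightarrow> \<bar>\<phi> x - \<phi> y\<bar> \<le> M * dist x y"
    and nonneg: "\<And>x. x \<in> S \<Longrightarrow> \<phi> x \<ge> 0"
  shows "holder_on (1/2) S (\<lambda>x. sqrt (\<phi> x))"
proof (rule holder_halfI[where C="sqrt M"])
  fix x y assume *: "x \<in> S" "y \<in> S"
  have "\<bar>sqrt (\<phi> x) - sqrt (\<phi> y)\<bar> \<le> sqrt \<bar>\<phi> x - \<phi> y\<bar>" by (intro sqrt_diff_le nonneg *)
  also have "\<dots> \<le> sqrt (M * dist x y)" using M[OF *] by simp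
  finally show "\<bar>sqrt (\<phi> x) - sqrt (\<phi> y)\<bar> \<le> sqrt M * sqrt (dist x y)"
    by (simp add: real_sqrt_mult)
qed

lemma holder_half_bounded_Lipschitz:
  assumes M: "\<And>x y. x \<in> S \<Longrightarrow> y \<in> S \<Longrightarrow> \<bar>f x - f y\<bar> \<le> M * dist x y" and "bounded S"
  shows "holder_on (1/2) S f"
proof -
  obtain e where e: "\<And>x y. x \<in> S \<Longrightarrow> y \<in> S \<Longrightarrow> dist x y \<le> e"
    using assms(2) by (meson bounded_two_points)
  show ?thesis
  proof (rule holder_halfI[where C="\<bar>M\<bar> * sqrt e"])
    fix x y assume *: "x \<in> S" "y \<in> S"
    have "\<bar>f x - f y\<bar> \<le> M * dist x y" by (rule M[OF *])
    also have "\<dots> \<le> \<bar>M\<bar> * (sqrt (dist x y) * sqrt (dist x y))" by (simp add: mult_right_mono)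
    also have "\<dots> \<le> \<bar>M\<bar> * (sqrt e * sqrt (dist x y))"
      by (intro mult_left_mono mult_right_mono) (use e[OF *] in auto)
    finally show "\<bar>f x - f y\<bar> \<le> \<bar>M\<bar> * sqrt e * sqrt (dist x y)" by simp
  qed
qed

lemma holder_on_imp_holder_half:
  assumes f: "holder_on b S f" and "b \<ge> 1/2" and "bounded S"
  shows "holder_on (1/2) S f"
proof -
  obtain e where e: "\<And>x y. x \<in> S \<Longrightarrow> y \<in> S \<Longrightarrow> dist x y \<le> e"
    using assms(3) by (meson bounded_two_points)
  obtain C where C: "\<And>x y. x \<in> S \<Longrightarrow> y \<in> S \<Longrightarrow> dist (f x) (f y) \<le> C * dist x y powr b"
    using f unfolding holder_on_def by blast
  show ?thesis
  proof (rule holder_halfI[where C="\<bar>C\<bar> * e powr (b - 1/2)"])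
    fix x y assume *: "x \<in> S" "y \<in> S"
    have "\<bar>f x - f y\<bar> \<le> C * dist x y powr b" using C[OF *] by (simp add: dist_real_def)
    also have "\<dots> \<le> \<bar>C\<bar> * dist x y powr ((b - 1/2) + 1/2)" by (simp add: mult_right_mono)
    also have "\<dots> = \<bar>C\<bar> * (dist x y powr (b - 1/2) * sqrt (dist x y))"
      unfolding powr_add by (simp add: powr_half_sqrt)
    also have "\<dots> \<le> \<bar>C\<bar> * (e powr (b - 1/2) * sqrt (dist x y))"
      by (intro mult_left_mono mult_right_mono powr_mono2) (use e[OF *] assms in auto)
    finally show "\<bar>f x - f y\<bar> \<le> \<bar>C\<bar> * e powr (b - 1/2) * sqrt (dist x y)" by simp
  qed
qed

lemma holder_half_continuous:
  assumes "holder_on (1/2) S f" shows "uniformly_continuous_on S f"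
proof -
  obtain C where C: "C \<ge> 0" "\<And>x y. x \<in> S \<Longrightarrow> y \<in> S \<Longrightarrow> \<bar>f x - f y\<bar> \<le> C * sqrt (dist x y)"
    using holder_halfD[OF assms] by blast
  show ?thesis
    unfolding uniformly_continuous_on_def
  proof (intro allI impI)
    fix e :: real assume e: "e > 0"
    define d where "d = (e / (C + 1))\<^sup>2"
    have d: "d > 0" using e C by (simp add: d_def)
    have "dist (f x') (f x) < e" if "x \<in> S" "x' \<in> S" "dist x' x < d" for x x'
    proof -
      have "sqrt (dist x' x) < e / (C + 1)"
        using that(3) e C unfolding d_def by (intro real_less_lsqrt) auto
      then have "(C + 1) * sqrt (dist x' x) < e" using C by (simp add: field_simps)
      moreover have "C * sqrt (dist x' x) \<le> (C + 1) * sqrt (dist x' x)"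
        by (intro mult_right_mono) auto
      ultimately show ?thesis using C(2)[of x' x] that by (simp add: dist_real_def)
    qed
    with d show "\<exists>d>0. \<forall>x\<in>S. \<forall>x'\<in>S. dist x' x < d \<longrightarrow> dist (f x') (f x) < e" by blast
  qed
qed

text \<open>Uniform continuity yields the extension, and a non-strict inequality survives limits
  along sequences in \<open>S\<close> with the same constant. It closes the domains of the kernels
  and of the right-hand side at the very end.\<close>

lemma holder_half_extend:
  assumes "holder_on (1/2) S f"
  shows "\<exists>g. holder_on (1/2) (closure S) g \<and> (\<forall>x\<in>S. g x = f x)"
proof -
  obtain C where C: "C \<ge> 0" "\<And>x y. x \<in> S \<Longrightarrow> y \<in> S \<Longrightarrow> \<bar>f x - f y\<bar> \<le> C * sqrt (dist x y)"
    using holder_halfD[OF assms] by blast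
  obtain g where g: "uniformly_continuous_on (closure S) g" "\<And>x. x \<in> S \<Longrightarrow> f x = g x"
  proof (rule uniformly_continuous_on_extension_on_closure[OF holder_half_continuous[OF assms]])
    fix g assume "uniformly_continuous_on (closure S) g" "\<And>x. x \<in> S \<Longrightarrow> f x = g x"
    then show thesis by (rule that)
  qed
  have cont: "continuous_on (closure S) g"
    using g(1) by (rule uniformly_continuous_imp_continuous)
  have "\<bar>g x - g y\<bar> \<le> C * sqrt (dist x y)" if xy: "x \<in> closure S" "y \<in> closure S" for x y
  proof -
    obtain X Y where X: "\<And>n. X n \<in> S" "X \<longlonglongrightarrow> x" and Y: "\<And>n. Y n \<in> S" "Y \<longlonglongrightarrow> y"
      using xy unfolding closure_sequential by blast
    have lim: "(\<lambda>n. g (Z n)) \<longlonglongrightarrow> g z" if "\<And>n. Z n \<in> S" "Z \<longlonglongrightarrow> z" "z \<in> closure S" for Z z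
    proof (rule continuous_on_tendsto_compose[OF cont that(2,3)])
      show "\<forall>\<^sub>F n in sequentially. Z n \<in> closure S"
        using that(1) closure_subset[of S] by (intro always_eventually) blast
    qed
    have "(\<lambda>n. C * sqrt (dist (X n) (Y n)) - \<bar>g (X n) - g (Y n)\<bar>) \<longlonglongrightarrow> C * sqrt (dist x y) - \<bar>g x - g y\<bar>"
      by (intro tendsto_intros lim X Y xy)
    moreover have "C * sqrt (dist (X n) (Y n)) - \<bar>g (X n) - g (Y n)\<bar> \<ge> 0" for n
      using C(2)[of "X n" "Y n"] X(1)[of n] Y(1)[of n] by (simp add: g(2))
    ultimately show ?thesis
      using LIMSEQ_le_const[of _ "C * sqrt (dist x y) - \<bar>g x - g y\<bar>" 0] by force
  qed
  then have "holder_on (1/2) (closure S) g" by (rule holder_halfI)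
  with g(2)[symmetric] show ?thesis by blast
qed

section \<open>Weakly singular kernels on the triangle\<close>

text \<open>The bound is the explicit value of the integral of a majorant, which is how the
  constants below arise. If \<open>f\<close> is not integrable, its integral is 0 by convention and
  the bound still holds.\<close>

lemma integral_abs_le:
  fixes f g :: "'a \<Rightarrow> real"
  assumes g: "has_bochner_integral M g I" and le: "\<And>x. \<bar>f x\<bar> \<le> g x"
  shows "\<bar>\<integral>x. f x \<partial>M\<bar> \<le> I"
proof -
  have "\<bar>\<integral>x. f x \<partial>M\<bar> \<le> (\<integral>x. \<bar>f x\<bar> \<partial>M)" by (rule integral_abs_bound)
  also have "\<dots> \<le> (\<integral>x. g x \<partial>M)"
    by (rule integral_mono') (use g le order_trans[OF abs_ge_zero le] in \<open>auto simp: has_bochner_integral_iff\<close>)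
  finally show ?thesis using g by (simp add: has_bochner_integral_iff)
qed

text \<open>Nonnegativity turns a gauge integral into a Lebesgue integral. The fundamental theorem
  with derivatives at interior points only thus applies to integrands that blow up at an
  endpoint.\<close>

lemma has_bochner_integral_HK_nonneg:
  fixes f :: "real \<Rightarrow> real"
  assumes [measurable]: "f \<in> borel_measurable borel" "S \<in> sets borel"
    and nonneg: "\<And>x. x \<in> S \<Longrightarrow> 0 \<le> f x" and I: "(f has_integral I) S"
  shows "has_bochner_integral lborel (\<lambda>x. indicator S x * f x) I"
proof -
  have eq: "(\<lambda>x. indicator S x * f x) = (\<lambda>x. if x \<in> S then f x else 0)"
    by (auto simp: indicator_def)
  have "((\<lambda>x. indicator S x * f x) has_integral I) UNIV"
    unfolding eq using I by (simp add: has_integral_restrict_UNIV)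
  then have "(\<integral>\<^sup>+x. ennreal (indicator S x * f x) \<partial>lborel) = ennreal I"
    by (rule nn_integral_has_integral_lborel[rotated 2]) (use nonneg in \<open>auto simp: indicator_def\<close>)
  then show ?thesis
    by (rule has_bochner_integral_nn_integral[rotated 3])
      (use nonneg has_integral_nonneg[OF I] in \<open>auto simp: indicator_def\<close>)
qed

lemma has_bochner_integral_inverse_sqrt:
  assumes "s \<le> c" "c \<le> d"
  shows "has_bochner_integral lborel (\<lambda>z. indicator {c<..<d} z / sqrt (z - s))
    (2 * sqrt (d - s) - 2 * sqrt (c - s))"
proof -
  have "((\<lambda>z. 1 / sqrt (z - s)) has_integral (2 * sqrt (d - s) - 2 * sqrt (c - s))) {c..d}"
  proof (rule fundamental_theorem_of_calculus_interior)
    show "continuous_on {c..d} (\<lambda>z. 2 * sqrt (z - s))" by (intro continuous_intros)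
    fix x assume "x \<in> {c<..<d}"
    with assms have "x - s > 0" by auto
    then have "((\<lambda>z. 2 * sqrt (z - s)) has_real_derivative 1 / sqrt (x - s)) (at x)"
      by (auto intro!: derivative_eq_intros simp: field_simps)
    then show "((\<lambda>z. 2 * sqrt (z - s)) has_vector_derivative 1 / sqrt (x - s)) (at x)"
      by (simp add: has_real_derivative_iff_has_vector_derivative)
  qed (use assms in auto)
  then have "((\<lambda>z. 1 / sqrt (z - s)) has_integral (2 * sqrt (d - s) - 2 * sqrt (c - s))) {c<..<d}"
    by (simp add: has_integral_Icc_iff_Ioo)
  from has_bochner_integral_HK_nonneg[OF _ _ _ this] assms show ?thesis
    by (simp)
qed

section \<open>The beta integral B(1/2, 1/2) and singular kernels in amplitude form\<close>

definition beta_weight :: "real \<Rightarrow> real" where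
  "beta_weight y = indicator {0<..<1} y / (sqrt y * sqrt (1 - y))"

lemma beta_weight_nonneg: "beta_weight y \<ge> 0"
  by (auto simp: beta_weight_def indicator_def)

text \<open>An antiderivative is \<open>arcsin (2 * y - 1)\<close>, since
  \<open>1 - (2 * y - 1)^2 = 4 * y * (1 - y)\<close>.\<close>

lemma has_bochner_integral_beta_weight: "has_bochner_integral lborel beta_weight pi"
proof -
  have "((\<lambda>y. 1 / (sqrt y * sqrt (1 - y))) has_integral (arcsin (2 * 1 - 1) - arcsin (2 * 0 - 1))) {0..1::real}"
  proof (rule fundamental_theorem_of_calculus_interior)
    show "continuous_on {0..1::real} (\<lambda>y. arcsin (2 * y - 1))" by (intro continuous_intros) auto
    fix x :: real assume x: "x \<in> {0<..<1}"
    have "1 - (2 * x - 1)\<^sup>2 = 4 * (x * (1 - x))" by (simp add: power2_eq_square algebra_simps)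
    then have *: "sqrt (1 - (2 * x - 1)\<^sup>2) = 2 * (sqrt x * sqrt (1 - x))"
      by (simp add: real_sqrt_mult)
    have "((\<lambda>y. arcsin (2 * y - 1)) has_real_derivative inverse (sqrt (1 - (2 * x - 1)\<^sup>2)) * 2) (at x)"
      by (rule DERIV_chain'[where g=arcsin]) (use x in \<open>auto intro!: derivative_eq_intros DERIV_arcsin\<close>)
    then have "((\<lambda>y. arcsin (2 * y - 1)) has_real_derivative 1 / (sqrt x * sqrt (1 - x))) (at x)"
      unfolding * by (simp add: field_simps)
    then show "((\<lambda>y. arcsin (2 * y - 1)) has_vector_derivative 1 / (sqrt x * sqrt (1 - x))) (at x)"
      by (simp add: has_real_derivative_iff_has_vector_derivative)
  qed auto
  then have "((\<lambda>y. 1 / (sqrt y * sqrt (1 - y))) has_integral pi) {0<..<1::real}"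
    by (simp add: has_integral_Icc_iff_Ioo)
  from has_bochner_integral_HK_nonneg[OF _ _ _ this] show ?thesis
    unfolding beta_weight_def[abs_def] by simp
qed

text \<open>The edge s = 0 belongs to the set because the initial contribution is a convolution
  evaluated there; t = L does not, because \<open>Kker\<close> vanishes from time L on.\<close>

definition tri :: "real \<Rightarrow> (real \<times> real) set" where
  "tri L = {(t, s). 0 \<le> s \<and> s < t \<and> t < L}"

lemma tri_iff [simp]: "(t, s) \<in> tri L \<longleftrightarrow> 0 \<le> s \<and> s < t \<and> t < L"
  by (simp add: tri_def)

lemma bounded_tri: "bounded (tri L)"
  by (rule bounded_subset[of "{0..L} \<times> {0..L}"])
    (auto simp: tri_def intro!: bounded_Times)

lemma holder_tri_bounded:
  assumes "holder_on (1/2) (tri L) (case_prod b)"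
  shows "\<exists>B\<ge>0. \<forall>t s. (t, s) \<in> tri L \<longrightarrow> \<bar>b t s\<bar> \<le> B"
proof -
  obtain B where B: "B \<ge> 0" "\<forall>p\<in>tri L. \<bar>case_prod b p\<bar> \<le> B"
    using holder_half_bounded[OF assms bounded_tri] by blast
  have "\<bar>b t s\<bar> \<le> B" if "(t, s) \<in> tri L" for t s
    using bspec[OF B(2) that] by simp
  with B(1) show ?thesis by blast
qed

lemma tri_measurable [measurable]: "tri L \<in> sets (borel \<Otimes>\<^sub>M borel)"
proof -
  have "tri L = {p \<in> space (borel \<Otimes>\<^sub>M borel). 0 \<le> snd p \<and> snd p < fst p \<and> fst p < L}"
    by (auto simp: tri_def space_pair_measure)
  then show ?thesis by simp
qed

text \<open>Extension by zero makes every Volterra integral an integral over the whole line, so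
  substitution and Fubini work without limits of integration.\<close>

definition sing :: "real \<Rightarrow> (real \<Rightarrow> real \<Rightarrow> real) \<Rightarrow> real \<Rightarrow> real \<Rightarrow> real" where
  "sing L b t s = (if (t, s) \<in> tri L then b t s / sqrt (t - s) else 0)"

definition conv :: "(real \<Rightarrow> real \<Rightarrow> real) \<Rightarrow> (real \<Rightarrow> real \<Rightarrow> real) \<Rightarrow> real \<Rightarrow> real \<Rightarrow> real" where
  "conv V W t s = (\<integral>z. V t z * W z s \<partial>lborel)"

lemma sing_measurable:
  assumes "holder_on (1/2) (tri L) (case_prod b)"
  shows "case_prod (sing L b) \<in> borel_measurable (borel \<Otimes>\<^sub>M borel)"
proof -
  have "continuous_on (tri L) (case_prod b)"
    by (intro uniformly_continuous_imp_continuous holder_half_continuous assms)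
  from borel_measurable_continuous_on_indicator[OF tri_measurable[unfolded borel_prod] this]
  have "(\<lambda>p. indicator (tri L) p *\<^sub>R case_prod b p) \<in> borel_measurable (borel \<Otimes>\<^sub>M borel)"
    by (simp add: borel_prod)
  then have "(\<lambda>p. (indicator (tri L) p *\<^sub>R case_prod b p) / sqrt (fst p - snd p)) \<in> borel_measurable (borel \<Otimes>\<^sub>M borel)"
    by measurable
  also have "(\<lambda>p. (indicator (tri L) p *\<^sub>R case_prod b p) / sqrt (fst p - snd p)) = case_prod (sing L b)"
    by (auto simp: sing_def fun_eq_iff indicator_def)
  finally show ?thesis .
qed

lemma conv_measurable:
  assumes [measurable]: "case_prod V \<in> borel_measurable (borel \<Otimes>\<^sub>M borel)" "case_prod W \<in> borel_measurable (borel \<Otimes>\<^sub>M borel)"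
  shows "case_prod (conv V W) \<in> borel_measurable (borel \<Otimes>\<^sub>M borel)"
  unfolding conv_def[abs_def] by measurable

text \<open>With z = s + (t - s) y one has z - s = (t - s) y and t - z = (t - s) (1 - y). The two
  square roots together contribute t - s in the denominator, which the Jacobian cancels; no
  singularity in t - s is left.\<close>

lemma sing_sing_affine:
  assumes "(t, s) \<in> tri L"
  shows "(t - s) * (sing L a t (s + (t - s) * y) * sing L b (s + (t - s) * y) s)
     = beta_weight y * (a t (s + (t - s) * y) * b (s + (t - s) * y) s)"
proof (cases "y \<in> {0<..<1}")
  case True
  define z where "z = s + (t - s) * y"
  have ts: "t - s > 0" "0 \<le> s" "t < L" using assms by auto
  have 1: "z - s = (t - s) * y" "t - z = (t - s) * (1 - y)" by (auto simp: z_def algebra_simps)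
  have "s < z" "z < t" using 1 True ts by (metis diff_gt_0_iff_gt greaterThanLessThan_iff mult_pos_pos)+
  then have in_tri: "(t, z) \<in> tri L" "(z, s) \<in> tri L" using ts by auto
  have "sqrt (z - s) = sqrt (t - s) * sqrt y" "sqrt (t - z) = sqrt (t - s) * sqrt (1 - y)"
    unfolding 1 by (simp_all add: real_sqrt_mult)
  moreover have "(t - s) = sqrt (t - s) * sqrt (t - s)" using ts by simp
  moreover have "sqrt (t - s) > 0" "sqrt y > 0" "sqrt (1 - y) > 0" using ts True by auto
  ultimately show ?thesis
    unfolding z_def[symmetric] sing_def beta_weight_def using in_tri True
    by (simp add: field_simps)
next
  case False
  have ts: "t - s > 0" using assms by auto
  have "\<not> (s < s + (t - s) * y \<and> s + (t - s) * y < t)"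
  proof
    assume *: "s < s + (t - s) * y \<and> s + (t - s) * y < t"
    have 1: "0 < (t - s) * y" using * by linarith
    have 2: "y < 1"
    proof (rule ccontr)
      assume "\<not> y < 1"
      then have "(t - s) * 1 \<le> (t - s) * y" using ts by (intro mult_left_mono) auto
      moreover have "s + (t - s) * y < t" using * by blast
      ultimately show False unfolding mult_1_right by linarith
    qed
    have "0 < y" using 1 ts by (simp add: zero_less_mult_iff)
    then show False using False 2 by simp
  qed
  then show ?thesis using False by (auto simp: sing_def beta_weight_def)
qed

lemma integrable_sing_sing:
  assumes a: "holder_on (1/2) (tri L) (case_prod a)" and b: "holder_on (1/2) (tri L) (case_prod b)"
    and ts: "(t, s) \<in> tri L"
  shows "integrable lborel (\<lambda>z. sing L a t z * sing L b z s)"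
    and "integrable lborel (\<lambda>y. beta_weight y * (a t (s + (t - s) * y) * b (s + (t - s) * y) s))"
proof -
  obtain A where A: "A \<ge> 0" "\<And>t s. (t, s) \<in> tri L \<Longrightarrow> \<bar>a t s\<bar> \<le> A"
    using holder_tri_bounded[OF a] by blast
  obtain B where B: "B \<ge> 0" "\<And>t s. (t, s) \<in> tri L \<Longrightarrow> \<bar>b t s\<bar> \<le> B"
    using holder_tri_bounded[OF b] by blast
  note [measurable] = sing_measurable[OF a] sing_measurable[OF b]
  have pos: "t - s > 0" using ts by auto
  have "integrable lborel (\<lambda>y. (t - s) * (sing L a t (s + (t - s) * y) * sing L b (s + (t - s) * y) s))"
  proof (rule Bochner_Integration.integrable_bound)
    show "integrable lborel (\<lambda>y. beta_weight y * (A * B))"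
      using has_bochner_integral_beta_weight by (simp add: has_bochner_integral_iff)
    have "\<bar>beta_weight y * (a t (s + (t - s) * y) * b (s + (t - s) * y) s)\<bar> \<le> \<bar>beta_weight y * (A * B)\<bar>" for y
    proof (cases "y \<in> {0<..<1}")
      case True
      have "0 < (t - s) * y" "(t - s) * y < (t - s) * 1"
        using True pos by (auto simp: mult_less_cancel_left_pos simp del: mult_1_right)
      then have "(t, s + (t - s) * y) \<in> tri L" "(s + (t - s) * y, s) \<in> tri L" using ts by auto
      then show ?thesis
        unfolding abs_mult using A B by (intro mult_mono) auto
    qed (simp add: beta_weight_def)
    then show "AE y in lborel. norm ((t - s) * (sing L a t (s + (t - s) * y) * sing L b (s + (t - s) * y) s)) \<le> norm (beta_weight y * (A * B))"
      unfolding sing_sing_affine[OF ts] by simp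
  qed measurable
  then show 1: "integrable lborel (\<lambda>y. beta_weight y * (a t (s + (t - s) * y) * b (s + (t - s) * y) s))"
    unfolding sing_sing_affine[OF ts] .
  have "integrable lborel (\<lambda>y. (1 / (t - s)) * ((t - s) * (sing L a t (s + (t - s) * y) * sing L b (s + (t - s) * y) s)))"
    unfolding sing_sing_affine[OF ts] by (intro integrable_mult_right) (use 1 in auto)
  then have "integrable lborel (\<lambda>y. sing L a t (s + (t - s) * y) * sing L b (s + (t - s) * y) s)"
    using pos by simp
  then show "integrable lborel (\<lambda>z. sing L a t z * sing L b z s)"
    using pos by (subst (asm) lborel_integrable_real_affine_iff) auto
qed

lemma conv_sing_sing_eq:
  assumes "(t, s) \<in> tri L"
  shows "conv (sing L a) (sing L b) t s
     = (\<integral>y. beta_weight y * (a t (s + (t - s) * y) * b (s + (t - s) * y) s) \<partial>lborel)"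
proof -
  have "t - s > 0" using assms by auto
  then have "conv (sing L a) (sing L b) t s
     = (t - s) * (\<integral>y. sing L a t (s + (t - s) * y) * sing L b (s + (t - s) * y) s \<partial>lborel)"
    unfolding conv_def by (subst lborel_integral_real_affine[where c="t - s" and t=s]) auto
  also have "\<dots> = (\<integral>y. (t - s) * (sing L a t (s + (t - s) * y) * sing L b (s + (t - s) * y) s) \<partial>lborel)"
    by simp
  finally show ?thesis unfolding sing_sing_affine[OF assms] .
qed

text \<open>After the substitution neither the weight nor the domain depends on (t, s), so the
  Hoelder bound of the product of amplitudes is simply integrated against a weight of mass pi. The
  inner points are convex combinations of s and t with the same y, hence no further apart than the
  given pairs.\<close>

lemma holder_conv_sing_sing:
  assumes a: "holder_on (1/2) (tri L) (case_prod a)" and b: "holder_on (1/2) (tri L) (case_prod b)"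
  shows "holder_on (1/2) (tri L) (case_prod (conv (sing L a) (sing L b)))"
proof -
  obtain A where A: "A \<ge> 0" "\<And>t s. (t, s) \<in> tri L \<Longrightarrow> \<bar>a t s\<bar> \<le> A"
    using holder_tri_bounded[OF a] by blast
  obtain B where B: "B \<ge> 0" "\<And>t s. (t, s) \<in> tri L \<Longrightarrow> \<bar>b t s\<bar> \<le> B"
    using holder_tri_bounded[OF b] by blast
  obtain C where C: "C \<ge> 0" "\<And>p q. p \<in> tri L \<Longrightarrow> q \<in> tri L \<Longrightarrow> \<bar>case_prod a p - case_prod a q\<bar> \<le> C * sqrt (dist p q)"
    using holder_halfD[OF a] by blast
  obtain D where D: "D \<ge> 0" "\<And>p q. p \<in> tri L \<Longrightarrow> q \<in> tri L \<Longrightarrow> \<bar>case_prod b p - case_prod b q\<bar> \<le> D * sqrt (dist p q)"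
    using holder_halfD[OF b] by blast
  show ?thesis
  proof (rule holder_halfI[where C="pi * ((C * B + A * D) * 2)"])
    fix p q assume pq: "p \<in> tri L" "q \<in> tri L"
    obtain t s where p: "p = (t, s)" by (cases p)
    obtain t' s' where q: "q = (t', s')" by (cases q)
    have ts: "(t, s) \<in> tri L" and ts': "(t', s') \<in> tri L" using pq p q by auto
    let ?z = "\<lambda>y. s + (t - s) * y" and ?z' = "\<lambda>y. s' + (t' - s') * y"
    let ?F = "\<lambda>y. a t (?z y) * b (?z y) s" and ?F' = "\<lambda>y. a t' (?z' y) * b (?z' y) s'"
    define d where "d = dist p q"
    have d: "\<bar>t - t'\<bar> \<le> d" "\<bar>s - s'\<bar> \<le> d"
      unfolding d_def p q using dist_fst_le[of "(t,s)" "(t',s')"] dist_snd_le[of "(t,s)" "(t',s')"]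
      by (auto simp: dist_real_def)
    have F: "\<bar>?F y - ?F' y\<bar> \<le> (C * B + A * D) * 2 * sqrt d" if y: "0 < y" "y < 1" for y
    proof -
      have mem: "(t, s + (t - s) * y) \<in> tri L \<and> (s + (t - s) * y, s) \<in> tri L" if "(t, s) \<in> tri L" for t s
      proof -
        have "0 < (t - s) * y" "(t - s) * y < (t - s) * 1"
          using y that by (auto simp: mult_less_cancel_left_pos simp del: mult_1_right)
        then show ?thesis using that by auto
      qed
      have "?z y - ?z' y = (1 - y) * (s - s') + y * (t - t')" by (simp add: algebra_simps)
      also have "\<bar>\<dots>\<bar> \<le> (1 - y) * \<bar>s - s'\<bar> + y * \<bar>t - t'\<bar>"
        using y by (intro order_trans[OF abs_triangle_ineq]) (auto simp: abs_mult)
      also have "\<dots> \<le> (1 - y) * d + y * d"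
        using y d by (intro add_mono mult_left_mono) auto
      finally have zz: "\<bar>?z y - ?z' y\<bar> \<le> d" by (simp add: algebra_simps)
      \<comment> \<open>The distance is at most 2 d; the cruder 4 d is taken because its square root
        is 2 \<open>sqrt d\<close>.\<close>
      have dd: "sqrt (dist (u, v) (u', v')) \<le> 2 * sqrt d" if "\<bar>u - u'\<bar> \<le> d" "\<bar>v - v'\<bar> \<le> d" for u v u' v' :: real
      proof -
        have "dist (u, v) (u', v') \<le> \<bar>u - u'\<bar> + \<bar>v - v'\<bar>"
          unfolding dist_prod_def by (simp add: dist_real_def sqrt_sum_squares_le_sum_abs[THEN order_trans])
        also have "\<dots> \<le> 4 * d" using that d by linarith
        finally have "sqrt (dist (u, v) (u', v')) \<le> sqrt (4 * d)" by simp
        then show ?thesis by (simp add: real_sqrt_mult)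
      qed
      have "\<bar>a t (?z y) - a t' (?z' y)\<bar> \<le> C * sqrt (dist (t, ?z y) (t', ?z' y))"
        using C(2)[of "(t, ?z y)" "(t', ?z' y)"] mem[OF ts] mem[OF ts'] by auto
      also have "\<dots> \<le> C * (2 * sqrt d)" using C(1) d zz by (intro mult_left_mono dd) auto
      finally have 1: "\<bar>a t (?z y) - a t' (?z' y)\<bar> \<le> C * (2 * sqrt d)" .
      have "\<bar>b (?z y) s - b (?z' y) s'\<bar> \<le> D * sqrt (dist (?z y, s) (?z' y, s'))"
        using D(2)[of "(?z y, s)" "(?z' y, s')"] mem[OF ts] mem[OF ts'] by auto
      also have "\<dots> \<le> D * (2 * sqrt d)" using D(1) d zz by (intro mult_left_mono dd) auto
      finally have 2: "\<bar>b (?z y) s - b (?z' y) s'\<bar> \<le> D * (2 * sqrt d)" .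
      have "?F y - ?F' y = (a t (?z y) - a t' (?z' y)) * b (?z y) s + a t' (?z' y) * (b (?z y) s - b (?z' y) s')"
        by (simp add: algebra_simps)
      also have "\<bar>\<dots>\<bar> \<le> \<bar>a t (?z y) - a t' (?z' y)\<bar> * \<bar>b (?z y) s\<bar> + \<bar>a t' (?z' y)\<bar> * \<bar>b (?z y) s - b (?z' y) s'\<bar>"
        by (metis abs_mult abs_triangle_ineq)
      also have "\<dots> \<le> (C * (2 * sqrt d)) * B + A * (D * (2 * sqrt d))"
        by (intro add_mono mult_mono 1 2 A B) (use A B C D d mem[OF ts] mem[OF ts'] in auto)
      finally show ?thesis by (simp add: algebra_simps)
    qed
    have "conv (sing L a) (sing L b) t s - conv (sing L a) (sing L b) t' s'
      = (\<integral>y. beta_weight y * ?F y - beta_weight y * ?F' y \<partial>lborel)"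
      unfolding conv_sing_sing_eq[OF ts] conv_sing_sing_eq[OF ts']
      by (subst Bochner_Integration.integral_diff) (use integrable_sing_sing[OF a b] ts ts' in auto)
    also have "\<bar>\<dots>\<bar> \<le> pi * ((C * B + A * D) * 2 * sqrt d)"
    proof (rule integral_abs_le)
      show "has_bochner_integral lborel (\<lambda>y. beta_weight y * ((C * B + A * D) * 2 * sqrt d)) (pi * ((C * B + A * D) * 2 * sqrt d))"
        by (intro has_bochner_integral_mult_left has_bochner_integral_beta_weight)
      fix y
      show "\<bar>beta_weight y * ?F y - beta_weight y * ?F' y\<bar> \<le> beta_weight y * ((C * B + A * D) * 2 * sqrt d)"
      proof (cases "0 < y \<and> y < 1")
        case True
        have "\<bar>beta_weight y * ?F y - beta_weight y * ?F' y\<bar> = beta_weight y * \<bar>?F y - ?F' y\<bar>"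
          by (simp add: right_diff_distrib[symmetric] abs_mult beta_weight_nonneg)
        then show ?thesis
          using F True by (auto intro!: mult_left_mono beta_weight_nonneg)
      qed (auto simp: beta_weight_def)
    qed
    finally show "\<bar>case_prod (conv (sing L a) (sing L b)) p - case_prod (conv (sing L a) (sing L b)) q\<bar>
       \<le> pi * ((C * B + A * D) * 2) * sqrt (dist p q)"
      unfolding p q d_def by (simp add: mult.assoc)
  qed
qed

section \<open>Convolution of a bounded kernel with a singular one\<close>

lemma has_bochner_integral_translate:
  fixes f :: "real \<Rightarrow> real"
  assumes "has_bochner_integral lborel f I"
  shows "has_bochner_integral lborel (\<lambda>z. f (z - s)) I"
proof -
  have "has_bochner_integral lborel (\<lambda>z. f (- s + 1 * z)) (I /\<^sub>R \<bar>1\<bar>)"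
    using assms by (subst lborel_has_bochner_integral_real_affine_iff[symmetric]) auto
  then show ?thesis by simp
qed

text \<open>Dominated convergence, with majorant \<open>1 / sqrt y\<close>, sends the weighted mass
  to 0 as the rate grows; integer rates suffice. The number k becomes the contraction factor of the
  iteration.\<close>

lemma exponential_weight_small:
  assumes "e > 0"
  shows "\<exists>l\<ge>0. \<exists>k\<ge>0. k \<le> e \<and>
    has_bochner_integral lborel (\<lambda>y. indicator {0<..<L} y * exp (- l * y) / sqrt y) k"
proof (cases "L > 0")
  case True
  let ?f = "\<lambda>n y. indicator {0<..<L} y * exp (- real n * y) / sqrt y"
  have w: "integrable lborel (\<lambda>y. indicator {0<..<L} y / sqrt y)"
    using has_bochner_integral_inverse_sqrt[of 0 0 L] True by (auto simp: has_bochner_integral_iff)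
  have bd: "norm (?f n y) \<le> indicator {0<..<L} y / sqrt y" for n y
    by (auto simp: indicator_def divide_simps)
  have "(\<lambda>n. \<integral>y. ?f n y \<partial>lborel) \<longlonglongrightarrow> (\<integral>y. 0 \<partial>(lborel :: real measure))"
  proof (rule integral_dominated_convergence[where w="\<lambda>y. indicator {0<..<L} y / sqrt y"])
    have "(\<lambda>n. ?f n y) \<longlonglongrightarrow> 0" for y
    proof (cases "y \<in> {0<..<L}")
      case True
      then have "(\<lambda>n. exp (- y) ^ n) \<longlonglongrightarrow> 0" by (intro LIMSEQ_power_zero) simp
      then have "(\<lambda>n. exp (- real n * y)) \<longlonglongrightarrow> 0" by (simp add: exp_of_nat_mult[symmetric])
      then have "(\<lambda>n. indicator {0<..<L} y * exp (- real n * y) / sqrt y) \<longlonglongrightarrow> indicator {0<..<L} y * 0 / sqrt y"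
        using True by (intro tendsto_intros) auto
      then show ?thesis by simp
    qed simp
    then show "AE y in lborel. (\<lambda>n. ?f n y) \<longlonglongrightarrow> 0" by simp
    show "AE y in lborel. norm (?f n y) \<le> indicator {0<..<L} y / sqrt y" for n using bd by simp
  qed (use w in measurable)
  then have "\<forall>\<^sub>F n in sequentially. (\<integral>y. ?f n y \<partial>lborel) < e"
    using assms by (intro order_tendstoD(2)) auto
  then obtain n where n: "(\<integral>y. ?f n y \<partial>lborel) < e"
    using eventually_happens by fastforce
  have int: "integrable lborel (?f n)"
  proof (rule Bochner_Integration.integrable_bound[OF w])
    show "AE y in lborel. norm (?f n y) \<le> norm (indicator {0<..<L} y / sqrt y)"
    proof (rule AE_I2)
      fix y
      have "norm (?f n y) \<le> indicator {0<..<L} y / sqrt y" by (rule bd)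
      also have "\<dots> \<le> norm (indicator {0<..<L} y / sqrt y)" unfolding real_norm_def by (rule abs_ge_self)
      finally show "norm (?f n y) \<le> norm (indicator {0<..<L} y / sqrt y)" .
    qed
  qed measurable
  have "(\<integral>y. ?f n y \<partial>lborel) \<ge> 0" by (rule Bochner_Integration.integral_nonneg) (auto simp: indicator_def)
  then show ?thesis
    using n int by (intro exI[of _ "real n"] exI[of _ "\<integral>y. ?f n y \<partial>lborel"] conjI)
       (auto simp: has_bochner_integral_iff)
qed (use assms in \<open>auto intro!: exI[of _ 0]\<close>)

text \<open>For t \<le> t' the path from (t, s) via (t', s) to (t', s') stays in the triangle: the
  larger time has to be reached before s is changed.\<close>

lemma holder_tri_sections:
  assumes t: "\<And>t t' s. 0 \<le> s \<Longrightarrow> s < t \<Longrightarrow> t \<le> t' \<Longrightarrow> t' < L \<Longrightarrow> \<bar>f t s - f t' s\<bar> \<le> p * sqrt (t' - t)"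
    and s: "\<And>t s s'. 0 \<le> s \<Longrightarrow> s \<le> s' \<Longrightarrow> s' < t \<Longrightarrow> t < L \<Longrightarrow> \<bar>f t s - f t s'\<bar> \<le> q * sqrt (s' - s)"
    and pq: "p \<ge> 0" "q \<ge> 0"
  shows "holder_on (1/2) (tri L) (case_prod f)"
proof (rule holder_halfI[where C="p + q"])
  fix x y assume xy: "x \<in> tri L" "y \<in> tri L"
  have *: "\<bar>f t s - f t' s'\<bar> \<le> (p + q) * sqrt (dist (t, s) (t', s'))"
    if "(t, s) \<in> tri L" "(t', s') \<in> tri L" "t \<le> t'" for t s t' s'
  proof -
    have d: "\<bar>t - t'\<bar> \<le> dist (t, s) (t', s')" "\<bar>s - s'\<bar> \<le> dist (t, s) (t', s')"
      using dist_fst_le[of "(t,s)" "(t',s')"] dist_snd_le[of "(t,s)" "(t',s')"] by (auto simp: dist_real_def)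
    have "\<bar>f t s - f t' s\<bar> \<le> p * sqrt (t' - t)" using that by (intro t) auto
    also have "\<dots> \<le> p * sqrt (dist (t, s) (t', s'))" using d pq by (intro mult_left_mono) auto
    finally have 1: "\<bar>f t s - f t' s\<bar> \<le> p * sqrt (dist (t, s) (t', s'))" .
    have "\<bar>f t' s - f t' s'\<bar> \<le> q * sqrt \<bar>s - s'\<bar>"
      using s[of s s' t'] s[of s' s t'] that by (cases "s \<le> s'") (auto simp: abs_minus_commute)
    also have "\<dots> \<le> q * sqrt (dist (t, s) (t', s'))" using d pq by (intro mult_left_mono) auto
    finally show ?thesis using 1 unfolding distrib_right by linarith
  qed
  obtain t s t' s' where e: "x = (t, s)" "y = (t', s')" by (cases x, cases y)
  show "\<bar>case_prod f x - case_prod f y\<bar> \<le> (p + q) * sqrt (dist x y)"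
    using *[of t s t' s'] *[of t' s' t s] xy unfolding e
    by (cases "t \<le> t'") (auto simp: abs_minus_commute dist_commute)
qed

text \<open>The weight splits as exp (l (t - z)) = exp (l (t - s)) exp (- l (z - s)). The first
  factor reproduces the weight of the conclusion, and the second one, integrated against the
  singular factor, gives k.\<close>

lemma conv_sing_bound:
  assumes supp: "\<And>t z. (t, z) \<notin> tri L \<Longrightarrow> V t z = 0"
    and V: "\<And>t z. (t, z) \<in> tri L \<Longrightarrow> \<bar>V t z\<bar> \<le> v * exp (l * (t - z))" and v: "v \<ge> 0"
    and B: "\<And>t s. (t, s) \<in> tri L \<Longrightarrow> \<bar>b t s\<bar> \<le> B" "B \<ge> 0"
    and k: "has_bochner_integral lborel (\<lambda>y. indicator {0<..<L} y * exp (- l * y) / sqrt y) k"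
    and ts: "(t, s) \<in> tri L"
  shows "\<bar>conv V (sing L b) t s\<bar> \<le> v * B * k * exp (l * (t - s))"
proof -
  have "\<bar>conv V (sing L b) t s\<bar> \<le> (v * B * exp (l * (t - s))) * k"
    unfolding conv_def
  proof (rule integral_abs_le)
    show "has_bochner_integral lborel
       (\<lambda>z. v * B * exp (l * (t - s)) * (indicator {0<..<L} (z - s) * exp (- l * (z - s)) / sqrt (z - s)))
       (v * B * exp (l * (t - s)) * k)"
      by (intro has_bochner_integral_mult_right has_bochner_integral_translate k)
    fix z
    show "\<bar>V t z * sing L b z s\<bar> \<le> v * B * exp (l * (t - s)) * (indicator {0<..<L} (z - s) * exp (- l * (z - s)) / sqrt (z - s))"
    proof (cases "(t, z) \<in> tri L \<and> (z, s) \<in> tri L")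
      case True
      then have "\<bar>V t z * sing L b z s\<bar> = \<bar>V t z\<bar> * \<bar>b z s\<bar> / sqrt (z - s)"
        by (simp add: sing_def abs_mult)
      also have "\<dots> \<le> (v * exp (l * (t - z))) * B / sqrt (z - s)"
        using True by (intro divide_right_mono mult_mono V B) (use v in auto)
      also have "l * (t - z) = l * (t - s) + (- l * (z - s))" by (simp add: algebra_simps)
      also have "(v * exp (l * (t - s) + (- l * (z - s)))) * B / sqrt (z - s)
        = v * B * exp (l * (t - s)) * (indicator {0<..<L} (z - s) * exp (- l * (z - s)) / sqrt (z - s))"
        unfolding exp_add using True by simp
      finally show ?thesis .
    next
      case False
      then have "V t z * sing L b z s = 0" using supp by (auto simp: sing_def)
      then show ?thesis using v B by (auto simp: indicator_def)
    qed
  qed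
  then show ?thesis by (simp add: mult_ac)
qed

lemma integrable_bdd_sing:
  assumes [measurable]: "case_prod V \<in> borel_measurable (borel \<Otimes>\<^sub>M borel)"
    and supp: "\<And>t z. (t, z) \<notin> tri L \<Longrightarrow> V t z = 0"
    and V: "\<And>t z. (t, z) \<in> tri L \<Longrightarrow> \<bar>V t z\<bar> \<le> v"
    and b: "holder_on (1/2) (tri L) (case_prod b)"
  shows "integrable lborel (\<lambda>z. V t z * sing L b z s)"
proof (cases "(t, s) \<in> tri L")
  case True
  note [measurable] = sing_measurable[OF b]
  obtain B where B: "B \<ge> 0" "\<And>t s. (t, s) \<in> tri L \<Longrightarrow> \<bar>b t s\<bar> \<le> B"
    using holder_tri_bounded[OF b] by blast
  have i: "integrable lborel (\<lambda>z. v * B * (indicator {s<..<L} z / sqrt (z - s)))"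
    by (rule integrable_mult_right)
      (use has_bochner_integral_inverse_sqrt[of s s L] True in \<open>auto simp: has_bochner_integral_iff\<close>)
  show ?thesis
  proof (rule Bochner_Integration.integrable_bound[OF i])
    have "\<bar>V t z * sing L b z s\<bar> \<le> \<bar>v * B * (indicator {s<..<L} z / sqrt (z - s))\<bar>" for z
    proof (cases "(t, z) \<in> tri L \<and> (z, s) \<in> tri L")
      case True
      then have "\<bar>V t z * sing L b z s\<bar> = \<bar>V t z\<bar> * \<bar>b z s\<bar> / sqrt (z - s)"
        by (simp add: sing_def abs_mult)
      also have "\<dots> \<le> v * B / sqrt (z - s)"
        using True V[of t z] by (intro divide_right_mono mult_mono V B) auto
      also have "\<dots> = v * B * (indicator {s<..<L} z / sqrt (z - s))" using True by simp
      finally show ?thesis by linarith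
    next
      case False
      then have "V t z * sing L b z s = 0" using supp by (auto simp: sing_def)
      then show ?thesis by (simp only: abs_zero abs_ge_zero)
    qed
    then show "AE z in lborel. norm (V t z * sing L b z s) \<le> norm (v * B * (indicator {s<..<L} z / sqrt (z - s)))"
      by simp
  qed measurable
next
  case False
  then have "(\<lambda>z. V t z * sing L b z s) = (\<lambda>z. 0)" using supp by (fastforce simp: sing_def fun_eq_iff)
  then show ?thesis by simp
qed

text \<open>On s < z < t the Hoelder bound of \<open>V\<close> in its first variable applies. On t <
  z < t' the term \<open>V t z\<close> vanishes and only the size of \<open>V t' z\<close> counts;
  there the singular factor integrates to 2 (sqrt (t' - s) - sqrt (t - s)), at most 2 sqrt (t' -
  t).\<close>

lemma conv_sing_holder_left:
  assumes meas: "case_prod V \<in> borel_measurable (borel \<Otimes>\<^sub>M borel)"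
    and supp: "\<And>t z. (t, z) \<notin> tri L \<Longrightarrow> V t z = 0"
    and V: "\<And>t z. (t, z) \<in> tri L \<Longrightarrow> \<bar>V t z\<bar> \<le> v * exp (l * (t - z))" and v: "v \<ge> 0"
    and H: "\<And>t t' z. 0 \<le> z \<Longrightarrow> z < t \<Longrightarrow> t \<le> t' \<Longrightarrow> t' < L \<Longrightarrow>
       \<bar>V t z - V t' z\<bar> \<le> p * exp (l * (t' - z)) * sqrt (t' - t)" and p: "p \<ge> 0"
    and b: "holder_on (1/2) (tri L) (case_prod b)"
    and B: "\<And>t s. (t, s) \<in> tri L \<Longrightarrow> \<bar>b t s\<bar> \<le> B" "B \<ge> 0"
    and k: "has_bochner_integral lborel (\<lambda>y. indicator {0<..<L} y * exp (- l * y) / sqrt y) k"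
    and l: "l \<ge> 0"
    and ts: "0 \<le> s" "s < t" "t \<le> t'" "t' < L"
  shows "\<bar>conv V (sing L b) t s - conv V (sing L b) t' s\<bar>
     \<le> (p * B * k + 2 * v * B) * exp (l * (t' - s)) * sqrt (t' - t)"
proof -
  have V': "\<bar>V t z\<bar> \<le> v * exp (l * L)" if "(t, z) \<in> tri L" for t z
    using that l by (intro order_trans[OF V] mult_left_mono v) (auto intro: mult_left_mono)
  let ?E = "exp (l * (t' - s))"
  let ?g = "\<lambda>z. p * B * ?E * sqrt (t' - t) * (indicator {0<..<L} (z - s) * exp (- l * (z - s)) / sqrt (z - s))
     + v * B * ?E * (indicator {t<..<t'} z / sqrt (z - s))"
  have "conv V (sing L b) t s - conv V (sing L b) t' s = (\<integral>z. V t z * sing L b z s - V t' z * sing L b z s \<partial>lborel)"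
    unfolding conv_def
    by (subst Bochner_Integration.integral_diff) (use integrable_bdd_sing[OF meas supp V' b] in auto)
  also have "\<dots> = (\<integral>z. (if z = t then 0 else V t z * sing L b z s - V t' z * sing L b z s) \<partial>lborel)"
  proof (rule integral_cong_AE)
    note [measurable] = meas sing_measurable[OF b]
    show "(\<lambda>z. V t z * sing L b z s - V t' z * sing L b z s) \<in> borel_measurable lborel"
      by measurable
    show "(\<lambda>z. if z = t then 0 else V t z * sing L b z s - V t' z * sing L b z s) \<in> borel_measurable lborel"
      by measurable
    show "AE z in lborel. V t z * sing L b z s - V t' z * sing L b z s = (if z = t then 0 else V t z * sing L b z s - V t' z * sing L b z s)"
      using AE_lborel_singleton[of t] by eventually_elim simp
  qed
  also have "\<bar>\<dots>\<bar> \<le> p * B * ?E * sqrt (t' - t) * k + v * B * ?E * (2 * sqrt (t' - s) - 2 * sqrt (t - s))"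
  proof (rule integral_abs_le)
    show "has_bochner_integral lborel ?g (p * B * ?E * sqrt (t' - t) * k + v * B * ?E * (2 * sqrt (t' - s) - 2 * sqrt (t - s)))"
      by (intro has_bochner_integral_add has_bochner_integral_mult_right has_bochner_integral_translate k
          has_bochner_integral_inverse_sqrt) (use ts in auto)
    fix z
    have gpos: "?g z \<ge> 0"
      using v p B ts by (auto simp: indicator_def)
    show "\<bar>if z = t then 0 else V t z * sing L b z s - V t' z * sing L b z s\<bar> \<le> ?g z"
    proof -
      consider "z = t" | "s < z" "z < t" | "t < z" "z < t'" | "z \<le> s \<or> t' \<le> z" by linarith
      then show ?thesis
      proof cases
        case 1
        then show ?thesis using gpos by simp
      next
        case 2
        have bz: "\<bar>sing L b z s\<bar> \<le> B / sqrt (z - s)"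
          using B(1)[of z s] 2 ts by (auto simp: sing_def divide_right_mono)
        have "\<bar>V t z * sing L b z s - V t' z * sing L b z s\<bar> = \<bar>V t z - V t' z\<bar> * \<bar>sing L b z s\<bar>"
          by (simp add: left_diff_distrib[symmetric] abs_mult)
        also have "\<dots> \<le> (p * exp (l * (t' - z)) * sqrt (t' - t)) * (B / sqrt (z - s))"
          using 2 ts p by (intro mult_mono H bz) auto
        also have "l * (t' - z) = l * (t' - s) + (- l * (z - s))" by (simp add: algebra_simps)
        also have "(p * exp (l * (t' - s) + (- l * (z - s))) * sqrt (t' - t)) * (B / sqrt (z - s)) = ?g z"
          unfolding exp_add using 2 ts by simp
        finally show ?thesis using 2 by simp
      next
        case 3
        have bz: "\<bar>sing L b z s\<bar> \<le> B / sqrt (z - s)"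
          using B(1)[of z s] 3 ts by (auto simp: sing_def divide_right_mono)
        have "\<bar>V t' z\<bar> \<le> v * exp (l * (t' - z))" using 3 ts by (intro V) auto
        also have "\<dots> \<le> v * ?E" using 3 ts v l by (intro mult_left_mono) (auto intro: mult_left_mono)
        finally have Vz: "\<bar>V t' z\<bar> \<le> v * ?E" .
        have "\<bar>V t z * sing L b z s - V t' z * sing L b z s\<bar> = \<bar>V t' z\<bar> * \<bar>sing L b z s\<bar>"
          using 3 supp[of t z] by (simp add: abs_mult)
        also have "\<dots> \<le> v * ?E * (B / sqrt (z - s))"
          using v by (intro mult_mono Vz bz) auto
        also have "\<dots> \<le> ?g z" using 3 ts p B by (simp add: mult_ac)
        finally show ?thesis using 3 by simp
      next
        case 4
        then have "V t z * sing L b z s = 0" "V t' z * sing L b z s = 0"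
          using supp[of t z] supp[of t' z] ts by (auto simp: sing_def)
        then have "\<bar>if z = t then 0 else V t z * sing L b z s - V t' z * sing L b z s\<bar> = 0"
          by (simp only: abs_zero if_cancel diff_self)
        then show ?thesis using gpos by linarith
      qed
    qed
  qed
  also have "\<dots> \<le> p * B * ?E * sqrt (t' - t) * k + v * B * ?E * (2 * sqrt (t' - t))"
  proof -
    have "sqrt (t' - s) - sqrt (t - s) \<le> sqrt (t' - t)"
      using sqrt_diff_le[of "t' - s" "t - s"] ts by auto
    then show ?thesis using v B(2) by (intro add_mono order_refl mult_left_mono) auto
  qed
  finally show ?thesis by (simp add: algebra_simps)
qed

text \<open>\<open>V\<close> is merely bounded, so all regularity in s comes from the right factor.
  The integral has three parts: (s, s'), where only one kernel lives; the change of the amplitude on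
  (s', t); and the change of \<open>1 / sqrt (z - s)\<close> on (s', t). The last has a constant
  sign, so its absolute value integrates exactly, to at most 2 sqrt (s' - s).\<close>

lemma conv_sing_holder_right:
  assumes meas: "case_prod V \<in> borel_measurable (borel \<Otimes>\<^sub>M borel)"
    and supp: "\<And>t z. (t, z) \<notin> tri L \<Longrightarrow> V t z = 0"
    and V: "\<And>t z. (t, z) \<in> tri L \<Longrightarrow> \<bar>V t z\<bar> \<le> v" and v: "v \<ge> 0"
    and b: "holder_on (1/2) (tri L) (case_prod b)"
    and B: "\<And>t s. (t, s) \<in> tri L \<Longrightarrow> \<bar>b t s\<bar> \<le> B" "B \<ge> 0"
    and D: "\<And>p q. p \<in> tri L \<Longrightarrow> q \<in> tri L \<Longrightarrow> \<bar>case_prod b p - case_prod b q\<bar> \<le> D * sqrt (dist p q)" "D \<ge> 0"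
    and ts: "0 \<le> s" "s \<le> s'" "s' < t" "t < L"
  shows "\<bar>conv V (sing L b) t s - conv V (sing L b) t s'\<bar> \<le> (4 * v * B + 2 * v * D * sqrt L) * sqrt (s' - s)"
proof -
  let ?g = "\<lambda>z. v * B * (indicator {s<..<s'} z / sqrt (z - s))
     + v * D * sqrt (s' - s) * (indicator {s'<..<t} z / sqrt (z - s))
     + v * B * (indicator {s'<..<t} z / sqrt (z - s') - indicator {s'<..<t} z / sqrt (z - s))"
  let ?h = "\<lambda>z. V t z * sing L b z s - V t z * sing L b z s'"
  have "conv V (sing L b) t s - conv V (sing L b) t s' = (\<integral>z. ?h z \<partial>lborel)"
    unfolding conv_def
    by (subst Bochner_Integration.integral_diff) (use integrable_bdd_sing[OF meas supp V b] in auto)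
  also have "\<dots> = (\<integral>z. (if z = s' then 0 else ?h z) \<partial>lborel)"
  proof (rule integral_cong_AE)
    note [measurable] = meas sing_measurable[OF b]
    show "?h \<in> borel_measurable lborel" by measurable
    show "(\<lambda>z. if z = s' then 0 else ?h z) \<in> borel_measurable lborel" by measurable
    show "AE z in lborel. ?h z = (if z = s' then 0 else ?h z)"
      using AE_lborel_singleton[of s'] by eventually_elim simp
  qed
  also have "\<bar>\<dots>\<bar> \<le> v * B * (2 * sqrt (s' - s) - 2 * sqrt (s - s))
     + v * D * sqrt (s' - s) * (2 * sqrt (t - s) - 2 * sqrt (s' - s))
     + v * B * ((2 * sqrt (t - s') - 2 * sqrt (s' - s')) - (2 * sqrt (t - s) - 2 * sqrt (s' - s)))"
  proof (rule integral_abs_le)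
    show "has_bochner_integral lborel ?g (v * B * (2 * sqrt (s' - s) - 2 * sqrt (s - s))
     + v * D * sqrt (s' - s) * (2 * sqrt (t - s) - 2 * sqrt (s' - s))
     + v * B * ((2 * sqrt (t - s') - 2 * sqrt (s' - s')) - (2 * sqrt (t - s) - 2 * sqrt (s' - s))))"
      by (intro has_bochner_integral_add has_bochner_integral_diff has_bochner_integral_mult_right
          has_bochner_integral_inverse_sqrt) (use ts in auto)
    fix z
    have g2: "indicator {s'<..<t} z / sqrt (z - s') - indicator {s'<..<t} z / sqrt (z - s) \<ge> 0"
      using ts by (auto simp: indicator_def intro!: divide_left_mono)
    then have gpos: "?g z \<ge> 0"
      using v D B ts by (intro add_nonneg_nonneg mult_nonneg_nonneg) (auto simp: indicator_def)
    consider "z = s'" | "s < z" "z < s'" | "s' < z" "z < t" | "z \<le> s \<or> t \<le> z" by linarith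
    then show "\<bar>if z = s' then 0 else ?h z\<bar> \<le> ?g z"
    proof cases
      case 1
      then show ?thesis using gpos by simp
    next
      case 2
      have "?h z = V t z * b z s / sqrt (z - s)" using 2 ts by (simp add: sing_def)
      also have "\<bar>\<dots>\<bar> = \<bar>V t z\<bar> * \<bar>b z s\<bar> / sqrt (z - s)" using 2 by (simp add: abs_mult)
      also have "\<dots> \<le> v * B / sqrt (z - s)"
        using 2 ts v by (intro divide_right_mono mult_mono V B) auto
      also have "\<dots> = ?g z" using 2 ts by simp
      finally show ?thesis using 2 by simp
    next
      case 3
      have "?h z = V t z * ((b z s - b z s') / sqrt (z - s) - b z s' * (1 / sqrt (z - s') - 1 / sqrt (z - s)))"
        using 3 ts by (simp add: sing_def algebra_simps diff_divide_distrib)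
      also have "\<bar>\<dots>\<bar> \<le> v * (D * sqrt (s' - s) / sqrt (z - s) + B * (1 / sqrt (z - s') - 1 / sqrt (z - s)))"
        unfolding abs_mult
      proof (intro mult_mono V v)
        have "\<bar>b z s - b z s'\<bar> \<le> D * sqrt (dist (z, s) (z, s'))"
          using D(1)[of "(z, s)" "(z, s')"] 3 ts by auto
        then have 1: "\<bar>b z s - b z s'\<bar> \<le> D * sqrt (s' - s)"
          using ts by (simp add: dist_prod_def dist_real_def)
        have "\<bar>(b z s - b z s') / sqrt (z - s)\<bar> \<le> D * sqrt (s' - s) / sqrt (z - s)"
          using 1 3 ts by (simp add: divide_right_mono)
        moreover have "\<bar>b z s' * (1 / sqrt (z - s') - 1 / sqrt (z - s))\<bar> \<le> B * (1 / sqrt (z - s') - 1 / sqrt (z - s))"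
          unfolding abs_mult
        proof (rule mult_mono)
          have "1 / sqrt (z - s') - 1 / sqrt (z - s) \<ge> 0" using 3 ts by (auto intro!: divide_left_mono)
          then show "\<bar>1 / sqrt (z - s') - 1 / sqrt (z - s)\<bar> \<le> 1 / sqrt (z - s') - 1 / sqrt (z - s)" by linarith
        qed (use B 3 ts in auto)
        ultimately show "\<bar>(b z s - b z s') / sqrt (z - s) - b z s' * (1 / sqrt (z - s') - 1 / sqrt (z - s))\<bar>
          \<le> D * sqrt (s' - s) / sqrt (z - s) + B * (1 / sqrt (z - s') - 1 / sqrt (z - s))"
          by linarith
      qed (use 3 ts in auto)
      also have "\<dots> = ?g z" using 3 ts by (simp add: algebra_simps)
      finally show ?thesis using 3 by simp
    next
      case 4
      then have "?h z = 0" using supp[of t z] ts by (auto simp: sing_def)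
      then have "\<bar>if z = s' then 0 else ?h z\<bar> = 0" by (simp only: abs_zero if_cancel)
      then show ?thesis using gpos by linarith
    qed
  qed
  also have "\<dots> \<le> v * B * (2 * sqrt (s' - s)) + v * D * sqrt (s' - s) * (2 * sqrt L) + v * B * (2 * sqrt (s' - s))"
  proof (intro add_mono mult_left_mono)
    have "sqrt (t - s) \<le> sqrt L" using ts by simp
    then show "2 * sqrt (t - s) - 2 * sqrt (s' - s) \<le> 2 * sqrt L"
      using real_sqrt_ge_zero[of "s' - s"] ts by linarith
    have "sqrt (t - s') \<le> sqrt (t - s)" using ts by simp
    then show "(2 * sqrt (t - s') - 2 * sqrt (s' - s')) - (2 * sqrt (t - s) - 2 * sqrt (s' - s)) \<le> 2 * sqrt (s' - s)" by simp
  qed (use v B D ts in auto)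
  finally show ?thesis by (simp add: algebra_simps)
qed

section \<open>The resolvent kernel\<close>

lemma integral_eq_lborel:
  fixes f :: "real \<Rightarrow> real"
  assumes "integrable lborel f" "\<And>x. x \<notin> S \<Longrightarrow> f x = 0"
  shows "integral S f = (\<integral>x. f x \<partial>lborel)"
proof -
  have "integral UNIV (\<lambda>x. if x \<in> S then f x else 0) = integral S f"
    by (rule integral_restrict_UNIV)
  also have "(\<lambda>x. if x \<in> S then f x else 0) = f" using assms(2) by auto
  finally show ?thesis using integral_lborel[OF assms(1)] by simp
qed

text \<open>The case distinction in \<open>H1_eq\<close> records that \<open>Kker\<close> is 0 at s
  = 0, where the amplitude \<open>a\<close> need not vanish.\<close>

locale volterra_kernel =
  fixes L :: real and X :: "real \<Rightarrow> real" and a :: "real \<Rightarrow> real \<Rightarrow> real"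
  assumes L_pos: "L > 0"
    and a_holder: "holder_on (1/2) (tri L) (case_prod a)"
    and H1_eq: "H1ker X L t s = (if 0 < s then sing L a t s else 0)"
begin

lemma H1_support: "(t, s) \<notin> tri L \<or> s \<le> 0 \<Longrightarrow> H1ker X L t s = 0"
  unfolding H1_eq by (auto simp: sing_def)

lemma Hit_support: "(t, s) \<notin> tri L \<or> s \<le> 0 \<Longrightarrow> Hit X L n t s = 0"
proof (induction n arbitrary: t s)
  case 0
  then show ?case using H1_support by simp
next
  case (Suc n)
  have 0: "Hit X L n t z * H1ker X L z s = 0" for z
  proof (cases "(t, z) \<in> tri L \<and> (z, s) \<in> tri L \<and> s > 0")
    case True
    then have "(t, s) \<in> tri L" by auto
    with True Suc.prems show ?thesis by linarith
  next
    case False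
    then show ?thesis using Suc.IH[of t z] H1_support[of z s] by force
  qed
  show ?case unfolding Hit.simps 0 by simp
qed

text \<open>\<open>iter n\<close> is H with index n + 2: the count starts at the first bounded
  iterate. The singular H with index 1 enters separately, through \<open>Kker\<close>.\<close>

definition iter :: "nat \<Rightarrow> real \<Rightarrow> real \<Rightarrow> real" where
  "iter n t s = Hit X L (Suc n) t s"

lemma iter_support: "(t, s) \<notin> tri L \<or> s \<le> 0 \<Longrightarrow> iter n t s = 0"
  unfolding iter_def by (rule Hit_support)

lemma iter_0: "iter 0 t s = (if (t, s) \<in> tri L \<and> 0 < s then conv (sing L a) (sing L a) t s else 0)"
proof (cases "(t, s) \<in> tri L \<and> 0 < s")
  case True
  have eq: "Hit X L 0 t z * H1ker X L z s = sing L a t z * sing L a z s" for z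
    using True unfolding Hit.simps H1_eq by (auto simp: sing_def)
  have "iter 0 t s = integral {0..L} (\<lambda>z. sing L a t z * sing L a z s)"
    unfolding iter_def Hit.simps(2) eq ..
  also have "\<dots> = conv (sing L a) (sing L a) t s"
    unfolding conv_def
    by (intro integral_eq_lborel integrable_sing_sing a_holder) (use True in \<open>auto simp: sing_def\<close>)
  finally show ?thesis using True by simp
next
  case False
  then show ?thesis using iter_support[of t s 0] by force
qed

text \<open>Rewriting the gauge integral in \<open>Hit\<close> as a Lebesgue convolution requires
  integrability. The recursion is therefore conditional on a bound for \<open>iter n\<close> and can
  be used only inside the induction that supplies it.\<close>

lemma iter_Suc:
  assumes "case_prod (iter n) \<in> borel_measurable (borel \<Otimes>\<^sub>M borel)"
    and "\<And>t z. (t, z) \<in> tri L \<Longrightarrow> \<bar>iter n t z\<bar> \<le> v"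
  shows "iter (Suc n) t s = (if (t, s) \<in> tri L \<and> 0 < s then conv (iter n) (sing L a) t s else 0)"
proof (cases "(t, s) \<in> tri L \<and> 0 < s")
  case True
  have eq: "Hit X L (Suc n) t z * H1ker X L z s = iter n t z * sing L a z s" for z
    using True unfolding iter_def H1_eq by (auto simp: sing_def)
  have "iter (Suc n) t s = integral {0..L} (\<lambda>z. iter n t z * sing L a z s)"
    unfolding iter_def[of "Suc n"] Hit.simps(2)[of _ _ "Suc n"] eq ..
  also have "\<dots> = conv (iter n) (sing L a) t s"
    unfolding conv_def
    by (intro integral_eq_lborel integrable_bdd_sing[where v=v] assms a_holder)
      (use True in \<open>auto simp: sing_def iter_support\<close>)
  finally show ?thesis using True by simp
next
  case False
  then show ?thesis using iter_support[of t s "Suc n"] by force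
qed

text \<open>The exponential weight \<open>exp (l * (t - s))\<close> turns the convolution with the
  singular kernel into a contraction, so that the iterates decay geometrically.\<close>

lemma iter_bounds:
  "\<exists>l v p. l \<ge> 0 \<and> v \<ge> 0 \<and> p \<ge> 0 \<and> (\<forall>n.
    case_prod (iter n) \<in> borel_measurable (borel \<Otimes>\<^sub>M borel) \<and>
    (\<forall>t s. (t, s) \<in> tri L \<longrightarrow> \<bar>iter n t s\<bar> \<le> v / 4 ^ n * exp (l * (t - s))) \<and>
    (\<forall>t t' s. 0 \<le> s \<and> s < t \<and> t \<le> t' \<and> t' < L \<longrightarrow>
       \<bar>iter n t s - iter n t' s\<bar> \<le> p / 2 ^ n * exp (l * (t' - s)) * sqrt (t' - t)))"
proof -
  obtain A where A: "A \<ge> 0" "\<And>t s. (t, s) \<in> tri L \<Longrightarrow> \<bar>a t s\<bar> \<le> A"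
    using holder_tri_bounded[OF a_holder] by blast
  note c = holder_conv_sing_sing[OF a_holder a_holder]
  obtain v where v: "v \<ge> 0" "\<And>t s. (t, s) \<in> tri L \<Longrightarrow> \<bar>conv (sing L a) (sing L a) t s\<bar> \<le> v"
    using holder_tri_bounded[OF c] by blast
  obtain q where q: "q \<ge> 0" "\<And>x y. x \<in> tri L \<Longrightarrow> y \<in> tri L \<Longrightarrow>
      \<bar>case_prod (conv (sing L a) (sing L a)) x - case_prod (conv (sing L a) (sing L a)) y\<bar> \<le> q * sqrt (dist x y)"
    using holder_halfD[OF c] by blast
  \<comment> \<open>The Hoelder constants obey p_(n+1) \<le> p_n / 4 + 2 A v / 4^n. With ratio 1/2
    instead of 1/4 there is room for the second term, provided that 8 v A \<le> p: each summand is
    then at most a quarter of p / 2^n.\<close>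
  define p where "p = max q (8 * v * A)"
  have p: "p \<ge> 0" "q \<le> p" "8 * v * A \<le> p" using q by (auto simp: p_def)
  \<comment> \<open>The threshold is chosen to give A k \<le> 1/4; A + 1 replaces A because A may be
    0.\<close>
  obtain l k where l: "l \<ge> 0" and k: "k \<ge> 0" "k \<le> 1 / (4 * (A + 1))"
    "has_bochner_integral lborel (\<lambda>y. indicator {0<..<L} y * exp (- l * y) / sqrt y) k"
    using exponential_weight_small[of "1 / (4 * (A + 1))" L] A(1) by auto
  have "A * k \<le> (A + 1) * (1 / (4 * (A + 1)))" using A k by (intro mult_mono) auto
  also have "\<dots> = 1 / 4" using A by simp
  finally have Ak: "A * k \<le> 1 / 4" .
  let ?P = "\<lambda>n. case_prod (iter n) \<in> borel_measurable (borel \<Otimes>\<^sub>M borel) \<and>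
    (\<forall>t s. (t, s) \<in> tri L \<longrightarrow> \<bar>iter n t s\<bar> \<le> v / 4 ^ n * exp (l * (t - s))) \<and>
    (\<forall>t t' s. 0 \<le> s \<and> s < t \<and> t \<le> t' \<and> t' < L \<longrightarrow>
       \<bar>iter n t s - iter n t' s\<bar> \<le> p / 2 ^ n * exp (l * (t' - s)) * sqrt (t' - t))"
  have exp1: "1 \<le> exp (l * (t - s))" if "s \<le> t" for t s using that l by simp
  note [measurable] = sing_measurable[OF a_holder]
  have "?P n" for n
  proof (induction n)
    case 0
    have eq: "case_prod (iter 0) = (\<lambda>x. if x \<in> tri L \<and> 0 < snd x then case_prod (conv (sing L a) (sing L a)) x else 0)"
      unfolding iter_0 by (auto simp: fun_eq_iff)
    have [measurable]: "case_prod (conv (sing L a) (sing L a)) \<in> borel_measurable (borel \<Otimes>\<^sub>M borel)"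
      by (intro conv_measurable sing_measurable a_holder)
    have m: "case_prod (iter 0) \<in> borel_measurable (borel \<Otimes>\<^sub>M borel)" unfolding eq by measurable
    have b: "\<bar>iter 0 t s\<bar> \<le> v / 4 ^ 0 * exp (l * (t - s))" if "(t, s) \<in> tri L" for t s
    proof -
      have "\<bar>iter 0 t s\<bar> \<le> v" unfolding iter_0 using v that by auto
      also have "\<dots> \<le> v * exp (l * (t - s))" using exp1[of s t] that v by (simp add: mult_le_cancel_left1)
      finally show ?thesis by simp
    qed
    have h: "\<bar>iter 0 t s - iter 0 t' s\<bar> \<le> p / 2 ^ 0 * exp (l * (t' - s)) * sqrt (t' - t)"
      if "0 \<le> s" "s < t" "t \<le> t'" "t' < L" for t t' s
    proof -
      have "dist (t, s) (t', s) = t' - t" using that by (simp add: dist_prod_def dist_real_def)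
      then have "\<bar>iter 0 t s - iter 0 t' s\<bar> \<le> q * sqrt (t' - t)"
        unfolding iter_0 using q(2)[of "(t, s)" "(t', s)"] that q(1) by auto
      also have "\<dots> \<le> p * exp (l * (t' - s)) * sqrt (t' - t)"
      proof (rule mult_right_mono)
        have "q * 1 \<le> p * exp (l * (t' - s))" using exp1[of s t'] that p q by (intro mult_mono) auto
        then show "q \<le> p * exp (l * (t' - s))" by simp
      qed (use that in auto)
      finally show ?thesis by simp
    qed
    show ?case using m b h by blast
  next
    case (Suc n)
    then have m: "case_prod (iter n) \<in> borel_measurable (borel \<Otimes>\<^sub>M borel)"
      and b: "\<And>t s. (t, s) \<in> tri L \<Longrightarrow> \<bar>iter n t s\<bar> \<le> v / 4 ^ n * exp (l * (t - s))"
      and h: "\<And>t t' s. 0 \<le> s \<Longrightarrow> s < t \<Longrightarrow> t \<le> t' \<Longrightarrow> t' < L \<Longrightarrow>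
       \<bar>iter n t s - iter n t' s\<bar> \<le> p / 2 ^ n * exp (l * (t' - s)) * sqrt (t' - t)"
      by blast+
    have v4: "v / 4 ^ n \<ge> 0" using v by simp
    have bb: "\<bar>iter n t s\<bar> \<le> v / 4 ^ n * exp (l * L)" if "(t, s) \<in> tri L" for t s
    proof -
      have "exp (l * (t - s)) \<le> exp (l * L)" using that l by (auto intro: mult_left_mono)
      then show ?thesis using b[OF that] mult_left_mono[OF _ v4] by (meson order_trans)
    qed
    have eq': "iter (Suc n) t s = (if (t, s) \<in> tri L \<and> 0 < s then conv (iter n) (sing L a) t s else 0)" for t s
      by (rule iter_Suc[OF m bb])
    have eq: "case_prod (iter (Suc n)) = (\<lambda>x. if x \<in> tri L \<and> 0 < snd x then case_prod (conv (iter n) (sing L a)) x else 0)"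
      by (auto simp: fun_eq_iff eq')
    have [measurable]: "case_prod (conv (iter n) (sing L a)) \<in> borel_measurable (borel \<Otimes>\<^sub>M borel)"
      by (rule conv_measurable[OF m sing_measurable[OF a_holder]])
    have m': "case_prod (iter (Suc n)) \<in> borel_measurable (borel \<Otimes>\<^sub>M borel)" unfolding eq by measurable
    have b': "\<bar>iter (Suc n) t s\<bar> \<le> v / 4 ^ Suc n * exp (l * (t - s))" if "(t, s) \<in> tri L" for t s
    proof -
      have "\<bar>iter (Suc n) t s\<bar> \<le> \<bar>conv (iter n) (sing L a) t s\<bar>" unfolding eq' by simp
      also have "\<dots> \<le> v / 4 ^ n * A * k * exp (l * (t - s))"
        by (rule conv_sing_bound[OF _ b v4 A(2,1) k(3) that]) (auto simp: iter_support)
      also have "\<dots> = (v / 4 ^ n * exp (l * (t - s))) * (A * k)" by (simp add: mult_ac)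
      also have "\<dots> \<le> (v / 4 ^ n * exp (l * (t - s))) * (1 / 4)"
        using v(1) by (intro mult_left_mono Ak) auto
      finally show ?thesis by (simp add: mult_ac)
    qed
    have h': "\<bar>iter (Suc n) t s - iter (Suc n) t' s\<bar> \<le> p / 2 ^ Suc n * exp (l * (t' - s)) * sqrt (t' - t)"
      if "0 \<le> s" "s < t" "t \<le> t'" "t' < L" for t t' s
    proof -
      have "\<bar>iter (Suc n) t s - iter (Suc n) t' s\<bar> \<le> \<bar>conv (iter n) (sing L a) t s - conv (iter n) (sing L a) t' s\<bar>"
        unfolding eq' using that by auto
      also have "\<dots> \<le> (p / 2 ^ n * A * k + 2 * (v / 4 ^ n) * A) * exp (l * (t' - s)) * sqrt (t' - t)"
        by (rule conv_sing_holder_left[OF m _ b v4 h _ a_holder A(2,1) k(3) l that])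
          (use p in \<open>auto simp: iter_support\<close>)
      also have "\<dots> \<le> (p / 2 ^ Suc n) * exp (l * (t' - s)) * sqrt (t' - t)"
      proof (intro mult_right_mono)
        have 1: "p / 2 ^ n * (A * k) \<le> p / 2 ^ n * (1 / 4)" using p by (intro mult_left_mono Ak) auto
        have "(8 * v * A) / 4 ^ n \<le> p / 4 ^ n" using p by (intro divide_right_mono) auto
        also have "\<dots> \<le> p / 2 ^ n" using p by (intro divide_left_mono power_mono) auto
        finally have "2 * (v / 4 ^ n) * A \<le> p / 2 ^ n * (1 / 4)" by simp
        then show "p / 2 ^ n * A * k + 2 * (v / 4 ^ n) * A \<le> p / 2 ^ Suc n"
          using 1 by simp
      qed (use that in auto)
      finally show ?thesis .
    qed
    show ?case using m' b' h' by blast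
  qed
  then show ?thesis using l v(1) p(1) by blast
qed

text \<open>The geometric bounds are summed termwise. Regularity is stated in t only:
  \<open>Gker\<close> is 0 at s = 0 by definition, so continuity in s up to that edge cannot be
  expected.\<close>

lemma Gker_bounds:
  "\<exists>C\<ge>0. case_prod (Gker X L) \<in> borel_measurable (borel \<Otimes>\<^sub>M borel) \<and>
    (\<forall>t s. (t, s) \<notin> tri L \<longrightarrow> Gker X L t s = 0) \<and>
    (\<forall>t s. (t, s) \<in> tri L \<longrightarrow> \<bar>Gker X L t s\<bar> \<le> C) \<and>
    (\<forall>t t' s. 0 \<le> s \<and> s < t \<and> t \<le> t' \<and> t' < L \<longrightarrow> \<bar>Gker X L t s - Gker X L t' s\<bar> \<le> C * sqrt (t' - t))"
proof -
  obtain l v p where lvp: "l \<ge> 0" "v \<ge> 0" "p \<ge> 0"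
    and m: "\<And>n. case_prod (iter n) \<in> borel_measurable (borel \<Otimes>\<^sub>M borel)"
    and b: "\<And>n t s. (t, s) \<in> tri L \<Longrightarrow> \<bar>iter n t s\<bar> \<le> v / 4 ^ n * exp (l * (t - s))"
    and h: "\<And>n t t' s. 0 \<le> s \<and> s < t \<and> t \<le> t' \<and> t' < L \<Longrightarrow>
       \<bar>iter n t s - iter n t' s\<bar> \<le> p / 2 ^ n * exp (l * (t' - s)) * sqrt (t' - t)"
    using iter_bounds by blast
  have G: "Gker X L t s = pi * (\<Sum>n. iter n t s)" for t s
    unfolding Gker_def iter_def ..
  let ?E = "exp (l * L)"
  have E: "exp (l * (t - s)) \<le> ?E" if "(t, s) \<in> tri L" for t s
    using that lvp by (auto intro: mult_left_mono)
  have half: "(\<lambda>n. c * (1/2) ^ n) sums (c * 2)" for c :: real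
    using sums_mult[OF geometric_sums[of "1/2::real"], of c] by simp
  have b2: "\<bar>iter n t s\<bar> \<le> v * ?E * (1/2) ^ n" if "(t, s) \<in> tri L" for n t s
  proof -
    have "\<bar>iter n t s\<bar> \<le> v / 4 ^ n * exp (l * (t - s))" by (rule b[OF that])
    also have "\<dots> \<le> v / 2 ^ n * ?E"
      using lvp E[OF that] by (intro mult_mono divide_left_mono power_mono) auto
    finally show ?thesis by (simp add: power_divide mult_ac)
  qed
  have sm: "summable (\<lambda>n. iter n t s)" for t s
  proof (cases "(t, s) \<in> tri L")
    case True
    then show ?thesis
      by (intro summable_comparison_test'[OF sums_summable[OF half[of "v * ?E"]]]) (use b2 in auto)
  qed (simp add: iter_support)
  have series_le: "\<bar>\<Sum>n. f n\<bar> \<le> c * 2" if "summable f" "\<And>n. \<bar>f n\<bar> \<le> c * (1/2) ^ n" for f and c :: real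
  proof -
    have "summable (\<lambda>n. \<bar>f n\<bar>)"
      by (rule summable_comparison_test'[OF sums_summable[OF half[of c]]]) (use that in auto)
    then have "\<bar>\<Sum>n. f n\<bar> \<le> (\<Sum>n. \<bar>f n\<bar>)" by (rule summable_rabs)
    also have "\<dots> \<le> (\<Sum>n. c * (1/2) ^ n)"
      by (intro suminf_le that \<open>summable (\<lambda>n. \<bar>f n\<bar>)\<close> sums_summable[OF half])
    also have "\<dots> = c * 2" by (rule sums_unique[OF half, symmetric])
    finally show ?thesis .
  qed
  have "\<bar>Gker X L t s\<bar> \<le> pi * ((v + p) * ?E * 2)" if "(t, s) \<in> tri L" for t s
  proof -
    have "\<bar>\<Sum>n. iter n t s\<bar> \<le> (v * ?E) * 2" by (rule series_le[OF sm b2[OF that]])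
    also have "\<dots> \<le> (v + p) * ?E * 2" using lvp by simp
    finally show ?thesis unfolding G abs_mult by simp
  qed
  moreover have "\<bar>Gker X L t s - Gker X L t' s\<bar> \<le> pi * ((v + p) * ?E * 2) * sqrt (t' - t)"
    if *: "0 \<le> s \<and> s < t \<and> t \<le> t' \<and> t' < L" for t t' s
  proof -
    have ts': "(t', s) \<in> tri L" using * by auto
    have "\<bar>\<Sum>n. iter n t s - iter n t' s\<bar> \<le> (p * ?E * sqrt (t' - t)) * 2"
    proof (rule series_le)
      fix n
      have "\<bar>iter n t s - iter n t' s\<bar> \<le> p / 2 ^ n * exp (l * (t' - s)) * sqrt (t' - t)"
        by (rule h[OF *])
      also have "\<dots> \<le> p / 2 ^ n * ?E * sqrt (t' - t)"
        using lvp E[OF ts'] * by (intro mult_right_mono mult_left_mono) auto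
      finally show "\<bar>iter n t s - iter n t' s\<bar> \<le> p * ?E * sqrt (t' - t) * (1/2) ^ n"
        by (simp add: power_divide mult_ac)
    qed (intro summable_diff sm)
    also have "\<dots> \<le> (v + p) * ?E * 2 * sqrt (t' - t)"
      using lvp * by (simp add: algebra_simps)
    finally have "\<bar>\<Sum>n. iter n t s - iter n t' s\<bar> \<le> (v + p) * ?E * 2 * sqrt (t' - t)" .
    moreover have "Gker X L t s - Gker X L t' s = pi * (\<Sum>n. iter n t s - iter n t' s)"
      unfolding G by (simp add: suminf_diff[OF sm sm, symmetric] right_diff_distrib)
    ultimately show ?thesis by (simp add: abs_mult mult.assoc)
  qed
  moreover have "Gker X L t s = 0" if "(t, s) \<notin> tri L" for t s
    unfolding G using that by (simp add: iter_support)
  moreover have "case_prod (Gker X L) \<in> borel_measurable (borel \<Otimes>\<^sub>M borel)"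
  proof -
    have "case_prod (Gker X L) = (\<lambda>x. pi * (\<Sum>n. case_prod (iter n) x))"
      by (auto simp: G fun_eq_iff)
    also have "\<dots> \<in> borel_measurable (borel \<Otimes>\<^sub>M borel)"
      by (intro borel_measurable_times borel_measurable_const borel_measurable_suminf m)
    finally show ?thesis .
  qed
  moreover have "pi * ((v + p) * ?E * 2) \<ge> 0" using lvp by simp
  ultimately show ?thesis by blast
qed

text \<open>This is pi times the resolvent kernel, the sum of all H with index at least 1.\<close>

definition resolvent :: "real \<Rightarrow> real \<Rightarrow> real" where
  "resolvent t s = Kker X L s t + Gker X L t s"

lemma Kker_eq: "Kker X L s t = (if 0 < s then pi * sing L a t s else 0)"
proof -
  have "Kker X L s t = pi * H1ker X L t s"
    by (auto simp: H1ker_def Kker_def indicator_def)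
  then show ?thesis by (simp add: H1_eq)
qed

section \<open>Size of the resolvent and its action on singular kernels\<close>

lemma resolvent_support: "(t, s) \<notin> tri L \<Longrightarrow> resolvent t s = 0"
  using Gker_bounds by (auto simp: resolvent_def Kker_eq sing_def)

lemma resolvent_measurable: "case_prod resolvent \<in> borel_measurable (borel \<Otimes>\<^sub>M borel)"
proof -
  note [measurable] = sing_measurable[OF a_holder]
  have [measurable]: "case_prod (Gker X L) \<in> borel_measurable (borel \<Otimes>\<^sub>M borel)"
    using Gker_bounds by blast
  show ?thesis unfolding resolvent_def Kker_eq by measurable
qed

lemma resolvent_bound:
  "\<exists>M\<ge>0. \<forall>t s. (t, s) \<in> tri L \<longrightarrow> \<bar>resolvent t s\<bar> \<le> M / sqrt (t - s)"
proof -
  obtain A where A: "A \<ge> 0" "\<And>t s. (t, s) \<in> tri L \<Longrightarrow> \<bar>a t s\<bar> \<le> A"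
    using holder_tri_bounded[OF a_holder] by blast
  obtain C where C: "C \<ge> 0" "\<And>t s. (t, s) \<in> tri L \<Longrightarrow> \<bar>Gker X L t s\<bar> \<le> C"
    using Gker_bounds by blast
  have "\<bar>resolvent t s\<bar> \<le> (pi * A + C * sqrt L) / sqrt (t - s)" if ts: "(t, s) \<in> tri L" for t s
  proof -
    have "sqrt (t - s) > 0" using ts by auto
    have "\<bar>Kker X L s t\<bar> \<le> pi * (\<bar>a t s\<bar> / sqrt (t - s))"
      unfolding Kker_eq using ts by (simp add: sing_def abs_mult)
    also have "\<dots> \<le> pi * (A / sqrt (t - s))"
      using A(2)[OF ts] ts by (intro mult_left_mono divide_right_mono) auto
    finally have 1: "\<bar>Kker X L s t\<bar> \<le> pi * A / sqrt (t - s)" by simp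
    have "\<bar>Gker X L t s\<bar> \<le> C * 1" using C(2)[OF ts] by simp
    also have "\<dots> \<le> C * (sqrt L / sqrt (t - s))"
      using ts C(1) by (intro mult_left_mono) auto
    finally show ?thesis using 1 unfolding resolvent_def add_divide_distrib by simp
  qed
  moreover have "pi * A + C * sqrt L \<ge> 0" using A C L_pos by simp
  ultimately show ?thesis by blast
qed

text \<open>The cut-off of \<open>Kker\<close> at z = 0 is invisible here: if (z, s) lies in the
  triangle then z > s \<ge> 0.\<close>

lemma resolvent_sing_eq:
  "resolvent t z * sing L b z s = pi * (sing L a t z * sing L b z s) + Gker X L t z * sing L b z s"
proof (cases "(z, s) \<in> tri L")
  case True
  then have "z > 0" by auto
  then show ?thesis by (simp add: resolvent_def Kker_eq algebra_simps)
next
  case False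
  then have "sing L b z s = 0" unfolding sing_def by (rule if_not_P)
  then show ?thesis by simp
qed

lemma integrable_Gker_sing:
  assumes b: "holder_on (1/2) (tri L) (case_prod b)"
  shows "integrable lborel (\<lambda>z. Gker X L t z * sing L b z s)"
proof -
  obtain C where "case_prod (Gker X L) \<in> borel_measurable (borel \<Otimes>\<^sub>M borel)"
    and "\<And>t s. (t, s) \<notin> tri L \<Longrightarrow> Gker X L t s = 0"
    and "\<And>t s. (t, s) \<in> tri L \<Longrightarrow> \<bar>Gker X L t s\<bar> \<le> C"
    using Gker_bounds by blast
  from integrable_bdd_sing[OF this b] show ?thesis .
qed

lemma integrable_resolvent_sing:
  assumes b: "holder_on (1/2) (tri L) (case_prod b)" and ts: "(t, s) \<in> tri L"
  shows "integrable lborel (\<lambda>z. resolvent t z * sing L b z s)"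
  unfolding resolvent_sing_eq
  by (intro Bochner_Integration.integrable_add integrable_mult_right integrable_sing_sing(1)
      integrable_Gker_sing a_holder b ts)

text \<open>The singular part of the resolvent is covered by the beta substitution. For the
  \<open>Gker\<close> part, regularity in t comes from \<open>Gker\<close> and regularity in s from
  \<open>b\<close>; the two are joined by \<open>holder_tri_sections\<close>.\<close>

lemma holder_conv_resolvent:
  assumes b: "holder_on (1/2) (tri L) (case_prod b)"
  shows "holder_on (1/2) (tri L) (case_prod (conv resolvent (sing L b)))"
proof -
  obtain B where B: "B \<ge> 0" "\<And>t s. (t, s) \<in> tri L \<Longrightarrow> \<bar>b t s\<bar> \<le> B"
    using holder_tri_bounded[OF b] by blast
  obtain D where D: "D \<ge> 0" "\<And>x y. x \<in> tri L \<Longrightarrow> y \<in> tri L \<Longrightarrow>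
      \<bar>case_prod b x - case_prod b y\<bar> \<le> D * sqrt (dist x y)"
    using holder_halfD[OF b] by blast
  obtain C where C: "C \<ge> 0" and m: "case_prod (Gker X L) \<in> borel_measurable (borel \<Otimes>\<^sub>M borel)"
    and supp: "\<And>t s. (t, s) \<notin> tri L \<Longrightarrow> Gker X L t s = 0"
    and bd: "\<And>t s. (t, s) \<in> tri L \<Longrightarrow> \<bar>Gker X L t s\<bar> \<le> C"
    and h: "\<And>t t' s. 0 \<le> s \<Longrightarrow> s < t \<Longrightarrow> t \<le> t' \<Longrightarrow> t' < L \<Longrightarrow> \<bar>Gker X L t s - Gker X L t' s\<bar> \<le> C * sqrt (t' - t)"
    using Gker_bounds by blast
  \<comment> \<open>No decay has to be gained here, so the exponential weight is switched off: l =
    0, with mass 2 \<open>sqrt L\<close>.\<close>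
  have k: "has_bochner_integral lborel (\<lambda>y. indicator {0<..<L} y * exp (- 0 * y) / sqrt y) (2 * sqrt L)"
    using has_bochner_integral_inverse_sqrt[of 0 0 L] L_pos by simp
  have G: "holder_on (1/2) (tri L) (case_prod (conv (Gker X L) (sing L b)))"
  proof (rule holder_tri_sections)
    fix t t' s :: real assume ts: "0 \<le> s" "s < t" "t \<le> t'" "t' < L"
    show "\<bar>conv (Gker X L) (sing L b) t s - conv (Gker X L) (sing L b) t' s\<bar>
       \<le> (C * B * (2 * sqrt L) + 2 * C * B) * sqrt (t' - t)"
      using conv_sing_holder_left[where l=0, OF m supp _ C _ C b B(2,1) k _ ts] bd h by simp
  next
    fix t s s' :: real assume ts: "0 \<le> s" "s \<le> s'" "s' < t" "t < L"
    show "\<bar>conv (Gker X L) (sing L b) t s - conv (Gker X L) (sing L b) t s'\<bar>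
       \<le> (4 * C * B + 2 * C * D * sqrt L) * sqrt (s' - s)"
      by (rule conv_sing_holder_right[OF m supp bd C b B(2,1) D(2,1) ts])
  qed (use C B D L_pos in auto)
  have "holder_on (1/2) (tri L) (\<lambda>x. pi * case_prod (conv (sing L a) (sing L b)) x + case_prod (conv (Gker X L) (sing L b)) x)"
    by (intro holder_half_add holder_half_cmult G holder_conv_sing_sing a_holder b)
  then show ?thesis
  proof (rule holder_half_cong)
    fix x assume x: "x \<in> tri L"
    obtain t s where e: "x = (t, s)" by (cases x)
    have "conv resolvent (sing L b) t s = pi * conv (sing L a) (sing L b) t s + conv (Gker X L) (sing L b) t s"
      unfolding conv_def resolvent_sing_eq using x e
      by (subst Bochner_Integration.integral_add)
        (auto intro!: integrable_sing_sing integrable_Gker_sing a_holder b)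
    then show "pi * case_prod (conv (sing L a) (sing L b)) x + case_prod (conv (Gker X L) (sing L b)) x =
        case_prod (conv resolvent (sing L b)) x" by (simp add: e)
  qed
qed

end

section \<open>Kernels of a moving boundary\<close>

lemma gaussian_has_bochner_integral:
  "has_bochner_integral lborel (\<lambda>y::real. exp (- y\<^sup>2)) (sqrt pi)"
  using has_bochner_integral_even_function[OF gaussian_moment_0] by simp

lemma gaussian_abs_has_bochner_integral:
  "has_bochner_integral lborel (\<lambda>y::real. exp (- y\<^sup>2) * \<bar>y\<bar>) 1"
proof -
  have "has_bochner_integral lborel (\<lambda>y::real. indicator {0..} y *\<^sub>R (exp (- y\<^sup>2) * \<bar>y\<bar>)) (1 / 2)"
    using gaussian_moment_1 by (rule has_bochner_integral_cong[THEN iffD1, rotated -1]) (auto simp: indicator_def)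
  from has_bochner_integral_even_function[OF this] show ?thesis by simp
qed

text \<open>The substitution x = c + 2 sqrt \<tau> y absorbs the prefactor, so the initial
  contribution is an average against a fixed Gaussian and stays bounded as \<tau> tends to
  0.\<close>

lemma integral_translate_scale:
  fixes w :: "real \<Rightarrow> real"
  assumes "\<tau> > 0"
  shows "1 / sqrt \<tau> * (\<integral>x. exp (- (c - x)\<^sup>2 / (4 * \<tau>)) * w x \<partial>lborel)
    = 2 * (\<integral>y. exp (- y\<^sup>2) * w (c + 2 * sqrt \<tau> * y) \<partial>lborel)"
proof -
  have e: "(2 * sqrt \<tau> * y)\<^sup>2 / (4 * \<tau>) = y\<^sup>2" for y
    using assms by (simp add: power_mult_distrib)
  have "(\<integral>x. exp (- (c - x)\<^sup>2 / (4 * \<tau>)) * w x \<partial>lborel)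
     = 2 * sqrt \<tau> * (\<integral>y. exp (- y\<^sup>2) * w (c + 2 * sqrt \<tau> * y) \<partial>lborel)"
    by (subst lborel_integral_real_affine[where c="2 * sqrt \<tau>" and t=c]) (use assms e in auto)
  then show ?thesis using assms by simp
qed

locale moving_boundary =
  fixes L :: real and X X' :: "real \<Rightarrow> real"
  assumes L_pos: "L > 0" and X_0: "X 0 = 0"
    and X_deriv: "\<And>x. x \<in> {0..L} \<Longrightarrow> (X has_real_derivative X' x) (at x within {0..L})"
    and X'_holder: "holder_on (1/2) {0..L} X'"
begin

definition quot :: "real \<Rightarrow> real \<Rightarrow> real" where
  "quot t s = (X t - X s) / (t - s)"

definition heat :: "real \<Rightarrow> real \<Rightarrow> real" where
  "heat t s = exp (- (X t - X s)\<^sup>2 / (4 * (t - s)))"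

definition amp :: "real \<Rightarrow> real \<Rightarrow> real" where
  "amp t s = 1 / pi * (sqrt pi / 2 * quot t s * heat t s)"

lemma X_continuous: "continuous_on {0..L} X"
  using X_deriv by (intro DERIV_continuous_on) auto

lemma X_deriv_at: "0 < x \<Longrightarrow> x < L \<Longrightarrow> (X has_real_derivative X' x) (at x)"
  using X_deriv[of x] by (simp add: at_within_Icc_at)

text \<open>The difference of two difference quotients is handled by the mean value theorem for
  \<open>\<lambda>y. X (s + (t - s) y) / (t - s) - X (s' + (t' - s') y) / (t' - s')\<close>.\<close>

lemma quot_holder: "holder_on (1/2) (tri L) (case_prod quot)"
proof -
  obtain C where C: "C \<ge> 0" "\<And>x y. x \<in> {0..L} \<Longrightarrow> y \<in> {0..L} \<Longrightarrow> \<bar>X' x - X' y\<bar> \<le> C * sqrt (dist x y)"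
    using holder_halfD[OF X'_holder] by blast
  show ?thesis
  proof (rule holder_halfI[where C=C])
    fix p q assume pq: "p \<in> tri L" "q \<in> tri L"
    obtain t s t' s' where e: "p = (t, s)" "q = (t', s')" by (cases p, cases q)
    have ts: "0 \<le> s" "s < t" "t < L" "0 \<le> s'" "s' < t'" "t' < L" using pq e by auto
    have mem: "s \<le> s + (t - s) * y \<and> s + (t - s) * y \<le> t" if "s < t" "0 \<le> y" "y \<le> 1" for s t y :: real
    proof -
      have "(t - s) * y \<le> (t - s) * 1" using that by (intro mult_left_mono) auto
      moreover have "0 \<le> (t - s) * y" using that by simp
      ultimately show ?thesis unfolding mult_1_right by linarith
    qed
    have mem': "s < s + (t - s) * y \<and> s + (t - s) * y < t" if "s < t" "0 < y" "y < 1" for s t y :: real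
    proof -
      have "(t - s) * y < (t - s) * 1" using that by (intro mult_strict_left_mono) auto
      moreover have "0 < (t - s) * y" using that by simp
      ultimately show ?thesis unfolding mult_1_right by linarith
    qed
    have cont: "continuous_on {0..1} (\<lambda>y. X (s + (t - s) * y) / (t - s))" if "0 \<le> s" "s < t" "t < L" for s t
    proof (intro continuous_intros continuous_on_compose2[OF X_continuous])
      show "(\<lambda>y. s + (t - s) * y) ` {0..1} \<subseteq> {0..L}" using mem[OF that(2)] that by fastforce
    qed (use that in auto)
    have der: "((\<lambda>y. X (s + (t - s) * y) / (t - s)) has_real_derivative X' (s + (t - s) * y)) (at y)"
      if "0 \<le> s" "s < t" "t < L" "0 < y" "y < 1" for s t y
    proof -
      have "0 < s + (t - s) * y" "s + (t - s) * y < L"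
        using mem'[OF that(2,4,5)] that by linarith+
      then have "(X has_real_derivative X' (s + (t - s) * y)) (at (s + (t - s) * y))"
        by (rule X_deriv_at)
      then have "((\<lambda>y. X (s + (t - s) * y)) has_real_derivative X' (s + (t - s) * y) * (t - s)) (at y)"
        by (rule DERIV_chain'[where g=X, rotated]) (auto intro!: derivative_eq_intros)
      from DERIV_cdivide[OF this, of "t - s"] show ?thesis using that by simp
    qed
    let ?\<phi> = "\<lambda>y. X (s + (t - s) * y) / (t - s) - X (s' + (t' - s') * y) / (t' - s')"
    \<comment> \<open>Applied to the difference, the theorem yields one z for both quotients. The
      two arguments of X' are then convex combinations with equal weights, hence at most
      \<open>dist p q\<close> apart; two separate intermediate points would give no such
      control.\<close>
    have "\<exists>l z. 0 < z \<and> z < 1 \<and> (?\<phi> has_real_derivative l) (at z) \<and> ?\<phi> 1 - ?\<phi> 0 = (1 - 0) * l"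
    proof (rule MVT)
      show "continuous_on {0..1} ?\<phi>" by (intro continuous_on_diff cont ts)
      fix y :: real assume "0 < y" "y < 1"
      then show "?\<phi> differentiable at y"
        using DERIV_diff[OF der[OF ts(1-3)] der[OF ts(4-6)]]
          unfolding real_differentiable_def by blast
    qed simp
    then obtain l z where z: "0 < z" "z < 1" "(?\<phi> has_real_derivative l) (at z)" "?\<phi> 1 - ?\<phi> 0 = (1 - 0) * l" by blast
    have l: "l = X' (s + (t - s) * z) - X' (s' + (t' - s') * z)"
      using DERIV_unique[OF z(3) DERIV_diff[OF der[OF ts(1-3) z(1,2)] der[OF ts(4-6) z(1,2)]]] .
    have d: "\<bar>t - t'\<bar> \<le> dist p q" "\<bar>s - s'\<bar> \<le> dist p q"
      unfolding e using dist_fst_le[of "(t,s)" "(t',s')"] dist_snd_le[of "(t,s)" "(t',s')"] by (auto simp: dist_real_def)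
    have "s + (t - s) * z - (s' + (t' - s') * z) = (1 - z) * (s - s') + z * (t - t')" by (simp add: algebra_simps)
    also have "\<bar>\<dots>\<bar> \<le> (1 - z) * \<bar>s - s'\<bar> + z * \<bar>t - t'\<bar>"
      using z by (intro order_trans[OF abs_triangle_ineq]) (auto simp: abs_mult)
    also have "\<dots> \<le> (1 - z) * dist p q + z * dist p q"
      using z d by (intro add_mono mult_left_mono) auto
    finally have dz: "dist (s + (t - s) * z) (s' + (t' - s') * z) \<le> dist p q"
      by (simp add: algebra_simps dist_real_def)
    have "quot t s - quot t' s' = l"
      using z(4) by (simp add: quot_def diff_divide_distrib)
    also have "\<bar>\<dots>\<bar> \<le> C * sqrt (dist (s + (t - s) * z) (s' + (t' - s') * z))"
      unfolding l using mem'[OF ts(2) z(1,2)] mem'[OF ts(5) z(1,2)] ts by (intro C) auto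
    also have "\<dots> \<le> C * sqrt (dist p q)" using C(1) dz by (intro mult_left_mono) auto
    finally show "\<bar>case_prod quot p - case_prod quot q\<bar> \<le> C * sqrt (dist p q)" by (simp add: e)
  qed
qed

text \<open>The exponent equals - (t - s) \<open>quot\<close>^2 / 4, in which the division by t - s
  is gone, and exp (- x) is 1-Lipschitz for x \<ge> 0.\<close>

lemma heat_holder: "holder_on (1/2) (tri L) (case_prod heat)"
proof -
  have d: "holder_on (1/2) (tri L) (\<lambda>p. fst p - snd p)"
  proof (rule holder_half_bounded_Lipschitz[OF _ bounded_tri])
    fix p q :: "real \<times> real"
    show "\<bar>fst p - snd p - (fst q - snd q)\<bar> \<le> 2 * dist p q"
      using dist_fst_le[of p q] dist_snd_le[of p q] by (auto simp: dist_real_def)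
  qed
  have "holder_on (1/2) (tri L) (\<lambda>p. 1 / 4 * ((fst p - snd p) * (case_prod quot p * case_prod quot p)))"
    by (intro holder_half_cmult holder_half_mult d quot_holder bounded_tri)
  then have "holder_on (1/2) (tri L) (\<lambda>p. exp (- (1 / 4 * ((fst p - snd p) * (case_prod quot p * case_prod quot p)))))"
  proof (rule Lipschitz_holder_half_comp)
    fix x y assume "x \<in> (\<lambda>p. 1 / 4 * ((fst p - snd p) * (case_prod quot p * case_prod quot p))) ` tri L"
      "y \<in> (\<lambda>p. 1 / 4 * ((fst p - snd p) * (case_prod quot p * case_prod quot p))) ` tri L"
    then have xy: "x \<ge> 0" "y \<ge> 0" by (auto simp: tri_def)
    have *: "\<bar>exp (- x) - exp (- y)\<bar> \<le> y - x" if "0 \<le> x" "x \<le> y" for x y :: real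
    proof -
      have "1 - exp (- (y - x)) \<le> y - x" using exp_ge_add_one_self[of "- (y - x)"] by linarith
      moreover have "exp (- x) - exp (- y) = exp (- x) * (1 - exp (- (y - x)))"
        by (simp add: right_diff_distrib flip: exp_add)
      moreover have "exp (- x) * (1 - exp (- (y - x))) \<le> 1 * (1 - exp (- (y - x)))"
        using that by (intro mult_right_mono) auto
      ultimately show ?thesis using that by simp
    qed
    show "\<bar>exp (- x) - exp (- y)\<bar> \<le> 1 * \<bar>x - y\<bar>"
      using *[of x y] *[of y x] xy by (cases "x \<le> y") (auto simp: abs_minus_commute)
  qed simp
  then show ?thesis
  proof (rule holder_half_cong)
    fix p assume "p \<in> tri L"
    then show "exp (- (1 / 4 * ((fst p - snd p) * (case_prod quot p * case_prod quot p)))) = case_prod heat p"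
      by (auto simp: tri_def heat_def quot_def power2_eq_square)
  qed
qed

lemma amp_holder: "holder_on (1/2) (tri L) (case_prod amp)"
proof -
  have "holder_on (1/2) (tri L) (\<lambda>p. 1 / pi * (sqrt pi / 2 * (case_prod quot p * case_prod heat p)))"
    by (intro holder_half_cmult holder_half_mult quot_holder heat_holder bounded_tri)
  then show ?thesis
    by (rule holder_half_cong) (auto simp: amp_def)
qed

sublocale volterra_kernel L X amp
proof
  show "H1ker X L t s = (if 0 < s then sing L amp t s else 0)" for t s
    by (auto simp: H1ker_def Kker_def sing_def amp_def quot_def heat_def)
qed (rule L_pos amp_holder)+

text \<open>The first term of N, without the factor \<open>sqrt pi\<close>, in the Gaussian variable
  y. The indicator confines the datum to the half-line on which it is given.\<close>

definition initial :: "(real \<Rightarrow> real) \<Rightarrow> real \<Rightarrow> real" where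
  "initial v \<tau> = 2 * (\<integral>y. exp (- y\<^sup>2) * (indicator {0<..} (X \<tau> + 2 * sqrt \<tau> * y) * v (X \<tau> + 2 * sqrt \<tau> * y)) \<partial>lborel)"

section \<open>Hoelder continuity of the initial contribution\<close>

context
  fixes v :: "real \<Rightarrow> real" and C V :: real
  assumes v_meas [measurable]: "(\<lambda>x. indicator {0<..} x * v x) \<in> borel_measurable borel"
    and v_Lipschitz: "\<And>x y. x > 0 \<Longrightarrow> y > 0 \<Longrightarrow> \<bar>v x - v y\<bar> \<le> C * \<bar>x - y\<bar>"
    and v_bounded: "\<And>x. x > 0 \<Longrightarrow> \<bar>v x\<bar> \<le> V"
begin

lemma CV_nonneg: "C \<ge> 0" "V \<ge> 0"
  using v_Lipschitz[of 1 2] v_bounded[of 1] by auto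

lemma integrable_gaussian_v:
  "integrable lborel (\<lambda>y. exp (- y\<^sup>2) * (indicator {0<..} (c + d * y) * v (c + d * y)))"
proof (rule Bochner_Integration.integrable_bound)
  show "integrable lborel (\<lambda>y. exp (- y\<^sup>2) * V)"
    using gaussian_has_bochner_integral by (simp add: has_bochner_integral_iff)
  have "(\<lambda>y. exp (- y\<^sup>2) * ((\<lambda>x. indicator {0<..} x * v x) (c + d * y))) \<in> borel_measurable lborel"
    by measurable
  then show "(\<lambda>y. exp (- y\<^sup>2) * (indicator {0<..} (c + d * y) * v (c + d * y))) \<in> borel_measurable lborel"
    by simp
  show "AE y in lborel. norm (exp (- y\<^sup>2) * (indicator {0<..} (c + d * y) * v (c + d * y))) \<le> norm (exp (- y\<^sup>2) * V)"
    using v_bounded CV_nonneg by (auto simp: abs_mult indicator_def)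
qed

lemma initial_eq:
  assumes "\<tau> > 0"
  shows "1 / sqrt \<tau> * integral {0<..} (\<lambda>x. exp (- (X \<tau> - x)\<^sup>2 / (4 * \<tau>)) * v x) = initial v \<tau>"
proof -
  let ?f = "\<lambda>x. exp (- (X \<tau> - x)\<^sup>2 / (4 * \<tau>)) * (indicator {0<..} x * v x)"
  have e: "(2 * sqrt \<tau> * y)\<^sup>2 / (4 * \<tau>) = y\<^sup>2" for y
    using assms by (simp add: power_mult_distrib)
  have "integrable lborel (\<lambda>y. ?f (X \<tau> + (2 * sqrt \<tau>) * y))"
    using integrable_gaussian_v[of "X \<tau>" "2 * sqrt \<tau>"] e by simp
  then have "integrable lborel ?f"
    using assms by (subst (asm) lborel_integrable_real_affine_iff) auto
  from integral_eq_lborel[OF this, of "{0<..}"]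
  have "integral {0<..} ?f = (\<integral>x. ?f x \<partial>lborel)" by simp
  moreover have "integral {0<..} ?f = integral {0<..} (\<lambda>x. exp (- (X \<tau> - x)\<^sup>2 / (4 * \<tau>)) * v x)"
    by (rule Henstock_Kurzweil_Integration.integral_cong) simp
  ultimately show ?thesis
    unfolding initial_def using integral_translate_scale[OF assms, of "X \<tau>" "\<lambda>x. indicator {0<..} x * v x"]
    by simp
qed

text \<open>As X 0 = 0, the function is X \<tau> / sqrt \<tau>. Minus one half of it is the Gaussian
  variable at which the argument of the datum crosses 0.\<close>

lemma boundary_ratio_holder: "holder_on (1/2) {0<..<L} (\<lambda>\<tau>. sqrt \<tau> * quot \<tau> 0)"
proof -
  have "holder_on (1/2) {0<..<L} (\<lambda>\<tau>. case_prod quot (\<tau>, 0))"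
    by (rule holder_half_Lipschitz_comp[OF quot_holder, where M=1]) (auto simp: dist_prod_def)
  moreover have "holder_on (1/2) {0<..<L} sqrt"
    by (rule holder_half_sqrt_comp[where M=1]) (auto simp: dist_real_def)
  ultimately show ?thesis
    using holder_half_mult[of "{0<..<L}" sqrt "\<lambda>\<tau>. quot \<tau> 0"] by simp
qed

text \<open>The datum extended by 0 is Lipschitz except for a jump at 0. Where both arguments lie on
  the same side, the Lipschitz bound and the Hoelder continuity of X and of the square root suffice.
  They lie on different sides only for u between the two crossing points, an interval of length
  O(sqrt |x - y|).\<close>

lemma initial_holder: "holder_on (1/2) {0<..<L} (initial v)"
proof -
  let ?w = "\<lambda>x. indicator {0<..} x * v x"
  \<comment> \<open>The solution u of X \<tau> + 2 sqrt \<tau> u = 0.\<close>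
  let ?c = "\<lambda>\<tau>. - (sqrt \<tau> * quot \<tau> 0) / 2"
  obtain D where D: "D \<ge> 0" "\<And>x y. x \<in> {0<..<L} \<Longrightarrow> y \<in> {0<..<L} \<Longrightarrow>
      \<bar>sqrt x * quot x 0 - sqrt y * quot y 0\<bar> \<le> D * sqrt (dist x y)"
    using holder_halfD[OF boundary_ratio_holder] by blast
  have "holder_on (1/2) {0<..<L} (\<lambda>\<tau>. \<tau> * quot \<tau> 0)"
  proof -
    have "holder_on (1/2) {0<..<L} (\<lambda>\<tau>. sqrt \<tau> * (sqrt \<tau> * quot \<tau> 0))"
      by (intro holder_half_mult boundary_ratio_holder holder_half_sqrt_comp[where M=1]) (auto simp: dist_real_def)
    then show ?thesis by (rule holder_half_cong) simp
  qed
  then obtain F where F: "F \<ge> 0" "\<And>x y. x \<in> {0<..<L} \<Longrightarrow> y \<in> {0<..<L} \<Longrightarrow>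
      \<bar>x * quot x 0 - y * quot y 0\<bar> \<le> F * sqrt (dist x y)"
    using holder_halfD by blast
  show ?thesis
  \<comment> \<open>Here \<open>sqrt pi\<close> is the Gaussian mass, paired with the shift F of X;
    the 2 is twice the first absolute moment 1, paired with the change of 2 sqrt \<tau>; V (D / 2)
    pays for the jump.\<close>
  proof (rule holder_halfI[where C="2 * (C * (sqrt pi * F + 2) + V * (D / 2))"])
    fix x y assume xy: "x \<in> {0<..<L}" "y \<in> {0<..<L}"
    define d where "d = sqrt (dist x y)"
    define m where "m = min (?c x) (?c y)"
    define M where "M = max (?c x) (?c y)"
    let ?z = "\<lambda>\<tau> u. X \<tau> + 2 * sqrt \<tau> * u"
    have X: "X \<tau> = \<tau> * quot \<tau> 0" if "\<tau> > 0" for \<tau> using that by (simp add: quot_def X_0)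
    have dX: "\<bar>X x - X y\<bar> \<le> F * d" using F(2)[OF xy] xy by (simp add: X d_def)
    have ds: "\<bar>sqrt x - sqrt y\<bar> \<le> d" using sqrt_diff_le[of x y] xy by (simp add: d_def dist_real_def)
    have mM: "M - m \<le> D / 2 * d" "m \<le> M" using D(2)[OF xy] unfolding m_def M_def d_def by auto
    have pos: "?z \<tau> u > 0 \<longleftrightarrow> u > ?c \<tau>" if "\<tau> > 0" for \<tau> u
    proof -
      have "?z \<tau> u = 2 * sqrt \<tau> * (u - ?c \<tau>)"
        using that by (simp add: X algebra_simps flip: power2_eq_square)
      then have "?z \<tau> u > 0 \<longleftrightarrow> u - ?c \<tau> > 0" using that by (simp add: zero_less_mult_iff)
      then show ?thesis by (simp only: diff_gt_0_iff_gt)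
    qed
    have diff: "\<bar>?w (?z x u) - ?w (?z y u)\<bar> \<le> C * (F * d + 2 * d * \<bar>u\<bar>) + V * indicator {m..M} u" for u
    proof -
      have "?z x u - ?z y u = (X x - X y) + 2 * (sqrt x - sqrt y) * u" by (simp add: algebra_simps)
      also have "\<bar>\<dots>\<bar> \<le> \<bar>X x - X y\<bar> + 2 * \<bar>sqrt x - sqrt y\<bar> * \<bar>u\<bar>"
        using abs_triangle_ineq[of "X x - X y" "2 * (sqrt x - sqrt y) * u"]
        by (simp only: abs_mult abs_numeral)
      also have "\<dots> \<le> F * d + 2 * d * \<bar>u\<bar>"
        by (intro add_mono dX mult_right_mono mult_left_mono ds) auto
      finally have zz: "\<bar>?z x u - ?z y u\<bar> \<le> F * d + 2 * d * \<bar>u\<bar>" .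
      then have nonneg: "0 \<le> C * (F * d + 2 * d * \<bar>u\<bar>)" using CV_nonneg by simp
      consider "?z x u > 0" "?z y u > 0" | "\<not> ?z x u > 0" "\<not> ?z y u > 0" | "(?z x u > 0) \<noteq> (?z y u > 0)" by blast
      then show ?thesis
      proof cases
        case 1
        then have "\<bar>?w (?z x u) - ?w (?z y u)\<bar> \<le> C * \<bar>?z x u - ?z y u\<bar>" using v_Lipschitz by simp
        also have "\<dots> \<le> C * (F * d + 2 * d * \<bar>u\<bar>)" using zz CV_nonneg by (intro mult_left_mono)
        also have "\<dots> \<le> \<dots> + V * indicator {m..M} u" using CV_nonneg by simp
        finally show ?thesis .
      next
        case 2
        then show ?thesis using nonneg CV_nonneg by simp
      next
        case 3
        then have "u \<in> {m..M}" using pos[of x u] pos[of y u] xy unfolding m_def M_def by auto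
        moreover have "\<bar>?w (?z x u) - ?w (?z y u)\<bar> \<le> V" using 3 v_bounded by auto
        ultimately show ?thesis using nonneg by simp
      qed
    qed
    have "initial v x - initial v y = 2 * (\<integral>u. exp (- u\<^sup>2) * ?w (?z x u) - exp (- u\<^sup>2) * ?w (?z y u) \<partial>lborel)"
      unfolding initial_def
      by (subst Bochner_Integration.integral_diff) (use integrable_gaussian_v in auto)
    also have "\<bar>\<dots>\<bar> \<le> 2 * (C * (sqrt pi * (F * d) + 1 * (2 * d)) + V * (M - m))"
      unfolding abs_mult abs_numeral
    proof (intro mult_left_mono integral_abs_le)
      have "has_bochner_integral lborel (\<lambda>u. indicator {m..M} u) (M - m)"
        using mM has_bochner_integral_real_indicator[of "{m..M}" lborel] by simp
      then show "has_bochner_integral lborel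
         (\<lambda>u. C * (exp (- u\<^sup>2) * (F * d) + exp (- u\<^sup>2) * \<bar>u\<bar> * (2 * d)) + V * indicator {m..M} u)
         (C * (sqrt pi * (F * d) + 1 * (2 * d)) + V * (M - m))"
        by (intro has_bochner_integral_add has_bochner_integral_mult_right has_bochner_integral_mult_left
            gaussian_has_bochner_integral gaussian_abs_has_bochner_integral)
      fix u
      have "exp (- u\<^sup>2) * ?w (?z x u) - exp (- u\<^sup>2) * ?w (?z y u) = exp (- u\<^sup>2) * (?w (?z x u) - ?w (?z y u))"
        by (simp add: right_diff_distrib)
      also have "\<bar>\<dots>\<bar> = exp (- u\<^sup>2) * \<bar>?w (?z x u) - ?w (?z y u)\<bar>" by (simp add: abs_mult)
      also have "\<dots> \<le> exp (- u\<^sup>2) * (C * (F * d + 2 * d * \<bar>u\<bar>) + V * indicator {m..M} u)"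
        by (intro mult_left_mono diff) simp
      also have "\<dots> = C * (exp (- u\<^sup>2) * (F * d) + exp (- u\<^sup>2) * \<bar>u\<bar> * (2 * d)) + exp (- u\<^sup>2) * (V * indicator {m..M} u)"
        by (simp add: algebra_simps)
      also have "\<dots> \<le> C * (exp (- u\<^sup>2) * (F * d) + exp (- u\<^sup>2) * \<bar>u\<bar> * (2 * d)) + 1 * (V * indicator {m..M} u)"
        using CV_nonneg by (intro add_left_mono mult_right_mono) auto
      finally show "\<bar>exp (- u\<^sup>2) * ?w (?z x u) - exp (- u\<^sup>2) * ?w (?z y u)\<bar>
        \<le> C * (exp (- u\<^sup>2) * (F * d) + exp (- u\<^sup>2) * \<bar>u\<bar> * (2 * d)) + V * indicator {m..M} u" by simp
    qed simp
    also have "\<dots> \<le> 2 * (C * (sqrt pi * (F * d) + 1 * (2 * d)) + V * (D / 2 * d))"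
      using CV_nonneg mM by (intro mult_left_mono add_left_mono) auto
    finally show "\<bar>initial v x - initial v y\<bar> \<le> 2 * (C * (sqrt pi * F + 2) + V * (D / 2)) * sqrt (dist x y)"
      unfolding d_def by (simp add: algebra_simps)
  qed
qed

end

end

section \<open>The flux formula\<close>

lemma has_bochner_integral_reflect:
  fixes f :: "real \<Rightarrow> real"
  assumes "has_bochner_integral lborel f I"
  shows "has_bochner_integral lborel (\<lambda>z. f (s - z)) I"
proof -
  have "has_bochner_integral lborel (\<lambda>z. f (s + (-1) * z)) (I /\<^sub>R \<bar>-1\<bar>)"
    using assms by (subst lborel_has_bochner_integral_real_affine_iff[symmetric]) auto
  then show ?thesis by simp
qed

context moving_boundary
begin

text \<open>The amplitude, relative to \<open>1 / sqrt (t - s)\<close>, of the kernel that acts on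
  the boundary datum once the resolvent has been moved onto the heat kernel.\<close>

definition flux_kernel :: "real \<Rightarrow> real \<Rightarrow> real" where
  "flux_kernel t s = heat t s + sqrt (t - s) * (conv resolvent (sing L heat) t s / pi)"

lemma flux_kernel_holder: "holder_on (1/2) (tri L) (case_prod flux_kernel)"
proof -
  have "holder_on (1/2) (tri L) (\<lambda>p. sqrt (fst p - snd p))"
  proof (rule holder_half_sqrt_comp)
    fix p q :: "real \<times> real"
    show "\<bar>fst p - snd p - (fst q - snd q)\<bar> \<le> 2 * dist p q"
      using dist_fst_le[of p q] dist_snd_le[of p q] by (auto simp: dist_real_def)
  qed (auto simp: tri_def)
  then have "holder_on (1/2) (tri L) (\<lambda>p. case_prod heat p + sqrt (fst p - snd p) * (1 / pi * case_prod (conv resolvent (sing L heat)) p))"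
    by (intro holder_half_add holder_half_mult holder_half_cmult heat_holder holder_conv_resolvent bounded_tri)
  then show ?thesis by (rule holder_half_cong) (auto simp: flux_kernel_def)
qed

lemma conv_resolvent_support: "(t, s) \<notin> tri L \<Longrightarrow> conv resolvent (sing L b) t s = 0"
proof -
  assume ts: "(t, s) \<notin> tri L"
  have 0: "resolvent t z * sing L b z s = 0" for z
  proof (cases "(t, z) \<in> tri L \<and> (z, s) \<in> tri L")
    case True
    then have "(t, s) \<in> tri L" by auto
    with ts show ?thesis by blast
  next
    case False
    then show ?thesis using resolvent_support[of t z] unfolding sing_def by auto
  qed
  show ?thesis unfolding conv_def 0 by simp
qed

text \<open>A function of the time difference alone dominates both the heat kernel and, up to a
  constant, the resolvent. Its mass is the same in either variable and at every time, as the Fubini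
  argument requires.\<close>

definition majorant :: "real \<Rightarrow> real" where
  "majorant y = indicator {0<..<L} y / sqrt y"

lemma majorant_nonneg: "majorant y \<ge> 0"
  by (auto simp: majorant_def indicator_def)

lemma has_bochner_integral_majorant: "has_bochner_integral lborel majorant (2 * sqrt L)"
  using has_bochner_integral_inverse_sqrt[of 0 0 L] L_pos by (simp add: majorant_def[abs_def])

lemma sing_heat_bound: "\<bar>sing L heat t s\<bar> \<le> majorant (t - s)"
proof (cases "(t, s) \<in> tri L")
  case True
  then have "heat t s \<le> 1" "heat t s > 0" by (auto simp: heat_def)
  then have "\<bar>sing L heat t s\<bar> \<le> 1 / sqrt (t - s)" using True by (simp add: sing_def divide_right_mono)
  then show ?thesis using True by (simp add: majorant_def)
next
  case False
  then show ?thesis unfolding sing_def by (simp only: if_False abs_zero majorant_nonneg)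
qed

lemma resolvent_majorant: "\<exists>M\<ge>0. \<forall>t s. \<bar>resolvent t s\<bar> \<le> M * majorant (t - s)"
proof -
  obtain M where M: "M \<ge> 0" "\<And>t s. (t, s) \<in> tri L \<Longrightarrow> \<bar>resolvent t s\<bar> \<le> M / sqrt (t - s)"
    using resolvent_bound by blast
  have "\<bar>resolvent t s\<bar> \<le> M * majorant (t - s)" for t s
  proof (cases "(t, s) \<in> tri L")
    case True
    then show ?thesis using M(2)[OF True] by (simp add: majorant_def)
  next
    case False
    then show ?thesis using resolvent_support[OF False] M(1) majorant_nonneg by simp
  qed
  with M(1) show ?thesis by blast
qed

definition abel :: "(real \<Rightarrow> real) \<Rightarrow> real \<Rightarrow> real" where
  "abel g s = (\<integral>r. sing L heat s r * g r \<partial>lborel)"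

text \<open>The factor \<open>sqrt (z - s)\<close> cancels the singular factor in \<open>sing\<close>, so that the
  convolution at \<open>s = 0\<close> is the integral of the resolvent against the initial contribution.\<close>

definition initial_flux :: "(real \<Rightarrow> real) \<Rightarrow> real \<Rightarrow> real" where
  "initial_flux v \<tau> = (initial v \<tau>
     + conv resolvent (sing L (\<lambda>z s. sqrt (z - s) * initial v z)) \<tau> 0 / pi) / sqrt pi"

section \<open>Interchange of the resolvent with the boundary integral\<close>

context
  fixes g :: "real \<Rightarrow> real" and B :: real
  assumes g_meas [measurable]: "g \<in> borel_measurable borel"
    and g_bound: "\<And>x. \<bar>g x\<bar> \<le> B"
begin

lemma B_nonneg: "B \<ge> 0" using g_bound[of 0] by linarith

lemma heat_g_le: "\<bar>sing L heat s r * g r\<bar> \<le> B * majorant (s - r)"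
  unfolding abs_mult mult.commute[of B]
  by (intro mult_mono sing_heat_bound g_bound) (auto simp: majorant_nonneg)

lemma has_bochner_integral_B_majorant:
  "has_bochner_integral lborel (\<lambda>r. B * majorant (s - r)) (B * (2 * sqrt L))"
  by (intro has_bochner_integral_mult_right has_bochner_integral_reflect has_bochner_integral_majorant)

lemma integrable_heat_g: "integrable lborel (\<lambda>r. sing L heat s r * g r)"
proof (rule Bochner_Integration.integrable_bound)
  note [measurable] = sing_measurable[OF heat_holder]
  show "(\<lambda>r. sing L heat s r * g r) \<in> borel_measurable lborel" by measurable
  show "integrable lborel (\<lambda>r. B * majorant (s - r))"
    using has_bochner_integral_B_majorant by (simp add: has_bochner_integral_iff)
  show "AE r in lborel. norm (sing L heat s r * g r) \<le> norm (B * majorant (s - r))"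
    using heat_g_le by (intro AE_I2) (simp add: B_nonneg majorant_nonneg)
qed

text \<open>The inner absolute integral is at most B (2 sqrt L) uniformly in s, and the resolvent
  factor has the integrable majorant M \<open>majorant (t - s)\<close>.\<close>

lemma integrable_resolvent_heat_g:
  "integrable (lborel \<Otimes>\<^sub>M lborel) (\<lambda>(s, r). resolvent t s * (sing L heat s r * g r))"
proof (rule lborel_pair.Fubini_integrable)
  note [measurable] = sing_measurable[OF heat_holder] resolvent_measurable
  show "(\<lambda>(s, r). resolvent t s * (sing L heat s r * g r)) \<in> borel_measurable (lborel \<Otimes>\<^sub>M lborel)"
    by measurable
  obtain M where M: "M \<ge> 0" "\<And>t s. \<bar>resolvent t s\<bar> \<le> M * majorant (t - s)"
    using resolvent_majorant by blast
  show "integrable lborel (\<lambda>s. \<integral>r. norm (case (s, r) of (s, r) \<Rightarrow> resolvent t s * (sing L heat s r * g r)) \<partial>lborel)"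
  proof (rule Bochner_Integration.integrable_bound)
    show "integrable lborel (\<lambda>s. M * (B * (2 * sqrt L)) * majorant (t - s))"
      using has_bochner_integral_reflect[OF has_bochner_integral_majorant]
      by (intro integrable_mult_right) (auto simp: has_bochner_integral_iff)
    show "(\<lambda>s. \<integral>r. norm (case (s, r) of (s, r) \<Rightarrow> resolvent t s * (sing L heat s r * g r)) \<partial>lborel) \<in> borel_measurable lborel"
      by measurable
    show "AE s in lborel. norm (\<integral>r. norm (case (s, r) of (s, r) \<Rightarrow> resolvent t s * (sing L heat s r * g r)) \<partial>lborel)
        \<le> norm (M * (B * (2 * sqrt L)) * majorant (t - s))"
    proof (rule AE_I2)
      fix s
      have "\<bar>\<integral>r. \<bar>sing L heat s r * g r\<bar> \<partial>lborel\<bar> \<le> B * (2 * sqrt L)"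
        using heat_g_le by (intro integral_abs_le[OF has_bochner_integral_B_majorant[of s]]) simp
      then have "\<bar>resolvent t s\<bar> * \<bar>\<integral>r. \<bar>sing L heat s r * g r\<bar> \<partial>lborel\<bar> \<le> M * majorant (t - s) * (B * (2 * sqrt L))"
        using M majorant_nonneg by (intro mult_mono) auto
      moreover have "(\<integral>r. norm (case (s, r) of (s, r) \<Rightarrow> resolvent t s * (sing L heat s r * g r)) \<partial>lborel)
          = \<bar>resolvent t s\<bar> * (\<integral>r. \<bar>sing L heat s r * g r\<bar> \<partial>lborel)"
        by (subst integral_mult_right_zero[symmetric]) (simp only: case_prod_conv real_norm_def abs_mult)
      ultimately show "norm (\<integral>r. norm (case (s, r) of (s, r) \<Rightarrow> resolvent t s * (sing L heat s r * g r)) \<partial>lborel)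
        \<le> norm (M * (B * (2 * sqrt L)) * majorant (t - s))"
        using M(1) B_nonneg L_pos majorant_nonneg by (simp add: abs_mult mult_ac)
    qed
  qed
  show "AE s in lborel. integrable lborel (\<lambda>r. case (s, r) of (s, r) \<Rightarrow> resolvent t s * (sing L heat s r * g r))"
    using integrable_heat_g by simp
qed

lemma integrable_resolvent_abel: "integrable lborel (\<lambda>s. resolvent t s * abel g s)"
  using lborel_pair.integrable_fst[OF integrable_resolvent_heat_g[of t]] by (simp add: abel_def)

lemma integrable_conv_g: "integrable lborel (\<lambda>r. conv resolvent (sing L heat) t r * g r)"
  using lborel_pair.integrable_snd[OF integrable_resolvent_heat_g[of t]]
  by (simp add: conv_def flip: mult.assoc)

lemma resolvent_abel:
  "(\<integral>s. resolvent t s * abel g s \<partial>lborel) = (\<integral>r. conv resolvent (sing L heat) t r * g r \<partial>lborel)"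
proof -
  have "(\<integral>s. resolvent t s * abel g s \<partial>lborel) = (\<integral>s. (\<integral>r. resolvent t s * (sing L heat s r * g r) \<partial>lborel) \<partial>lborel)"
    by (simp add: abel_def)
  also have "\<dots> = (\<integral>r. (\<integral>s. resolvent t s * (sing L heat s r * g r) \<partial>lborel) \<partial>lborel)"
    by (rule lborel_pair.Fubini_integral[OF integrable_resolvent_heat_g, symmetric])
  also have "\<dots> = (\<integral>r. conv resolvent (sing L heat) t r * g r \<partial>lborel)"
    by (simp add: conv_def flip: mult.assoc)
  finally show ?thesis .
qed

end

section \<open>Hoelder continuity of the initial flux, and the flux identity\<close>

lemma initial_kernel_holder:
  assumes "holder_on (1/2) {0<..<L} (initial v)"
  shows "holder_on (1/2) (tri L) (\<lambda>(z, s). sqrt (z - s) * initial v z)"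
proof -
  have "holder_on (1/2) (tri L) (\<lambda>p. sqrt (fst p - snd p))"
  proof (rule holder_half_sqrt_comp)
    fix p q :: "real \<times> real"
    show "\<bar>fst p - snd p - (fst q - snd q)\<bar> \<le> 2 * dist p q"
      using dist_fst_le[of p q] dist_snd_le[of p q] by (auto simp: dist_real_def)
  qed (auto simp: tri_def)
  moreover have "holder_on (1/2) (tri L) (\<lambda>p. initial v (fst p))"
    by (rule holder_half_Lipschitz_comp[OF assms, where M=1]) (auto simp: dist_fst_le tri_def)
  ultimately have "holder_on (1/2) (tri L) (\<lambda>p. sqrt (fst p - snd p) * initial v (fst p))"
    by (intro holder_half_mult bounded_tri)
  then show ?thesis by (rule holder_half_cong) auto
qed

lemma initial_flux_holder:
  assumes "holder_on (1/2) {0<..<L} (initial v)"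
  shows "holder_on (1/2) {0<..<L} (initial_flux v)"
proof -
  note c = holder_conv_resolvent[OF initial_kernel_holder[OF assms]]
  have "holder_on (1/2) {0<..<L} (\<lambda>\<tau>. case_prod (conv resolvent (sing L (\<lambda>z s. sqrt (z - s) * initial v z))) (\<tau>, 0))"
    by (rule holder_half_Lipschitz_comp[OF c, where M=1]) (auto simp: dist_prod_def)
  then have "holder_on (1/2) {0<..<L} (\<lambda>\<tau>. 1 / sqrt pi * (initial v \<tau> + 1 / pi * case_prod (conv resolvent (sing L (\<lambda>z s. sqrt (z - s) * initial v z))) (\<tau>, 0)))"
    by (intro holder_half_cmult holder_half_add assms)
  then show ?thesis by (rule holder_half_cong) (simp add: initial_flux_def)
qed

definition volterra_rhs :: "(real \<Rightarrow> real) \<Rightarrow> (real \<Rightarrow> real) \<Rightarrow> real \<Rightarrow> real" where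
  "volterra_rhs v g \<tau> = sqrt pi * (1 / sqrt \<tau> * integral {0<..} (\<lambda>x. exp (- (X \<tau> - x)\<^sup>2 / (4 * \<tau>)) * v x)
     - integral {0..\<tau>} (\<lambda>s. exp (- (X \<tau> - X s)\<^sup>2 / (4 * (\<tau> - s))) / sqrt (\<tau> - s) * g s))"

text \<open>The left side is the resolvent solution of the Volterra equation for N = sqrt pi
  (\<open>initial\<close> - \<open>abel\<close>); \<open>resolvent_abel\<close> rearranges its
  second part. Integrability is part of the conclusion because the later changes of variables work
  with \<open>has_integral\<close>, whereas \<open>integral\<close> alone would allow the default
  value 0.\<close>

lemma flux_formula:
  assumes v_meas: "(\<lambda>x. indicator {0<..} x * v x) \<in> borel_measurable borel"
    and v_Lipschitz: "\<And>x y. x > 0 \<Longrightarrow> y > 0 \<Longrightarrow> \<bar>v x - v y\<bar> \<le> C * \<bar>x - y\<bar>"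
    and v_bounded: "\<And>x. x > 0 \<Longrightarrow> \<bar>v x\<bar> \<le> V"
    and g_meas: "(\<lambda>x. indicator {0<..<L} x * g x) \<in> borel_measurable borel"
    and g_bound: "\<And>x. x \<in> {0<..<L} \<Longrightarrow> \<bar>g x\<bar> \<le> B"
    and \<tau>: "0 < \<tau>" "\<tau> < L"
  shows "volterra_rhs v g \<tau> / pi + 1 / pi\<^sup>2 * integral {0..\<tau>} (\<lambda>s. (Kker X L s \<tau> + Gker X L \<tau> s) * volterra_rhs v g s)
     = initial_flux v \<tau> - 1 / sqrt pi * integral {0..\<tau>} (\<lambda>r. flux_kernel \<tau> r / sqrt (\<tau> - r) * g r)"
    and "(\<lambda>r. flux_kernel \<tau> r / sqrt (\<tau> - r) * g r) integrable_on {0..\<tau>}"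
proof -
  let ?g = "\<lambda>x. indicator {0<..<L} x * g x"
  let ?b = "\<lambda>z s. sqrt (z - s) * initial v z"
  have gb: "\<bar>?g x\<bar> \<le> \<bar>B\<bar>" for x
    using g_bound[of x] by (auto simp: indicator_def)
  have ih: "holder_on (1/2) {0<..<L} (initial v)"
    by (rule initial_holder[OF v_meas v_Lipschitz v_bounded])
  \<comment> \<open>Endpoint values are defaults that differ between the formulas: g is cut to an
    open interval and \<open>1 / sqrt 0\<close> is 0. Only interior points are compared.\<close>
  have open_cong: "integral {0..\<sigma>} f = integral {0<..<\<sigma>} h" if "\<And>x. 0 < x \<Longrightarrow> x < \<sigma> \<Longrightarrow> f x = h x" for f h :: "real \<Rightarrow> real" and \<sigma>
    unfolding integral_open_interval_real by (rule Henstock_Kurzweil_Integration.integral_cong) (use that in auto)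
  have volterra_rhs: "volterra_rhs v g \<sigma> = sqrt pi * (initial v \<sigma> - abel ?g \<sigma>)" if \<sigma>: "0 < \<sigma>" "\<sigma> < L" for \<sigma>
  proof -
    have "integral {0..\<sigma>} (\<lambda>s. exp (- (X \<sigma> - X s)\<^sup>2 / (4 * (\<sigma> - s))) / sqrt (\<sigma> - s) * g s)
      = integral {0<..<\<sigma>} (\<lambda>s. sing L heat \<sigma> s * ?g s)"
      by (rule open_cong) (use \<sigma> in \<open>auto simp: sing_def heat_def\<close>)
    also have "\<dots> = abel ?g \<sigma>"
      unfolding abel_def
      by (rule integral_eq_lborel[OF integrable_heat_g[OF g_meas gb]]) (auto simp: sing_def indicator_def)
    finally have A: "integral {0..\<sigma>} (\<lambda>s. exp (- (X \<sigma> - X s)\<^sup>2 / (4 * (\<sigma> - s))) / sqrt (\<sigma> - s) * g s) = abel ?g \<sigma>" .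
    have "1 / sqrt \<sigma> * integral {0<..} (\<lambda>x. exp (- (X \<sigma> - x)\<^sup>2 / (4 * \<sigma>)) * v x) = initial v \<sigma>"
      by (rule initial_eq[OF v_meas v_Lipschitz v_bounded \<sigma>(1)])
    then show ?thesis unfolding volterra_rhs_def A by simp
  qed
  have i1: "integrable lborel (\<lambda>s. resolvent \<tau> s * sing L ?b s 0)"
    by (rule integrable_resolvent_sing[OF initial_kernel_holder[OF ih]]) (use \<tau> in auto)
  note i2 = integrable_resolvent_abel[OF g_meas gb, of \<tau>]
  have "sing L heat 0 r = 0" for r by (auto simp: sing_def)
  then have abel0: "abel ?g 0 = 0" by (simp add: abel_def)
  have "integral {0..\<tau>} (\<lambda>s. (Kker X L s \<tau> + Gker X L \<tau> s) * volterra_rhs v g s)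
    = integral {0<..<\<tau>} (\<lambda>s. sqrt pi * (resolvent \<tau> s * sing L ?b s 0 - resolvent \<tau> s * abel ?g s))"
    by (rule open_cong) (use \<tau> in \<open>auto simp: volterra_rhs sing_def resolvent_def algebra_simps\<close>)
  also have "\<dots> = (\<integral>s. sqrt pi * (resolvent \<tau> s * sing L ?b s 0 - resolvent \<tau> s * abel ?g s) \<partial>lborel)"
  proof (rule integral_eq_lborel)
    fix s assume "s \<notin> {0<..<\<tau>}"
    \<comment> \<open>The point s = 0 needs its own case: (\<tau>, 0) lies in the triangle, so the
      support of the resolvent does not help and the factors after it have to vanish.\<close>
    then consider "s = 0" | "(\<tau>, s) \<notin> tri L" by force
    then show "sqrt pi * (resolvent \<tau> s * sing L ?b s 0 - resolvent \<tau> s * abel ?g s) = 0"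
    proof cases
      case 1
      then show ?thesis using abel0 by (simp add: sing_def)
    qed (simp add: resolvent_support del: tri_iff)
  qed (intro integrable_mult_right Bochner_Integration.integrable_diff i1 i2)
  also have "\<dots> = sqrt pi * (conv resolvent (sing L ?b) \<tau> 0 - (\<integral>r. conv resolvent (sing L heat) \<tau> r * ?g r \<partial>lborel))"
    by (simp add: Bochner_Integration.integral_diff[OF i1 i2] resolvent_abel[OF g_meas gb] conv_def)
  finally have I: "integral {0..\<tau>} (\<lambda>s. (Kker X L s \<tau> + Gker X L \<tau> s) * volterra_rhs v g s)
    = sqrt pi * (conv resolvent (sing L ?b) \<tau> 0 - (\<integral>r. conv resolvent (sing L heat) \<tau> r * ?g r \<partial>lborel))" .
  note i3 = integrable_heat_g[OF g_meas gb, of \<tau>] and i4 = integrable_conv_g[OF g_meas gb, of \<tau>]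
  let ?F = "\<lambda>r. sing L heat \<tau> r * ?g r + conv resolvent (sing L heat) \<tau> r * ?g r / pi"
  have F_eq: "flux_kernel \<tau> r / sqrt (\<tau> - r) * g r = ?F r" if "0 < r" "r < \<tau>" for r
    using that \<tau> by (simp add: flux_kernel_def sing_def field_simps)
  have F0: "?F r = 0" if "r \<notin> {0<..<\<tau>}" for r
  proof (cases "0 < r")
    case True
    then have r: "(\<tau>, r) \<notin> tri L" using that by auto
    then have "sing L heat \<tau> r = 0" unfolding sing_def by (rule if_not_P)
    then show ?thesis using conv_resolvent_support[OF r, of heat] by simp
  qed simp
  have F_int: "integrable lborel ?F" by (intro Bochner_Integration.integrable_add i3 integrable_divide i4)
  have "integral {0..\<tau>} (\<lambda>r. flux_kernel \<tau> r / sqrt (\<tau> - r) * g r) = integral {0<..<\<tau>} ?F"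
    by (rule open_cong) (rule F_eq)
  also have "\<dots> = (\<integral>r. ?F r \<partial>lborel)" by (rule integral_eq_lborel[OF F_int F0])
  also have "\<dots> = abel ?g \<tau> + (\<integral>r. conv resolvent (sing L heat) \<tau> r * ?g r \<partial>lborel) / pi"
    by (subst Bochner_Integration.integral_add) (use i3 i4 in \<open>auto simp: abel_def\<close>)
  finally have F: "integral {0..\<tau>} (\<lambda>r. flux_kernel \<tau> r / sqrt (\<tau> - r) * g r)
     = abel ?g \<tau> + (\<integral>r. conv resolvent (sing L heat) \<tau> r * ?g r \<partial>lborel) / pi" .
  have pi2: "pi = sqrt pi * sqrt pi" by simp
  show "volterra_rhs v g \<tau> / pi + 1 / pi\<^sup>2 * integral {0..\<tau>} (\<lambda>s. (Kker X L s \<tau> + Gker X L \<tau> s) * volterra_rhs v g s)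
     = initial_flux v \<tau> - 1 / sqrt pi * integral {0..\<tau>} (\<lambda>r. flux_kernel \<tau> r / sqrt (\<tau> - r) * g r)"
    unfolding I F initial_flux_def volterra_rhs[OF \<tau>]
    by (simp add: field_simps power2_eq_square)
  have F_if: "(\<lambda>r. if r \<in> {0<..<\<tau>} then ?F r else 0) = ?F"
    by (intro ext) (metis F0)
  have "?F integrable_on UNIV" by (rule integrable_on_lborel[OF F_int])
  then have "?F integrable_on {0<..<\<tau>}"
    by (subst (asm) F_if[symmetric]) (simp only: integrable_restrict_UNIV)
  then have "(\<lambda>r. flux_kernel \<tau> r / sqrt (\<tau> - r) * g r) integrable_on {0<..<\<tau>}"
    by (rule integrable_eq) (use F_eq in auto)
  then show "(\<lambda>r. flux_kernel \<tau> r / sqrt (\<tau> - r) * g r) integrable_on {0..\<tau>}"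
    by (simp add: integrable_on_Icc_iff_Ioo)
qed

end

section \<open>Changes of variables, bounds on the data, and the closed triangle\<close>

lemma integral_cong_Ioo:
  fixes f h :: "real \<Rightarrow> real"
  assumes "\<And>x. a < x \<Longrightarrow> x < b \<Longrightarrow> f x = h x"
  shows "integral {a..b} f = integral {a..b} h"
  unfolding integral_open_interval_real
  by (rule Henstock_Kurzweil_Integration.integral_cong) (use assms in auto)

lemma has_integral_scale:
  fixes f :: "real \<Rightarrow> real"
  assumes "(f has_integral i) {0..c * t}" "c > 0"
  shows "((\<lambda>s. f (c * s)) has_integral i / c) {0..t}"
proof -
  have "((\<lambda>x. f (c *\<^sub>R x + 0)) has_integral ((1 / \<bar>c\<bar> ^ DIM(real)) *\<^sub>R i)) ((\<lambda>x. (1 / c) *\<^sub>R x + - ((1 / c) *\<^sub>R 0)) ` cbox 0 (c * t))"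
    by (rule has_integral_affinity) (use assms in auto)
  moreover have "(\<lambda>x. x / c) ` {0..c * t} = {0..t}"
    using assms(2) image_divide_atLeastAtMost[of c 0 "c * t"] by simp
  ultimately show ?thesis using assms(2) by (simp add: image_def)
qed

lemma has_integral_reflect_scale:
  fixes f :: "real \<Rightarrow> real"
  assumes "(f has_integral i) {0..c * (T - t)}" "c > 0"
  shows "((\<lambda>s. f (c * (T - s))) has_integral i / c) {t..T}"
proof -
  have "((\<lambda>x. f (c * - x)) has_integral i / c) {- (T - t)..- 0}"
    using has_integral_scale[OF assms] by (subst has_integral_reflect_real) auto
  from has_integral_affinity[OF this[folded cbox_interval], of 1 "- T"]
  show ?thesis by (simp add: algebra_simps)
qed

text \<open>On a unit interval containing x the function |w| is at least |w x| - C, so integrating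
  over that interval bounds |w x|. The interval need not be centred at x, which allows points close
  to the end of a half-line.\<close>

lemma Lipschitz_integrable_bounded:
  fixes w :: "real \<Rightarrow> real"
  assumes w: "w absolutely_integrable_on S"
    and lip: "\<And>x y. x \<in> S \<Longrightarrow> y \<in> S \<Longrightarrow> \<bar>w x - w y\<bar> \<le> C * \<bar>x - y\<bar>" and "C \<ge> 0"
    and a: "{a..a + 1} \<subseteq> S" "x \<in> {a..a + 1}"
  shows "\<bar>w x\<bar> \<le> integral S (\<lambda>y. \<bar>w y\<bar>) + C"
proof -
  have i: "(\<lambda>y. \<bar>w y\<bar>) integrable_on S"
    using w unfolding absolutely_integrable_on_def by simp
  have "w absolutely_integrable_on {a..a + 1}"
    by (rule absolutely_integrable_on_subinterval[OF w a(1)])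
  then have j: "(\<lambda>y. \<bar>w y\<bar>) integrable_on {a..a + 1}"
    unfolding absolutely_integrable_on_def by simp
  have "\<bar>w x\<bar> - C = integral {a..a + 1} (\<lambda>y. \<bar>w x\<bar> - C)" by simp
  also have "\<dots> \<le> integral {a..a + 1} (\<lambda>y. \<bar>w y\<bar>)"
  proof (rule integral_le[OF _ j])
    fix y assume y: "y \<in> {a..a + 1}"
    have "\<bar>w x - w y\<bar> \<le> C * \<bar>x - y\<bar>" using a y by (intro lip) auto
    also have "\<dots> \<le> C * 1" using a(2) y assms(3) by (intro mult_left_mono) auto
    finally show "\<bar>w x\<bar> - C \<le> \<bar>w y\<bar>" by linarith
  qed (rule integrable_const_ivl)
  also have "\<dots> \<le> integral S (\<lambda>y. \<bar>w y\<bar>)" by (rule integral_subset_le[OF a(1) j i]) simp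
  finally show ?thesis by simp
qed

lemma C2_open_deriv_Lipschitz:
  assumes u: "C2_open S u" and S: "convex S" and bd: "bounded (deriv (deriv u) ` S)"
  shows "\<exists>C\<ge>0. \<forall>x\<in>S. \<forall>y\<in>S. \<bar>deriv u x - deriv u y\<bar> \<le> C * \<bar>x - y\<bar>"
proof -
  obtain C where C: "\<And>x. x \<in> S \<Longrightarrow> \<bar>deriv (deriv u) x\<bar> \<le> C"
    using bd unfolding bounded_iff by auto
  have "\<bar>deriv u x - deriv u y\<bar> \<le> \<bar>C\<bar> * \<bar>x - y\<bar>" if "x \<in> S" "y \<in> S" for x y
  proof -
    have "norm (deriv u x - deriv u y) \<le> \<bar>C\<bar> * norm (x - y)"
    proof (rule field_differentiable_bound[OF S _ _ that])
      fix z assume z: "z \<in> S"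
      then show "norm (deriv (deriv u) z) \<le> \<bar>C\<bar>" using C[OF z] by simp
      have "deriv u differentiable at z" using u z unfolding C2_open_def by blast
      then show "(deriv u has_field_derivative deriv (deriv u) z) (at z within S)"
        by (metis DERIV_deriv_iff_real_differentiable has_field_derivative_at_within)
    qed
    then show ?thesis by simp
  qed
  then show ?thesis by (intro exI[of _ "\<bar>C\<bar>"]) auto
qed

text \<open>Every point is moved slightly towards (2 T / 3, T / 3), where each of s, t - s and T - t
  equals T / 3; the strict inequalities then hold by convexity.\<close>

lemma closed_triangle_subset_closure:
  assumes "T > 0"
  shows "{(t, s). 0 \<le> s \<and> s \<le> t \<and> t \<le> T} \<subseteq> closure (tri T)"
proof
  fix p assume "p \<in> {(t, s). 0 \<le> s \<and> s \<le> t \<and> t \<le> T}"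
  then obtain t s where p: "p = (t, s)" "0 \<le> s" "s \<le> t" "t \<le> T" by auto
  define e where "e = (\<lambda>n. 1 / (real n + 2))"
  let ?X = "\<lambda>n. ((1 - e n) * t + e n * (2 * T / 3), (1 - e n) * s + e n * (T / 3))"
  have e: "0 < e n" "e n < 1" for n by (auto simp: e_def)
  have "(\<lambda>n. e n) \<longlonglongrightarrow> 0"
    unfolding e_def using LIMSEQ_ignore_initial_segment[OF lim_1_over_n[where 'a=real], of 2] by (simp add: add.commute)
  then have "?X \<longlonglongrightarrow> ((1 - 0) * t + 0 * (2 * T / 3), (1 - 0) * s + 0 * (T / 3))"
    by (intro tendsto_intros)
  moreover have "?X n \<in> tri T" for n
  proof -
    have "0 < e n * (T / 3)" using e assms by simp
    moreover have "0 \<le> (1 - e n) * s" "(1 - e n) * s \<le> (1 - e n) * t" "(1 - e n) * t \<le> (1 - e n) * T"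
      using p e[of n] by (auto intro!: mult_left_mono)
    moreover have "(1 - e n) * T = T - e n * T" by (simp add: algebra_simps)
    moreover have "e n * (2 * T / 3) = 2 * (e n * (T / 3))" "e n * T = 3 * (e n * (T / 3))" by simp_all
    ultimately show ?thesis unfolding tri_iff by linarith
  qed
  ultimately show "p \<in> closure (tri T)"
    unfolding closure_sequential p by (intro exI[of _ ?X]) simp
qed

section \<open>Reduction to the Abel equation\<close>

text \<open>The requirements on a datum slope for \<open>initial_holder\<close>, with the values at
  x \<le> 0 cut away since derivatives there are arbitrary.\<close>

definition admissible :: "(real \<Rightarrow> real) \<Rightarrow> real \<Rightarrow> real \<Rightarrow> bool" where
  "admissible v C V \<longleftrightarrow> (\<lambda>x. indicator {0<..} x * v x) \<in> borel_measurable borel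
     \<and> (\<forall>x>0. \<forall>y>0. \<bar>v x - v y\<bar> \<le> C * \<bar>x - y\<bar>) \<and> (\<forall>x>0. \<bar>v x\<bar> \<le> V)"

locale free_boundary_data =
  fixes T \<gamma>0 \<gamma>2 \<delta>0 \<delta>2 :: real and \<xi> \<xi>' :: "real \<Rightarrow> real"
  assumes T_pos: "T > 0" and \<gamma>0_neg: "\<gamma>0 < 0" and \<gamma>2_pos: "0 < \<gamma>2"
    and \<xi>_0: "\<xi> 0 = 0"
    and \<xi>_deriv: "\<And>x. x \<in> {0..T} \<Longrightarrow> (\<xi> has_real_derivative \<xi>' x) (at x within {0..T})"
    and \<xi>'_holder: "holder_on (1/2) {0..T} \<xi>'"
begin

sublocale up: moving_boundary "\<gamma>2 * T" "xi_up \<xi> \<gamma>2" "\<lambda>\<tau>. \<xi>' (\<tau> / \<gamma>2) / \<gamma>2"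
proof
  have im: "\<tau> / \<gamma>2 \<in> {0..T}" if "\<tau> \<in> {0..\<gamma>2 * T}" for \<tau>
    using that \<gamma>2_pos by (auto simp: field_simps)
  show "\<gamma>2 * T > 0" using T_pos \<gamma>2_pos by simp
  show "xi_up \<xi> \<gamma>2 0 = 0" by (simp add: xi_up_def \<xi>_0)
  show "(xi_up \<xi> \<gamma>2 has_real_derivative \<xi>' (\<tau> / \<gamma>2) / \<gamma>2) (at \<tau> within {0..\<gamma>2 * T})"
    if \<tau>: "\<tau> \<in> {0..\<gamma>2 * T}" for \<tau>
  proof -
    have "(\<xi> has_real_derivative \<xi>' (\<tau> / \<gamma>2)) (at (\<tau> / \<gamma>2) within (\<lambda>\<tau>. \<tau> / \<gamma>2) ` {0..\<gamma>2 * T})"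
      using im by (intro has_field_derivative_subset[OF \<xi>_deriv[OF im[OF \<tau>]]]) blast
    moreover have "((\<lambda>\<tau>. \<tau> / \<gamma>2) has_real_derivative 1 / \<gamma>2) (at \<tau> within {0..\<gamma>2 * T})"
      using \<gamma>2_pos by (auto intro!: derivative_eq_intros)
    ultimately have "(\<xi> \<circ> (\<lambda>\<tau>. \<tau> / \<gamma>2) has_real_derivative \<xi>' (\<tau> / \<gamma>2) * (1 / \<gamma>2)) (at \<tau> within {0..\<gamma>2 * T})"
      by (rule DERIV_image_chain)
    then show ?thesis by (simp add: o_def xi_up_def[abs_def])
  qed
  have "holder_on (1/2) {0..\<gamma>2 * T} (\<lambda>\<tau>. 1 / \<gamma>2 * \<xi>' (\<tau> / \<gamma>2))"
  proof (intro holder_half_cmult holder_half_Lipschitz_comp[OF \<xi>'_holder, where M="1 / \<gamma>2"])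
    show "dist (x / \<gamma>2) (y / \<gamma>2) \<le> 1 / \<gamma>2 * dist x y" for x y
      using \<gamma>2_pos by (simp add: dist_real_def flip: diff_divide_distrib)
    show "(\<lambda>\<tau>. \<tau> / \<gamma>2) ` {0..\<gamma>2 * T} \<subseteq> {0..T}" using im by blast
  qed
  then show "holder_on (1/2) {0..\<gamma>2 * T} (\<lambda>\<tau>. \<xi>' (\<tau> / \<gamma>2) / \<gamma>2)" by simp
qed

text \<open>Reversing time and reflecting space each change the sign of the derivative, so the speed
  keeps the sign of \<xi>'.\<close>

sublocale lo: moving_boundary "\<bar>\<gamma>0\<bar> * T" "xi_lo \<xi> T \<gamma>0" "\<lambda>\<tau>. \<xi>' (T - \<tau> / \<bar>\<gamma>0\<bar>) / \<bar>\<gamma>0\<bar>"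
proof
  have im: "T - \<tau> / \<bar>\<gamma>0\<bar> \<in> {0..T}" if "\<tau> \<in> {0..\<bar>\<gamma>0\<bar> * T}" for \<tau>
  proof -
    have "\<tau> / \<bar>\<gamma>0\<bar> \<le> T" "0 \<le> \<tau> / \<bar>\<gamma>0\<bar>" using that \<gamma>0_neg by (auto simp: field_simps)
    then show ?thesis by simp
  qed
  show "\<bar>\<gamma>0\<bar> * T > 0" using T_pos \<gamma>0_neg by (intro mult_pos_pos) auto
  show "xi_lo \<xi> T \<gamma>0 0 = 0" by (simp add: xi_lo_def)
  show "(xi_lo \<xi> T \<gamma>0 has_real_derivative \<xi>' (T - \<tau> / \<bar>\<gamma>0\<bar>) / \<bar>\<gamma>0\<bar>) (at \<tau> within {0..\<bar>\<gamma>0\<bar> * T})"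
    if \<tau>: "\<tau> \<in> {0..\<bar>\<gamma>0\<bar> * T}" for \<tau>
  proof -
    have "(\<xi> has_real_derivative \<xi>' (T - \<tau> / \<bar>\<gamma>0\<bar>)) (at (T - \<tau> / \<bar>\<gamma>0\<bar>) within (\<lambda>\<tau>. T - \<tau> / \<bar>\<gamma>0\<bar>) ` {0..\<bar>\<gamma>0\<bar> * T})"
      using im by (intro has_field_derivative_subset[OF \<xi>_deriv[OF im[OF \<tau>]]]) blast
    moreover have "((\<lambda>\<tau>. T - \<tau> / \<bar>\<gamma>0\<bar>) has_real_derivative - (1 / \<bar>\<gamma>0\<bar>)) (at \<tau> within {0..\<bar>\<gamma>0\<bar> * T})"
      using \<gamma>0_neg by (auto intro!: derivative_eq_intros)
    ultimately have "(\<xi> \<circ> (\<lambda>\<tau>. T - \<tau> / \<bar>\<gamma>0\<bar>) has_real_derivative \<xi>' (T - \<tau> / \<bar>\<gamma>0\<bar>) * - (1 / \<bar>\<gamma>0\<bar>)) (at \<tau> within {0..\<bar>\<gamma>0\<bar> * T})"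
      by (rule DERIV_image_chain)
    from DERIV_diff[OF DERIV_const this, of "\<xi> T"]
    show ?thesis by (simp add: o_def xi_lo_def[abs_def])
  qed
  have "holder_on (1/2) {0..\<bar>\<gamma>0\<bar> * T} (\<lambda>\<tau>. 1 / \<bar>\<gamma>0\<bar> * \<xi>' (T - \<tau> / \<bar>\<gamma>0\<bar>))"
  proof (intro holder_half_cmult holder_half_Lipschitz_comp[OF \<xi>'_holder, where M="1 / \<bar>\<gamma>0\<bar>"])
    show "dist (T - x / \<bar>\<gamma>0\<bar>) (T - y / \<bar>\<gamma>0\<bar>) \<le> 1 / \<bar>\<gamma>0\<bar> * dist x y" for x y
      using \<gamma>0_neg by (simp add: dist_real_def abs_minus_commute flip: diff_divide_distrib)
    show "(\<lambda>\<tau>. T - \<tau> / \<bar>\<gamma>0\<bar>) ` {0..\<bar>\<gamma>0\<bar> * T} \<subseteq> {0..T}" using im by blast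
  qed
  then show "holder_on (1/2) {0..\<bar>\<gamma>0\<bar> * T} (\<lambda>\<tau>. \<xi>' (T - \<tau> / \<bar>\<gamma>0\<bar>) / \<bar>\<gamma>0\<bar>)" by simp
qed

text \<open>Rescaling time by \<gamma>2 leaves the factor \<open>1 / sqrt \<gamma>2\<close>. The
  second term carries the part of \<xi>' m that is integrated against m'; its
  \<open>sqrt (t - s)\<close> undoes the Abel weight.\<close>

definition k1 :: "real \<Rightarrow> real \<Rightarrow> real" where
  "k1 t s = up.flux_kernel (\<gamma>2 * t) (\<gamma>2 * s) / (sqrt pi * sqrt \<gamma>2)
     - \<xi>' t * (1 / \<gamma>2 - 1 / \<gamma>0) * sqrt (t - s)"

text \<open>In reversed time the second kernel lives on the same triangle as the first, so one set
  of estimates serves both. The minus sign is the sign of \<gamma>0, by which m is divided in the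
  left boundary datum.\<close>

definition k2_reflected :: "real \<Rightarrow> real \<Rightarrow> real" where
  "k2_reflected t s = - (lo.flux_kernel (\<bar>\<gamma>0\<bar> * t) (\<bar>\<gamma>0\<bar> * s) / (sqrt pi * sqrt \<bar>\<gamma>0\<bar>))"

definition k2 :: "real \<Rightarrow> real \<Rightarrow> real" where
  "k2 t s = k2_reflected (T - t) (T - s)"

text \<open>The argument c stands for m 0, all that remains of m outside the integrals.\<close>

definition data_term :: "(real \<Rightarrow> real) \<Rightarrow> (real \<Rightarrow> real) \<Rightarrow> real \<Rightarrow> real \<Rightarrow> real" where
  "data_term v w c t = \<xi>' t * (c * (1 / \<gamma>2 - 1 / \<gamma>0) - \<delta>2 / \<gamma>2 + \<delta>0 / \<gamma>0)
     + \<bar>\<gamma>0\<bar> * lo.initial_flux (\<lambda>x. w (\<xi> T - x)) (\<bar>\<gamma>0\<bar> * (T - t)) + \<gamma>2 * up.initial_flux v (\<gamma>2 * t)"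

lemma scaled_holder:
  assumes "holder_on (1/2) (tri (c * T)) (case_prod k)" "c > 0"
  shows "holder_on (1/2) (tri T) (\<lambda>p. case_prod k (c * fst p, c * snd p))"
proof (rule holder_half_Lipschitz_comp[OF assms(1), where M="2 * c"])
  fix p q :: "real \<times> real"
  have "dist (c * fst p, c * snd p) (c * fst q, c * snd q) \<le> \<bar>c * fst p - c * fst q\<bar> + \<bar>c * snd p - c * snd q\<bar>"
    unfolding dist_prod_def by (simp add: dist_real_def sqrt_sum_squares_le_sum_abs[THEN order_trans])
  also have "\<dots> = c * dist (fst p) (fst q) + c * dist (snd p) (snd q)"
    using assms(2) by (simp add: dist_real_def abs_mult flip: right_diff_distrib)
  also have "\<dots> \<le> c * dist p q + c * dist p q"
    using assms(2) by (intro add_mono mult_left_mono dist_fst_le dist_snd_le) auto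
  finally show "dist (c * fst p, c * snd p) (c * fst q, c * snd q) \<le> 2 * c * dist p q" by simp
qed (use assms(2) in \<open>auto simp: tri_def\<close>)

lemma k1_holder: "holder_on (1/2) (tri T) (case_prod k1)"
proof -
  have 1: "holder_on (1/2) (tri T) (\<lambda>p. 1 / (sqrt pi * sqrt \<gamma>2) * case_prod up.flux_kernel (\<gamma>2 * fst p, \<gamma>2 * snd p))"
    by (intro holder_half_cmult scaled_holder up.flux_kernel_holder \<gamma>2_pos)
  have 2: "holder_on (1/2) (tri T) (\<lambda>p. \<xi>' (fst p))"
    by (rule holder_half_Lipschitz_comp[OF \<xi>'_holder, where M=1]) (auto simp: dist_fst_le tri_def)
  have 3: "holder_on (1/2) (tri T) (\<lambda>p. sqrt (fst p - snd p))"
  proof (rule holder_half_sqrt_comp)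
    fix p q :: "real \<times> real"
    show "\<bar>fst p - snd p - (fst q - snd q)\<bar> \<le> 2 * dist p q"
      using dist_fst_le[of p q] dist_snd_le[of p q] by (auto simp: dist_real_def)
  qed (auto simp: tri_def)
  have "holder_on (1/2) (tri T) (\<lambda>p. 1 / (sqrt pi * sqrt \<gamma>2) * case_prod up.flux_kernel (\<gamma>2 * fst p, \<gamma>2 * snd p)
      + (- (1 / \<gamma>2 - 1 / \<gamma>0)) * (\<xi>' (fst p) * sqrt (fst p - snd p)))"
    by (intro holder_half_add 1 holder_half_cmult holder_half_mult 2 3 bounded_tri)
  then show ?thesis by (rule holder_half_cong) (auto simp: k1_def algebra_simps)
qed

lemma k2_reflected_holder: "holder_on (1/2) (tri T) (case_prod k2_reflected)"
proof -
  have "holder_on (1/2) (tri T) (\<lambda>p. - (1 / (sqrt pi * sqrt \<bar>\<gamma>0\<bar>)) * case_prod lo.flux_kernel (\<bar>\<gamma>0\<bar> * fst p, \<bar>\<gamma>0\<bar> * snd p))"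
    by (intro holder_half_cmult scaled_holder lo.flux_kernel_holder) (use \<gamma>0_neg in auto)
  then show ?thesis by (rule holder_half_cong) (auto simp: k2_reflected_def)
qed

lemma data_term_holder:
  assumes v: "admissible v C V" and w: "admissible (\<lambda>x. w (\<xi> T - x)) C' V'"
  shows "holder_on (1/2) {0<..<T} (data_term v w c)"
proof -
  have "holder_on (1/2) {0<..<\<gamma>2 * T} (up.initial v)"
    by (rule up.initial_holder[where C=C and V=V]) (use v in \<open>auto simp: admissible_def\<close>)
  note u = up.initial_flux_holder[OF this]
  have "holder_on (1/2) {0<..<\<bar>\<gamma>0\<bar> * T} (lo.initial (\<lambda>x. w (\<xi> T - x)))"
    by (rule lo.initial_holder[where C=C' and V=V']) (use w in \<open>auto simp: admissible_def\<close>)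
  note l = lo.initial_flux_holder[OF this]
  have 1: "holder_on (1/2) {0<..<T} (\<lambda>t. up.initial_flux v (\<gamma>2 * t))"
    by (rule holder_half_Lipschitz_comp[OF u, where M=\<gamma>2])
      (use \<gamma>2_pos in \<open>auto simp: dist_real_def abs_mult simp flip: right_diff_distrib\<close>)
  have 2: "holder_on (1/2) {0<..<T} (\<lambda>t. lo.initial_flux (\<lambda>x. w (\<xi> T - x)) (\<bar>\<gamma>0\<bar> * (T - t)))"
    by (rule holder_half_Lipschitz_comp[OF l, where M="\<bar>\<gamma>0\<bar>"])
      (use \<gamma>0_neg in \<open>auto simp: dist_real_def abs_mult abs_minus_commute mult_neg_pos simp flip: right_diff_distrib\<close>)
  have 3: "holder_on (1/2) {0<..<T} \<xi>'"
    by (rule holder_half_subset[OF \<xi>'_holder]) auto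
  have "holder_on (1/2) {0<..<T} (\<lambda>t. (c * (1 / \<gamma>2 - 1 / \<gamma>0) - \<delta>2 / \<gamma>2 + \<delta>0 / \<gamma>0) * \<xi>' t
     + \<bar>\<gamma>0\<bar> * lo.initial_flux (\<lambda>x. w (\<xi> T - x)) (\<bar>\<gamma>0\<bar> * (T - t)) + \<gamma>2 * up.initial_flux v (\<gamma>2 * t))"
    by (intro holder_half_add holder_half_cmult 1 2 3)
  then show ?thesis by (rule holder_half_cong) (simp add: data_term_def)
qed

lemma RH_eq_iff_Abel_eq:
  assumes v: "admissible v C V" and w: "admissible (\<lambda>x. w (\<xi> T - x)) C' V'"
    and m: "\<And>x. x \<in> {0..T} \<Longrightarrow> (m has_real_derivative m' x) (at x within {0..T})"
    and m': "continuous_on {0..T} m'" and t: "0 < t" "t < T"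
  shows "RH_eq T \<gamma>0 \<gamma>2 \<delta>0 \<delta>2 \<xi> v w m t \<longleftrightarrow> Abel_eq T k1 k2 (data_term v w (m 0)) m t"
proof -
  define b where "b = \<bar>\<gamma>0\<bar>"
  have b: "b > 0" "\<gamma>0 = - b" using \<gamma>0_neg by (auto simp: b_def)
  define gp where "gp = (\<lambda>t. (m t - \<delta>2) / \<gamma>2)"
  define gm where "gm = (\<lambda>t. (m t - \<delta>0) / \<gamma>0)"
  define g2 where "g2 = (\<lambda>s. deriv gp (s / \<gamma>2) / \<gamma>2)"
  define g1 where "g1 = (\<lambda>s. deriv gm (T - s / \<bar>\<gamma>0\<bar>) / \<bar>\<gamma>0\<bar>)"
  let ?w = "\<lambda>x. w (\<xi> T - x)"
  \<comment> \<open>Outside [0, T] the function m is arbitrary, so \<open>deriv m\<close> says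
    nothing at the two endpoints. Hence the open intervals in all that follows.\<close>
  have dm: "(m has_real_derivative m' x) (at x)" if "0 < x" "x < T" for x
    using m[of x] that by (simp add: at_within_Icc_at)
  have dmm: "deriv m x = m' x" if "0 < x" "x < T" for x
    by (rule DERIV_imp_deriv[OF dm[OF that]])
  have dquot: "deriv (\<lambda>t. (m t - d) / c) x = m' x / c" if "0 < x" "x < T" for x d c
    using DERIV_imp_deriv[OF DERIV_cdivide[OF DERIV_diff[OF dm[OF that] DERIV_const], of d c]] by simp
  note dgp = dquot[of _ \<delta>2 \<gamma>2, folded gp_def] and dgm = dquot[of _ \<delta>0 \<gamma>0, folded gm_def]
  have m'_bdd: "\<exists>B. \<forall>x\<in>{0..T}. \<bar>m' x\<bar> \<le> B"
    using compact_imp_bounded[OF compact_continuous_image[OF m' compact_Icc]]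
    unfolding bounded_iff by auto
  then obtain B where B: "\<And>x. x \<in> {0..T} \<Longrightarrow> \<bar>m' x\<bar> \<le> B" by blast
  have in2: "0 < s / \<gamma>2 \<and> s / \<gamma>2 < T" if "0 < s" "s < \<gamma>2 * T" for s
    using that \<gamma>2_pos by (auto simp: field_simps)
  have in1: "0 < T - s / \<bar>\<gamma>0\<bar> \<and> T - s / \<bar>\<gamma>0\<bar> < T" if "0 < s" "s < \<bar>\<gamma>0\<bar> * T" for s
    using that b by (auto simp: field_simps)
  have g2_eq: "g2 s = m' (s / \<gamma>2) / \<gamma>2 / \<gamma>2" if "0 < s" "s < \<gamma>2 * T" for s
    unfolding g2_def using dgp in2[OF that] by simp
  have g1_eq: "g1 s = m' (T - s / \<bar>\<gamma>0\<bar>) / \<gamma>0 / \<bar>\<gamma>0\<bar>" if "0 < s" "s < \<bar>\<gamma>0\<bar> * T" for s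
    unfolding g1_def using dgm in1[OF that] by simp
  have meas2: "(\<lambda>x. indicator {0<..<\<gamma>2 * T} x * g2 x) \<in> borel_measurable borel"
  proof -
    have "continuous_on {0<..<\<gamma>2 * T} g2"
    proof (rule continuous_on_eq)
      show "continuous_on {0<..<\<gamma>2 * T} (\<lambda>s. m' (s / \<gamma>2) / \<gamma>2 / \<gamma>2)"
        using in2 \<gamma>2_pos by (intro continuous_intros continuous_on_compose2[OF m']) (auto simp: less_imp_le)
    qed (use g2_eq in auto)
    from borel_measurable_continuous_on_indicator[OF _ this] show ?thesis by simp
  qed
  have meas1: "(\<lambda>x. indicator {0<..<\<bar>\<gamma>0\<bar> * T} x * g1 x) \<in> borel_measurable borel"
  proof -
    have "continuous_on {0<..<\<bar>\<gamma>0\<bar> * T} g1"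
    proof (rule continuous_on_eq)
      show "continuous_on {0<..<\<bar>\<gamma>0\<bar> * T} (\<lambda>s. m' (T - s / \<bar>\<gamma>0\<bar>) / \<gamma>0 / \<bar>\<gamma>0\<bar>)"
        using in1 b by (intro continuous_intros continuous_on_compose2[OF m']) (auto simp: less_imp_le)
    qed (use g1_eq in auto)
    from borel_measurable_continuous_on_indicator[OF _ this] show ?thesis by simp
  qed
  have bd2: "\<bar>g2 x\<bar> \<le> B / \<gamma>2 / \<gamma>2" if "x \<in> {0<..<\<gamma>2 * T}" for x
    using that \<gamma>2_pos B[of "x / \<gamma>2"] in2[of x] by (simp add: g2_eq abs_mult divide_right_mono)
  have bd1: "\<bar>g1 x\<bar> \<le> B / \<bar>\<gamma>0\<bar> / \<bar>\<gamma>0\<bar>" if "x \<in> {0<..<\<bar>\<gamma>0\<bar> * T}" for x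
    using that b B[of "T - x / \<bar>\<gamma>0\<bar>"] in1[of x] by (simp add: g1_eq abs_mult divide_right_mono)
  have \<tau>2: "0 < \<gamma>2 * t" "\<gamma>2 * t < \<gamma>2 * T" using t \<gamma>2_pos by auto
  have \<tau>1: "0 < \<bar>\<gamma>0\<bar> * (T - t)" "\<bar>\<gamma>0\<bar> * (T - t) < \<bar>\<gamma>0\<bar> * T" using t b by auto
  have v': "(\<lambda>x. indicator {0<..} x * v x) \<in> borel_measurable borel"
     "\<And>x y. x > 0 \<Longrightarrow> y > 0 \<Longrightarrow> \<bar>v x - v y\<bar> \<le> C * \<bar>x - y\<bar>" "\<And>x. x > 0 \<Longrightarrow> \<bar>v x\<bar> \<le> V"
    using v by (auto simp: admissible_def)
  have w': "(\<lambda>x. indicator {0<..} x * ?w x) \<in> borel_measurable borel"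
     "\<And>x y. x > 0 \<Longrightarrow> y > 0 \<Longrightarrow> \<bar>?w x - ?w y\<bar> \<le> C' * \<bar>x - y\<bar>" "\<And>x. x > 0 \<Longrightarrow> \<bar>?w x\<bar> \<le> V'"
    using w by (auto simp: admissible_def)
  define I2 where "I2 = integral {0..\<gamma>2 * t} (\<lambda>r. up.flux_kernel (\<gamma>2 * t) r / sqrt (\<gamma>2 * t - r) * g2 r)"
  define I1 where "I1 = integral {0..\<bar>\<gamma>0\<bar> * (T - t)} (\<lambda>r. lo.flux_kernel (\<bar>\<gamma>0\<bar> * (T - t)) r / sqrt (\<bar>\<gamma>0\<bar> * (T - t) - r) * g1 r)"
  have up_int: "(\<lambda>r. up.flux_kernel (\<gamma>2 * t) r / sqrt (\<gamma>2 * t - r) * g2 r) integrable_on {0..\<gamma>2 * t}"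
    by (rule up.flux_formula(2)[OF v' meas2 bd2 \<tau>2])
  have lo_int: "(\<lambda>r. lo.flux_kernel (\<bar>\<gamma>0\<bar> * (T - t)) r / sqrt (\<bar>\<gamma>0\<bar> * (T - t) - r) * g1 r) integrable_on {0..\<bar>\<gamma>0\<bar> * (T - t)}"
    by (rule lo.flux_formula(2)[OF w' meas1 bd1 \<tau>1])
  define P2 where "P2 = integral {0..\<gamma>2 * t}
    (\<lambda>s. (Kker (xi_up \<xi> \<gamma>2) (\<gamma>2 * T) s (\<gamma>2 * t) + Gker (xi_up \<xi> \<gamma>2) (\<gamma>2 * T) (\<gamma>2 * t) s) * up.volterra_rhs v g2 s)"
  define P1 where "P1 = integral {0..\<bar>\<gamma>0\<bar> * (T - t)}
    (\<lambda>s. (Kker (xi_lo \<xi> T \<gamma>0) (\<bar>\<gamma>0\<bar> * T) s (\<bar>\<gamma>0\<bar> * (T - t)) + Gker (xi_lo \<xi> T \<gamma>0) (\<bar>\<gamma>0\<bar> * T) (\<bar>\<gamma>0\<bar> * (T - t)) s) * lo.volterra_rhs ?w g1 s)"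
  have up: "up.volterra_rhs v g2 (\<gamma>2 * t) / pi + 1 / pi\<^sup>2 * P2 = up.initial_flux v (\<gamma>2 * t) - 1 / sqrt pi * I2"
    unfolding P2_def I2_def by (rule up.flux_formula(1)[OF v' meas2 bd2 \<tau>2])
  have lo: "lo.volterra_rhs ?w g1 (\<bar>\<gamma>0\<bar> * (T - t)) / pi + 1 / pi\<^sup>2 * P1 = lo.initial_flux ?w (\<bar>\<gamma>0\<bar> * (T - t)) - 1 / sqrt pi * I1"
    unfolding P1_def I1_def by (rule lo.flux_formula(1)[OF w' meas1 bd1 \<tau>1])
  have N2: "N2fun \<xi> \<gamma>2 v gp = up.volterra_rhs v g2"
    by (simp add: fun_eq_iff N2fun_def up.volterra_rhs_def g2_def)
  \<comment> \<open>Both terms of N1 have the sign opposite to those of N2; one Volterra right-hand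
    side therefore covers both sides, up to this minus.\<close>
  have N1: "N1fun \<xi> T \<gamma>0 w gm = (\<lambda>\<tau>. - lo.volterra_rhs ?w g1 \<tau>)"
    by (simp add: fun_eq_iff N1fun_def lo.volterra_rhs_def g1_def algebra_simps)
  have RH: "RH_eq T \<gamma>0 \<gamma>2 \<delta>0 \<delta>2 \<xi> v w m t \<longleftrightarrow>
     \<xi>' t * ((m t - \<delta>2) / \<gamma>2 - (m t - \<delta>0) / \<gamma>0)
     = - \<bar>\<gamma>0\<bar> * (lo.initial_flux ?w (\<bar>\<gamma>0\<bar> * (T - t)) - 1 / sqrt pi * I1)
       - \<gamma>2 * (up.initial_flux v (\<gamma>2 * t) - 1 / sqrt pi * I2)"
  proof -
    have d: "deriv \<xi> t = \<xi>' t"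
      using \<xi>_deriv[of t] t by (intro DERIV_imp_deriv) (simp add: at_within_Icc_at)
    have P1_neg: "integral {0..\<bar>\<gamma>0\<bar> * (T - t)}
      (\<lambda>s. (Kker (xi_lo \<xi> T \<gamma>0) (\<bar>\<gamma>0\<bar> * T) s (\<bar>\<gamma>0\<bar> * (T - t)) + Gker (xi_lo \<xi> T \<gamma>0) (\<bar>\<gamma>0\<bar> * T) (\<bar>\<gamma>0\<bar> * (T - t)) s) * - lo.volterra_rhs ?w g1 s) = - P1"
      unfolding P1_def by (simp only: mult_minus_right Henstock_Kurzweil_Integration.integral_neg)
    show ?thesis
      unfolding RH_eq_def Let_def gp_def[symmetric] gm_def[symmetric] N1 N2 d P1_neg P2_def[symmetric]
        up[symmetric] lo[symmetric]
      by (simp add: algebra_simps)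
  qed
  have mt: "(m' has_integral (m t - m 0)) {0..t}"
  proof (rule fundamental_theorem_of_calculus)
    fix x assume x: "x \<in> {0..t}"
    have "(m has_real_derivative m' x) (at x within {0..t})"
      by (rule has_field_derivative_subset[OF m]) (use x t in auto)
    then show "(m has_vector_derivative m' x) (at x within {0..t})"
      by (simp add: has_real_derivative_iff_has_vector_derivative)
  qed (use t in simp)
  \<comment> \<open>The datum \<open>g2\<close> contributes \<open>1 / \<gamma>2^2\<close>, the
    square root \<open>1 / sqrt \<gamma>2\<close> and the Jacobian \<gamma>2; the factor here
    inverts their product.\<close>
  define A2 where "A2 = I2 * \<gamma>2 * sqrt \<gamma>2"
  have A2: "((\<lambda>s. up.flux_kernel (\<gamma>2 * t) (\<gamma>2 * s) / sqrt (t - s) * m' s) has_integral A2) {0..t}"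
  proof -
    have "((\<lambda>r. up.flux_kernel (\<gamma>2 * t) r / sqrt (\<gamma>2 * t - r) * g2 r) has_integral I2) {0..\<gamma>2 * t}"
      unfolding I2_def by (rule integrable_integral[OF up_int])
    from has_integral_mult_right[OF has_integral_scale[OF this \<gamma>2_pos], of "\<gamma>2 * \<gamma>2 * sqrt \<gamma>2"]
    have "((\<lambda>s. \<gamma>2 * \<gamma>2 * sqrt \<gamma>2 * (up.flux_kernel (\<gamma>2 * t) (\<gamma>2 * s) / sqrt (\<gamma>2 * t - \<gamma>2 * s) * g2 (\<gamma>2 * s))) has_integral A2) {0..t}"
      using \<gamma>2_pos by (simp add: A2_def mult_ac)
    then show ?thesis
    proof (rule has_integral_spike_interior[where a=0 and b=t, unfolded cbox_interval])
      fix s assume "s \<in> box 0 t"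
      then have s: "0 < s" "s < t" by (auto simp: box_real)
      have "sqrt (\<gamma>2 * t - \<gamma>2 * s) = sqrt \<gamma>2 * sqrt (t - s)"
        by (simp add: real_sqrt_mult flip: right_diff_distrib)
      moreover have "g2 (\<gamma>2 * s) = m' s / \<gamma>2 / \<gamma>2"
        using g2_eq[of "\<gamma>2 * s"] s t \<gamma>2_pos by simp
      ultimately show "up.flux_kernel (\<gamma>2 * t) (\<gamma>2 * s) / sqrt (t - s) * m' s =
        \<gamma>2 * \<gamma>2 * sqrt \<gamma>2 * (up.flux_kernel (\<gamma>2 * t) (\<gamma>2 * s) / sqrt (\<gamma>2 * t - \<gamma>2 * s) * g2 (\<gamma>2 * s))"
        using \<gamma>2_pos by simp
    qed
  qed
  \<comment> \<open>As for \<open>A2\<close>, except that \<open>g1\<close> contributes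
    \<open>1 / (\<gamma>0 * b)\<close>; after the Jacobian b the negative factor \<gamma>0
    \<open>sqrt b\<close> remains.\<close>
  define A1 where "A1 = I1 * \<gamma>0 * sqrt b"
  have A1: "((\<lambda>s. lo.flux_kernel (\<bar>\<gamma>0\<bar> * (T - t)) (\<bar>\<gamma>0\<bar> * (T - s)) / sqrt (s - t) * m' s) has_integral A1) {t..T}"
  proof -
    have "((\<lambda>r. lo.flux_kernel (\<bar>\<gamma>0\<bar> * (T - t)) r / sqrt (\<bar>\<gamma>0\<bar> * (T - t) - r) * g1 r) has_integral I1) {0..\<bar>\<gamma>0\<bar> * (T - t)}"
      unfolding I1_def by (rule integrable_integral[OF lo_int])
    from has_integral_mult_right[OF has_integral_reflect_scale[OF this], of "\<gamma>0 * b * sqrt b"]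
    have "((\<lambda>s. \<gamma>0 * b * sqrt b * (lo.flux_kernel (\<bar>\<gamma>0\<bar> * (T - t)) (\<bar>\<gamma>0\<bar> * (T - s)) / sqrt (\<bar>\<gamma>0\<bar> * (T - t) - \<bar>\<gamma>0\<bar> * (T - s)) * g1 (\<bar>\<gamma>0\<bar> * (T - s)))) has_integral A1) {t..T}"
      using b by (simp add: A1_def mult_ac)
    then show ?thesis
    proof (rule has_integral_spike_interior[where a=t and b=T, unfolded cbox_interval])
      fix s assume "s \<in> box t T"
      then have s: "t < s" "s < T" by (auto simp: box_real)
      have "sqrt (\<bar>\<gamma>0\<bar> * (T - t) - \<bar>\<gamma>0\<bar> * (T - s)) = sqrt (b * (s - t))"
        by (simp add: b_def algebra_simps)
      also have "\<dots> = sqrt b * sqrt (s - t)" by (rule real_sqrt_mult)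
      finally have 1: "sqrt (\<bar>\<gamma>0\<bar> * (T - t) - \<bar>\<gamma>0\<bar> * (T - s)) = sqrt b * sqrt (s - t)" .
      have 2: "g1 (\<bar>\<gamma>0\<bar> * (T - s)) = m' s / \<gamma>0 / b"
        using g1_eq[of "\<bar>\<gamma>0\<bar> * (T - s)"] s t b by simp
      show "lo.flux_kernel (\<bar>\<gamma>0\<bar> * (T - t)) (\<bar>\<gamma>0\<bar> * (T - s)) / sqrt (s - t) * m' s =
        \<gamma>0 * b * sqrt b * (lo.flux_kernel (\<bar>\<gamma>0\<bar> * (T - t)) (\<bar>\<gamma>0\<bar> * (T - s)) / sqrt (\<bar>\<gamma>0\<bar> * (T - t) - \<bar>\<gamma>0\<bar> * (T - s)) * g1 (\<bar>\<gamma>0\<bar> * (T - s)))"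
        unfolding 1 2 using b by simp
    qed
  qed
  define e where "e = 1 / \<gamma>2 - 1 / \<gamma>0"
  have J1: "integral {0..t} (\<lambda>s. k1 t s / sqrt (t - s) * deriv m s) = A2 / (sqrt pi * sqrt \<gamma>2) - \<xi>' t * e * (m t - m 0)"
  proof -
    have "integral {0..t} (\<lambda>s. k1 t s / sqrt (t - s) * deriv m s)
      = integral {0..t} (\<lambda>s. 1 / (sqrt pi * sqrt \<gamma>2) * (up.flux_kernel (\<gamma>2 * t) (\<gamma>2 * s) / sqrt (t - s) * m' s) - (\<xi>' t * e) * m' s)"
      by (rule integral_cong_Ioo) (use t in \<open>auto simp: k1_def e_def dmm diff_divide_distrib left_diff_distrib\<close>)
    also have "\<dots> = 1 / (sqrt pi * sqrt \<gamma>2) * A2 - (\<xi>' t * e) * (m t - m 0)"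
      by (intro integral_unique has_integral_diff has_integral_mult_right A2 mt)
    finally show ?thesis by simp
  qed
  have J2: "integral {t..T} (\<lambda>s. k2 t s / sqrt (s - t) * deriv m s) = - A1 / (sqrt pi * sqrt b)"
  proof -
    have "integral {t..T} (\<lambda>s. k2 t s / sqrt (s - t) * deriv m s)
      = integral {t..T} (\<lambda>s. - (1 / (sqrt pi * sqrt b)) * (lo.flux_kernel (\<bar>\<gamma>0\<bar> * (T - t)) (\<bar>\<gamma>0\<bar> * (T - s)) / sqrt (s - t) * m' s))"
      by (rule integral_cong_Ioo) (use t in \<open>auto simp: k2_def k2_reflected_def b_def dmm\<close>)
    also have "\<dots> = - (1 / (sqrt pi * sqrt b)) * A1"
      by (intro integral_unique has_integral_mult_right A1)
    finally show ?thesis by simp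
  qed
  have A2': "A2 / (sqrt pi * sqrt \<gamma>2) = \<gamma>2 * I2 / sqrt pi"
    using \<gamma>2_pos by (simp add: A2_def)
  have A1': "- A1 / (sqrt pi * sqrt b) = b * I1 / sqrt pi"
    using b by (simp add: A1_def)
  have lhs: "(m t - \<delta>2) / \<gamma>2 - (m t - \<delta>0) / \<gamma>0 = e * (m t - m 0) + (m 0 * e - \<delta>2 / \<gamma>2 + \<delta>0 / \<gamma>0)"
    by (simp add: e_def diff_divide_distrib algebra_simps)
  show ?thesis
    unfolding RH Abel_eq_def J1 J2 A1' A2' data_term_def e_def[symmetric] lhs b_def[symmetric]
    by (simp add: algebra_simps) linarith
qed

end

text \<open>The isometry \<phi> is the identity for the initial datum and the reflection K - x for
  the terminal one. Boundedness of the slope combines its integrability with the Lipschitz bound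
  from the second derivative.\<close>

lemma admissible_deriv:
  assumes u: "C2_open S u" and S: "open S" "convex S"
    and i: "deriv u absolutely_integrable_on S" and bd: "bounded (deriv (deriv u) ` S)"
    and \<phi>: "continuous_on {0<..} \<phi>" "\<And>x. x > 0 \<Longrightarrow> \<phi> x \<in> S"
    and iso: "\<And>x y. \<bar>\<phi> x - \<phi> y\<bar> = \<bar>x - y\<bar>"
    and unit: "\<And>x. x \<in> S \<Longrightarrow> \<exists>a. {a..a + 1} \<subseteq> S \<and> x \<in> {a..a + 1}"
  shows "\<exists>C V. admissible (\<lambda>x. deriv u (\<phi> x)) C V"
proof -
  obtain C where C: "C \<ge> 0" "\<And>x y. x \<in> S \<Longrightarrow> y \<in> S \<Longrightarrow> \<bar>deriv u x - deriv u y\<bar> \<le> C * \<bar>x - y\<bar>"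
    using C2_open_deriv_Lipschitz[OF u S(2) bd] by blast
  have "continuous_on S (deriv u)"
    using u unfolding C2_open_def
    by (intro differentiable_imp_continuous_on differentiable_at_imp_differentiable_on) auto
  then have "continuous_on {0<..} (\<lambda>x. deriv u (\<phi> x))"
    by (rule continuous_on_compose2[OF _ \<phi>(1)]) (use \<phi>(2) in auto)
  from borel_measurable_continuous_on_indicator[OF _ this]
  have "(\<lambda>x. indicator {0<..} x * deriv u (\<phi> x)) \<in> borel_measurable borel" by simp
  moreover have "\<bar>deriv u (\<phi> x) - deriv u (\<phi> y)\<bar> \<le> C * \<bar>x - y\<bar>" if "x > 0" "y > 0" for x y
    using C(2)[OF \<phi>(2) \<phi>(2), OF that] by (simp add: iso)
  moreover have "\<bar>deriv u (\<phi> x)\<bar> \<le> integral S (\<lambda>y. \<bar>deriv u y\<bar>) + C" if x: "x > 0" for x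
  proof -
    obtain a where "{a..a + 1} \<subseteq> S" "\<phi> x \<in> {a..a + 1}" using unit[OF \<phi>(2)[OF x]] by blast
    from Lipschitz_integrable_bounded[OF i C(2) C(1) this] show ?thesis .
  qed
  ultimately show ?thesis unfolding admissible_def by blast
qed

lemma admissible_right:
  assumes "C2_open {0<..} u" "deriv u absolutely_integrable_on {0<..}" "bounded (deriv (deriv u) ` {0<..})"
  shows "\<exists>C V. admissible (deriv u) C V"
proof (rule admissible_deriv[OF assms(1) _ _ assms(2,3)])
  show "\<exists>a. {a..a + 1} \<subseteq> {0<..} \<and> x \<in> {a..a + 1}" if "x \<in> {0<..}" for x :: real
    using that by (intro exI[of _ x]) auto
qed auto

lemma admissible_left:
  assumes "C2_open {..<K} u" "deriv u absolutely_integrable_on {..<K}" "bounded (deriv (deriv u) ` {..<K})"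
  shows "\<exists>C V. admissible (\<lambda>x. deriv u (K - x)) C V"
proof (rule admissible_deriv[OF assms(1) _ _ assms(2,3)])
  show "\<exists>a. {a..a + 1} \<subseteq> {..<K} \<and> x \<in> {a..a + 1}" if "x \<in> {..<K}" for x
    using that by (intro exI[of _ "x - 1"]) auto
qed (auto intro!: continuous_intros)

section \<open>Extension to the closed domains and conclusion\<close>

theorem theorem3p12:
  fixes T \<gamma>0 \<gamma>2 \<delta>0 \<delta>2 \<beta> :: real and \<xi> :: "real \<Rightarrow> real"
  assumes "T > 0" and "\<gamma>0 < 0" and "0 < \<gamma>2"
    and "C1b_on \<beta> 0 T \<xi>" and "\<beta> > 1/2"
    and "\<forall>x y. 0 \<le> x \<and> x \<le> y \<and> y \<le> T \<longrightarrow> \<xi> y \<le> \<xi> x"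
    and "\<xi> 0 = 0" and "\<xi> T \<le> 0"
  shows "\<exists>(k1 :: real \<Rightarrow> real \<Rightarrow> real) (k2 :: real \<Rightarrow> real \<Rightarrow> real)
           (hh :: (real \<Rightarrow> real) \<Rightarrow> (real \<Rightarrow> real) \<Rightarrow> real \<Rightarrow> real \<Rightarrow> real).
     holder_on (1/2) {(t, s). 0 \<le> s \<and> s \<le> t \<and> t \<le> T} (\<lambda>p. k1 (fst p) (snd p))
   \<and> holder_on (1/2) ({0..T} \<times> {0..T} - {(t, s). 0 < s \<and> s < t \<and> t < T}) (\<lambda>p. k2 (fst p) (snd p))
   \<and> (\<forall>u0 uT :: real \<Rightarrow> real.
        C2_open {0<..} u0 \<and> bounded (u0 ` {0<..})
        \<and> deriv u0 absolutely_integrable_on {0<..} \<and> bounded (deriv (deriv u0) ` {0<..})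
        \<and> C2_open {..<\<xi> T} uT
        \<and> deriv uT absolutely_integrable_on {..<\<xi> T} \<and> bounded (deriv (deriv uT) ` {..<\<xi> T})
        \<longrightarrow> (\<forall>c. holder_on (1/2) {0..T} (hh (deriv u0) (deriv uT) c))
          \<and> (\<forall>m. C1_on 0 T m \<longrightarrow>
               ((\<forall>t\<in>{0<..<T}. RH_eq T \<gamma>0 \<gamma>2 \<delta>0 \<delta>2 \<xi> (deriv u0) (deriv uT) m t)
                \<longleftrightarrow> (\<forall>t\<in>{0<..<T}. Abel_eq T k1 k2 (hh (deriv u0) (deriv uT) (m 0)) m t))))"
proof -
  obtain \<xi>' where \<xi>': "\<And>x. x \<in> {0..T} \<Longrightarrow> (\<xi> has_real_derivative \<xi>' x) (at x within {0..T})"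
    and \<xi>'h: "holder_on \<beta> {0..T} \<xi>'"
    using assms(4) unfolding C1b_on_def by blast
  have \<xi>'half: "holder_on (1/2) {0..T} \<xi>'"
    by (rule holder_on_imp_holder_half[OF \<xi>'h]) (use assms(5) in auto)
  interpret D: free_boundary_data T \<gamma>0 \<gamma>2 \<delta>0 \<delta>2 \<xi> \<xi>'
    by unfold_locales (use assms \<xi>' \<xi>'half in auto)
  let ?\<Delta> = "{(t, s). 0 \<le> s \<and> s \<le> t \<and> t \<le> T}"
  obtain K1 where K1: "holder_on (1/2) (closure (tri T)) K1" "\<And>p. p \<in> tri T \<Longrightarrow> K1 p = case_prod D.k1 p"
    using holder_half_extend[OF D.k1_holder] by blast
  obtain K2 where K2: "holder_on (1/2) (closure (tri T)) K2" "\<And>p. p \<in> tri T \<Longrightarrow> K2 p = case_prod D.k2_reflected p"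
    using holder_half_extend[OF D.k2_reflected_holder] by blast
  define k1 where "k1 t s = K1 (t, s)" for t s
  \<comment> \<open>only \<open>t \<le> s\<close> matters; \<open>min\<close> extends \<open>k2\<close> to the rest of the square\<close>
  define k2 where "k2 t s = K2 (T - min t s, T - s)" for t s
  \<comment> \<open>\<open>data_term\<close> determines h inside the interval and the choice picks a
    Hoelder extension to the endpoints. As a function of v, w and c alone, \<open>hh\<close>
    expresses that h depends only on u0', uT' and m 0.\<close>
  define hh where "hh v w c = (SOME f. holder_on (1/2) {0..T} f \<and> (\<forall>t\<in>{0<..<T}. f t = D.data_term v w c t))" for v w c
  have k1: "holder_on (1/2) ?\<Delta> (\<lambda>p. k1 (fst p) (snd p))"
    using holder_half_subset[OF K1(1) closed_triangle_subset_closure[OF assms(1)]] by (simp add: k1_def)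
  have k2: "holder_on (1/2) ({0..T} \<times> {0..T} - {(t, s). 0 < s \<and> s < t \<and> t < T}) (\<lambda>p. k2 (fst p) (snd p))"
  proof -
    have "holder_on (1/2) ({0..T} \<times> {0..T}) (\<lambda>p. K2 ((\<lambda>p. (T - min (fst p) (snd p), T - snd p)) p))"
    proof (rule holder_half_Lipschitz_comp[OF K2(1), where M=3])
      fix p q :: "real \<times> real"
      have "dist (T - min (fst p) (snd p), T - snd p) (T - min (fst q) (snd q), T - snd q)
        \<le> \<bar>(T - min (fst p) (snd p)) - (T - min (fst q) (snd q))\<bar> + \<bar>(T - snd p) - (T - snd q)\<bar>"
        unfolding dist_prod_def by (simp add: dist_real_def sqrt_sum_squares_le_sum_abs[THEN order_trans])
      also have "\<dots> \<le> 3 * dist p q"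
        using dist_fst_le[of p q] dist_snd_le[of p q] unfolding dist_real_def by linarith
      finally show "dist (T - min (fst p) (snd p), T - snd p) (T - min (fst q) (snd q), T - snd q) \<le> 3 * dist p q" .
    next
      show "(\<lambda>p. (T - min (fst p) (snd p), T - snd p)) ` ({0..T} \<times> {0..T}) \<subseteq> closure (tri T)"
        by (rule order_trans[OF _ closed_triangle_subset_closure[OF assms(1)]]) auto
    qed
    from holder_half_subset[OF this] show ?thesis by (simp add: k2_def)
  qed
  \<comment> \<open>Agreement inside the open triangles is enough, since the Abel integrals ignore
    endpoints.\<close>
  have k1_eq: "k1 t s = D.k1 t s" if "0 < s" "s < t" "t < T" for t s
    using K1(2)[of "(t, s)"] that by (simp add: k1_def)
  have k2_eq: "k2 t s = D.k2 t s" if "0 < t" "t < s" "s < T" for t s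
    using K2(2)[of "(T - t, T - s)"] that by (simp add: k2_def D.k2_def)
  show ?thesis
  proof (intro exI[of _ k1] exI[of _ k2] exI[of _ hh] conjI k1 k2 allI impI; elim conjE)
    fix u0 uT :: "real \<Rightarrow> real"
    assume u0: "C2_open {0<..} u0" "deriv u0 absolutely_integrable_on {0<..}" "bounded (deriv (deriv u0) ` {0<..})"
      and uT: "C2_open {..<\<xi> T} uT" "deriv uT absolutely_integrable_on {..<\<xi> T}" "bounded (deriv (deriv uT) ` {..<\<xi> T})"
    obtain C V where v: "admissible (deriv u0) C V"
      using admissible_right[OF u0] by blast
    obtain C' V' where w: "admissible (\<lambda>x. deriv uT (\<xi> T - x)) C' V'"
      using admissible_left[OF uT] by blast
    have hh: "holder_on (1/2) {0..T} (hh (deriv u0) (deriv uT) c)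
      \<and> (\<forall>t\<in>{0<..<T}. hh (deriv u0) (deriv uT) c t = D.data_term (deriv u0) (deriv uT) c t)" for c
    proof -
      have "closure {0<..<T} = {0..T}" using assms(1) by simp
      then have "\<exists>f. holder_on (1/2) {0..T} f \<and> (\<forall>t\<in>{0<..<T}. f t = D.data_term (deriv u0) (deriv uT) c t)"
        using holder_half_extend[OF D.data_term_holder[OF v w, of c]] by simp
      then show ?thesis unfolding hh_def by (rule someI_ex)
    qed
    show "holder_on (1/2) {0..T} (hh (deriv u0) (deriv uT) c)" for c using hh by blast
    fix m assume "C1_on 0 T m"
    then obtain m' where m': "\<And>x. x \<in> {0..T} \<Longrightarrow> (m has_real_derivative m' x) (at x within {0..T})" "continuous_on {0..T} m'"
      unfolding C1_on_def by blast
    have "RH_eq T \<gamma>0 \<gamma>2 \<delta>0 \<delta>2 \<xi> (deriv u0) (deriv uT) m t \<longleftrightarrow> Abel_eq T k1 k2 (hh (deriv u0) (deriv uT) (m 0)) m t"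
      if t: "t \<in> {0<..<T}" for t
    proof -
      have "integral {0..t} (\<lambda>s. k1 t s / sqrt (t - s) * deriv m s) = integral {0..t} (\<lambda>s. D.k1 t s / sqrt (t - s) * deriv m s)"
        by (rule integral_cong_Ioo) (use t k1_eq in auto)
      moreover have "integral {t..T} (\<lambda>s. k2 t s / sqrt (s - t) * deriv m s) = integral {t..T} (\<lambda>s. D.k2 t s / sqrt (s - t) * deriv m s)"
        by (rule integral_cong_Ioo) (use t k2_eq in auto)
      ultimately have "Abel_eq T k1 k2 (hh (deriv u0) (deriv uT) (m 0)) m t
          \<longleftrightarrow> Abel_eq T D.k1 D.k2 (D.data_term (deriv u0) (deriv uT) (m 0)) m t"
        using hh t unfolding Abel_eq_def by simp
      then show ?thesis using D.RH_eq_iff_Abel_eq[OF v w m'] t by simp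
    qed
    then show "(\<forall>t\<in>{0<..<T}. RH_eq T \<gamma>0 \<gamma>2 \<delta>0 \<delta>2 \<xi> (deriv u0) (deriv uT) m t)
                \<longleftrightarrow> (\<forall>t\<in>{0<..<T}. Abel_eq T k1 k2 (hh (deriv u0) (deriv uT) (m 0)) m t)"
      by blast
  qed
qed

end
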